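(* There exist functions $f(n_1,n_2)$ and $\delta(n_1,n_2)$ with $$f(n_1,n_2)=\mathcal{O}\!\left(\frac{(n_1+n_2)(\log(n_1n_2))^2}{n_1n_2}\right),\qquad \delta(n_1,n_2)=\mathcal{O}\!\left(\frac{\log(n_1n_2)}{(n_1+n_2)^2}\right)\qquad (n_1,n_2\to\infty)$$ such that the following holds. Let $n_1,n_2\ge 2$, let $\mathbf{M}\in\mathbb{R}^{n_1\times n_2}$ have rank $r\ge 1$, let $C\in\mathbb{R}$, and assume $\rho_{\mathrm F}<\frac12$, $\rho_{\mathrm{op}}<\frac14$, $\rho_\infty<\frac12$, $\nu_{\mathcal B}<\frac12$. Let $p\in[0,1]$ with $p\ge \frac{1}{n_1n_2}$, and let $\Omega$ be generated by the sampling scheme described in the context with parameter $p$. If $$p\ \ge\ \min\bigl\{1,\ c_\rho\,\max(\mu_1^2,\mu_0)\, r\, f(n_1,n_2)\bigr\},$$ where $$c_\rho=\max\left\{\frac{24}{(1/2-\rho_{\mathrm F})^2},\ \frac{8}{(1/4-\rho_{\mathrm{op}})^2},\ \frac{8}{(1/2-\rho_\infty)^2},\ \frac{8}{(1/2-\nu_{\mathcal B})^2}\right\},$$ then with probability at least $1-\delta(n_1,n_2)$ the trace-norm minimization problem $$\min_{\mathbf{X}\in\mathbb{R}^{n_1\times n_2}}\|\mathbf{X}\|_{\mathrm{tr}}\quad\text{s.t.}\quad X_{ij}=M^{\mathrm c}_{ij}\ \text{ for } (i,j)\in\Omega\setminus\mathcal{C},\qquad X_{ij}\ge M^{\mathrm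 c}_{ij}\ \text{ for }(i,j)\in\mathcal{C}$$ has a unique solution, and it is equal to $\mathbf{M}$.
   Context: Norms on matrices: $\|\cdot\|_{\mathrm{tr}}$ (trace/nuclear norm), $\|\cdot\|_{\mathrm{op}}$ (operator/spectral norm), $\|\cdot\|_{\mathrm F}$ (Frobenius), $\|\cdot\|_\infty$ (entrywise maximum absolute value). For linear operators on $\mathbb{R}^{n_1\times n_2}$, $\|\cdot\|_{\mathrm{op}}$ is the operator norm induced by the Frobenius norm. $[n]=\{1,\dots,n\}$. For an index set $\mathcal S$, $\mathcal{P}_{\mathcal S}$ sets to zero all entries outside $\mathcal S$. Clipping: $\mathbf{M}^{\mathrm c}$ has entries $M^{\mathrm c}_{ij}=\min\{C,M_{ij}\}$. $\Omega\subset[n_1]\times[n_2]$ is the set of observed indices, $\mathcal{C}=\{(i,j)\in\Omega: M^{\mathrm c}_{ij}=C\}$, and $\mathcal{B}=\{(i,j):M_{ij}<C\}$. Let $\mathbf{M}=\mathbf{U}\mathbf{\Sigma}\mathbf{V}^\top$ be a skinny SVD ($\mathbf U\in\mathbb{R}^{n_1\times r}$, $\mathbf V\in\mathbb{R}^{n_2\times r}$), with columns $\bm u_k,\bm v_k$ of $\mathbf U,\mathbf V$. Coherence: $\mu_0=\max\{\frac{n_1}{r}\max_{i}\|\mathbf U_{i,\cdot}\|^2,\ \frac{n_2}{r}\max_j\|\mathbf V_{j,\cdot}\|^2\}$ (Euclidean norms of rows). Joint coherence: $\mu_1=\sqrt{\frac{n_1n_2}{r}}\,\|\mathbf U\mathbf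 V^\top\|_\infty$. $T=\mathrm{span}\bigl(\{\bm u_k\bm y^\top:k\in[r],\bm y\in\mathbb{R}^{n_2}\}\cup\{\bm x\bm v_k^\top:k\in[r],\bm x\in\mathbb{R}^{n_1}\}\bigr)$, and $\mathcal{P}_T$ is the orthogonal projection onto $T$. The (nonlinear) operator $\mathcal{P}^*:\mathbb{R}^{n_1\times n_2}\to\mathbb{R}^{n_1\times n_2}$: $(\mathcal{P}^*(\mathbf Z))_{ij}=Z_{ij}$ if $M_{ij}<C$; $=\max\{Z_{ij},0\}$ if $M_{ij}=C$; $=0$ otherwise. $$\rho_{\mathrm F}=\sup_{\mathbf Z\in T\setminus\{0\}:\|\mathbf Z\|_{\mathrm F}\le\|\mathbf U\mathbf V^\top\|_{\mathrm F}}\frac{\|\mathcal P_T\mathcal P^*(\mathbf Z)-\mathbf Z\|_{\mathrm F}}{\|\mathbf Z\|_{\mathrm F}},\quad \rho_\infty=\sup_{\mathbf Z\in T\setminus\{0\}:\|\mathbf Z\|_\infty\le\|\mathbf U\mathbf V^\top\|_\infty}\frac{\|\mathcal P_T\mathcal P^*(\mathbf Z)-\mathbf Z\|_\infty}{\|\mathbf Z\|_\infty},$$ $$\rho_{\mathrm{op}}=\sqrt r\,\mu_1\sup_{\mathbf Z\in T\setminus\{0\}:\|\mathbf Z\|_{\mathrm{op}}\le\sqrt{n_1n_2}\|\mathbf U\mathbf V^\top\|_{\mathrm{op}}}\frac{\|\mathcal P^*(\mathbf Z)-\mathbf Z\|_{\mathrm{op}}}{\|\mathbf Z\|_{\mathrm{op}}},\quad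 \nu_{\mathcal B}=\|\mathcal P_T\mathcal P_{\mathcal B}\mathcal P_T-\mathcal P_T\|_{\mathrm{op}}.$$ Sampling scheme with parameter $p$: let $k_0=\lceil\log_2(2\sqrt2\sqrt{n_1n_2r})\rceil$ and $q=1-(1-p)^{1/k_0}$. For $k=1,\dots,k_0$ the random sets $\Omega_k\subset[n_1]\times[n_2]$ contain each index $(i,j)$ with probability $q$, all these events (over $k,i,j$) being independent; $\Omega=\bigcup_{k=1}^{k_0}\Omega_k$. *)

theory Defs
  imports
    "HOL-Probability.Product_PMF"
    "HOL-Library.Landau_Symbols"
    "Jordan_Normal_Form.Char_Poly"
    "Jordan_Normal_Form.DL_Rank"
begin

text \<open>
  The bounds \<open>f\<close> and \<open>\<delta>\<close> are chosen before the dimensions, so matrices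
  are those of Jordan Normal Form, with carriers \<open>carrier_mat n1 n2\<close>; indices start at \<open>0\<close>.
  HOL-Analysis has constants with the same short names, hence the qualified \<open>Matrix.mat\<close> etc.
\<close>

subsection \<open>Norms\<close>

definition vnorm :: "real vec \<Rightarrow> real" where
  "vnorm v = sqrt (scalar_prod v v)"

definition mat_inner :: "real mat \<Rightarrow> real mat \<Rightarrow> real" where
  "mat_inner A B = (\<Sum>i<dim_row A. \<Sum>j<dim_col A. A $$ (i, j) * B $$ (i, j))"

definition frob_norm :: "real mat \<Rightarrow> real" where
  "frob_norm A = sqrt (mat_inner A A)"

definition max_norm :: "real mat \<Rightarrow> real" where
  "max_norm A = Max (abs ` elements_mat A)"

definition spec_norm :: "real mat \<Rightarrow> real" where
  "spec_norm A = (SUP x\<in>{x \<in> carrier_vec (dim_col A). vnorm x \<le> 1}. vnorm (A *\<^sub>v x))"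

text \<open>The sum of the singular values: the square roots of the eigenvalues of the positive
  semidefinite matrix \<open>A\<^sup>T A\<close>, with multiplicity. Zero eigenvalues contribute nothing.\<close>

definition trace_norm :: "real mat \<Rightarrow> real" where
  "trace_norm A = (\<Sum>x\<in>#proots (char_poly (transpose_mat A * A)). sqrt x)"

definition operator_norm :: "nat \<Rightarrow> nat \<Rightarrow> (real mat \<Rightarrow> real mat) \<Rightarrow> real" where
  "operator_norm n1 n2 L = (SUP Z\<in>{Z \<in> carrier_mat n1 n2. frob_norm Z \<le> 1}. frob_norm (L Z))"

subsection \<open>Singular value decomposition, coherence, tangent space\<close>

definition skinny_svd :: "real mat \<Rightarrow> nat \<Rightarrow> real mat \<Rightarrow> real mat \<Rightarrow> real mat \<Rightarrow> bool" where
  "skinny_svd M r U S V \<longleftrightarrow>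
     U \<in> carrier_mat (dim_row M) r \<and> S \<in> carrier_mat r r \<and> V \<in> carrier_mat (dim_col M) r \<and>
     transpose_mat U * U = 1\<^sub>m r \<and> transpose_mat V * V = 1\<^sub>m r \<and>
     diagonal_mat S \<and> (\<forall>k<r. S $$ (k, k) > 0) \<and>
     M = U * S * transpose_mat V"

definition coherence :: "real mat \<Rightarrow> real mat \<Rightarrow> real" where
  "coherence U V =
     max (real (dim_row U) / real (dim_col U) * (MAX i\<in>{..<dim_row U}. (vnorm (Matrix.row U i))\<^sup>2))
         (real (dim_row V) / real (dim_col V) * (MAX j\<in>{..<dim_row V}. (vnorm (Matrix.row V j))\<^sup>2))"

definition joint_coherence :: "real mat \<Rightarrow> real mat \<Rightarrow> real" where
  "joint_coherence U V =
     sqrt (real (dim_row U) * real (dim_row V) / real (dim_col U)) * max_norm (U * transpose_mat V)"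

definition outer :: "real vec \<Rightarrow> real vec \<Rightarrow> real mat" where
  "outer x y = Matrix.mat (dim_vec x) (dim_vec y) (\<lambda>(i, j). vec_index x i * vec_index y j)"

definition tangent :: "real mat \<Rightarrow> real mat \<Rightarrow> real mat set" where
  "tangent U V =
     LinearCombinations.module.span class_ring (module_mat TYPE(real) (dim_row U) (dim_row V))
       ({outer (col U k) y | k y. k < dim_col U \<and> y \<in> carrier_vec (dim_row V)} \<union>
        {outer x (col V k) | k x. k < dim_col V \<and> x \<in> carrier_vec (dim_row U)})"

definition orth_proj :: "real mat set \<Rightarrow> real mat \<Rightarrow> real mat" where
  "orth_proj T Z = (THE W. W \<in> T \<and> (\<forall>Y\<in>T. mat_inner (Z - W) Y = 0))"

abbreviation proj_T :: "real mat \<Rightarrow> real mat \<Rightarrow> real mat \<Rightarrow> real mat" where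
  "proj_T U V \<equiv> orth_proj (tangent U V)"

subsection \<open>Clipping and the information-loss quantities\<close>

definition clip :: "real \<Rightarrow> real mat \<Rightarrow> real mat" where
  "clip C M = map_mat (min C) M"

definition clipped_obs :: "real \<Rightarrow> real mat \<Rightarrow> (nat \<times> nat) set \<Rightarrow> (nat \<times> nat) set" where
  "clipped_obs C M \<Omega> = {ij \<in> \<Omega>. clip C M $$ ij = C}"

definition below_ceiling :: "real \<Rightarrow> real mat \<Rightarrow> (nat \<times> nat) set" where
  "below_ceiling C M = {(i, j). i < dim_row M \<and> j < dim_col M \<and> M $$ (i, j) < C}"

definition proj_entries :: "(nat \<times> nat) set \<Rightarrow> real mat \<Rightarrow> real mat" where
  "proj_entries S Z = Matrix.mat (dim_row Z) (dim_col Z) (\<lambda>ij. if ij \<in> S then Z $$ ij else 0)"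

definition P_star :: "real \<Rightarrow> real mat \<Rightarrow> real mat \<Rightarrow> real mat" where
  "P_star C M Z = Matrix.mat (dim_row Z) (dim_col Z)
     (\<lambda>ij. if M $$ ij < C then Z $$ ij else if M $$ ij = C then max (Z $$ ij) 0 else 0)"

definition rho_F :: "real \<Rightarrow> real mat \<Rightarrow> real mat \<Rightarrow> real mat \<Rightarrow> real" where
  "rho_F C M U V =
     (SUP Z\<in>{Z \<in> tangent U V. Z \<noteq> 0\<^sub>m (dim_row U) (dim_row V) \<and>
               frob_norm Z \<le> frob_norm (U * transpose_mat V)}.
        frob_norm (proj_T U V (P_star C M Z) - Z) / frob_norm Z)"

definition rho_inf :: "real \<Rightarrow> real mat \<Rightarrow> real mat \<Rightarrow> real mat \<Rightarrow> real" where
  "rho_inf C M U V =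
     (SUP Z\<in>{Z \<in> tangent U V. Z \<noteq> 0\<^sub>m (dim_row U) (dim_row V) \<and>
               max_norm Z \<le> max_norm (U * transpose_mat V)}.
        max_norm (proj_T U V (P_star C M Z) - Z) / max_norm Z)"

definition rho_op :: "real \<Rightarrow> real mat \<Rightarrow> real mat \<Rightarrow> real mat \<Rightarrow> real" where
  "rho_op C M U V =
     sqrt (real (dim_col U)) * joint_coherence U V *
     (SUP Z\<in>{Z \<in> tangent U V. Z \<noteq> 0\<^sub>m (dim_row U) (dim_row V) \<and>
               spec_norm Z \<le> sqrt (real (dim_row U) * real (dim_row V)) * spec_norm (U * transpose_mat V)}.
        spec_norm (P_star C M Z - Z) / spec_norm Z)"

definition nu_B :: "real \<Rightarrow> real mat \<Rightarrow> real mat \<Rightarrow> real mat \<Rightarrow> real" where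
  "nu_B C M U V = operator_norm (dim_row U) (dim_row V)
     (\<lambda>Z. proj_T U V (proj_entries (below_ceiling C M) (proj_T U V Z)) - proj_T U V Z)"

definition c_rho :: "real \<Rightarrow> real mat \<Rightarrow> real mat \<Rightarrow> real mat \<Rightarrow> real" where
  "c_rho C M U V = Max
     {24 / (1/2 - rho_F C M U V)\<^sup>2, 8 / (1/4 - rho_op C M U V)\<^sup>2,
      8 / (1/2 - rho_inf C M U V)\<^sup>2, 8 / (1/2 - nu_B C M U V)\<^sup>2}"

subsection \<open>Random observation pattern\<close>

definition rounds :: "nat \<Rightarrow> nat \<Rightarrow> nat \<Rightarrow> nat" where
  "rounds n1 n2 r = nat \<lceil>log 2 (2 * sqrt 2 * sqrt (real n1 * real n2 * real r))\<rceil>"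

definition round_prob :: "nat \<Rightarrow> nat \<Rightarrow> nat \<Rightarrow> real \<Rightarrow> real" where
  "round_prob n1 n2 r p = 1 - (1 - p) powr (1 / real (rounds n1 n2 r))"

text \<open>The coordinate \<open>\<omega> (k, i, j)\<close> is the indicator of \<open>(i, j) \<in> \<Omega>\<^sub>k\<close>; under \<open>Pi_pmf\<close> the
  coordinates are independent.\<close>

definition sampling :: "nat \<Rightarrow> nat \<Rightarrow> nat \<Rightarrow> real \<Rightarrow> (nat \<times> nat) set pmf" where
  "sampling n1 n2 r p =
     map_pmf (\<lambda>\<omega>. \<Union>k\<in>{1..rounds n1 n2 r}. {(i, j). i < n1 \<and> j < n2 \<and> \<omega> (k, i, j)})
       (Pi_pmf ({1..rounds n1 n2 r} \<times> {..<n1} \<times> {..<n2}) False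
          (\<lambda>_. bernoulli_pmf (round_prob n1 n2 r p)))"

subsection \<open>Trace-norm minimization\<close>

definition feasible :: "real \<Rightarrow> real mat \<Rightarrow> (nat \<times> nat) set \<Rightarrow> real mat \<Rightarrow> bool" where
  "feasible C M \<Omega> X \<longleftrightarrow>
     X \<in> carrier_mat (dim_row M) (dim_col M) \<and>
     (\<forall>ij\<in>\<Omega> - clipped_obs C M \<Omega>. X $$ ij = clip C M $$ ij) \<and>
     (\<forall>ij\<in>clipped_obs C M \<Omega>. X $$ ij \<ge> clip C M $$ ij)"

definition solutions :: "real \<Rightarrow> real mat \<Rightarrow> (nat \<times> nat) set \<Rightarrow> real mat set" where
  "solutions C M \<Omega> = {X. is_arg_min trace_norm (feasible C M \<Omega>) X}"

end

theory Submission
  imports Defs "HOL-Analysis.Function_Topology"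
begin

text \<open>
  \<open>M\<close> is the unique minimizer as soon as there is a \<open>y\<close> supported on \<open>\<Omega>\<close>, with the sign pattern of
  \<open>P_star\<close>, such that \<open>P_T y\<close> is close to \<open>U V\<^sup>T\<close> in Frobenius norm and \<open>y - P_T y\<close> has spectral norm below
  \<open>1/2\<close>, provided the uncensored samples determine the tangential part of a perturbation up to a
  polynomial factor. Such a \<open>y\<close> is built by golfing: starting from \<open>W = U V\<^sup>T\<close>, each round adds
  \<open>q\<^sup>-\<^sup>1\<close> times the sampled part of \<open>P_star W\<close>, which halves the Frobenius and the maximum norm of
  the residual \<open>W\<close>; the quantities \<open>rho\<close> bound the expected step, and fresh randomness bounds the deviation.
  The first round alone gives the injectivity on the tangent space.

  The matrix concentration needs no matrix exponentials. For vectors \<open>w_i\<close> with \<open>\<Sum> w_i w_i\<^sup>T \<le> 1\<close> and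
  \<open>X = \<Sum> (\<delta>_i / q - 1) w_i w_i\<^sup>T\<close>, conditioning on one \<open>\<delta>_i\<close> at a time turns \<open>E tr X\<^sup>2\<^sup>p\<close> into a sum of
  differences of \<open>w_i\<^sup>T X\<^sup>2\<^sup>p\<^sup>-\<^sup>1 w_i\<close> under rank-one updates. Comparing eigenbases bounds these by even
  powers, and \<open>w_i w_i\<^sup>T\<close> sums back to \<open>X + 1\<close> at most, so \<open>E tr X\<^sup>2\<^sup>p\<close> is bounded by
  \<open>(2p - 1) \<nu> (E tr X\<^sup>2\<^sup>p\<^sup>-\<^sup>1 + 2 E tr X\<^sup>2\<^sup>p\<^sup>-\<^sup>2)\<close>. Taking \<open>p\<close> logarithmic in the dimension gives a Chernoff bound,
  which also covers rectangular matrices through their symmetric dilation.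
\<close>

section \<open>Spectral theorem for real symmetric kernels\<close>

text \<open>\<open>P_star\<close> is nonlinear, so the residuals are not the iterates of a linear
  map and contraction cannot be read off one operator norm. \<open>rho_F\<close>,
  \<open>rho_inf\<close> and \<open>rho_op\<close> speak only about tangent matrices of bounded
  size, so each round has to keep its residual inside their domains. The maximum norm also feeds the
  spectral estimate: round \<open>k\<close> works at scale \<open>2^-k\<close> and costs at most
  \<open>2^-k / 4\<close> in spectral norm, less than \<open>1/2\<close> in total. The other half of
  the budget pays for the tangential mismatch, the last Frobenius residual times the injectivity
  factor \<open>sqrt (2 / q)\<close>; this explains \<open>2 sqrt 2 sqrt (n1 n2 r)\<close> under the
  logarithm in the number of rounds. An expected step uses up \<open>rho\<close> and leaves
  \<open>1/2 - rho\<close> or \<open>1/4 - rho_op\<close> to the deviation, whence the denominators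
  in \<open>c_rho\<close>. Vectors are functions read only on a finite index set of arbitrary type.
  One spectral theory thus serves columns, cells and disjoint unions of indices, and operator norms
  become bounds on bilinear forms.\<close>

definition ip :: "'j set \<Rightarrow> ('j \<Rightarrow> real) \<Rightarrow> ('j \<Rightarrow> real) \<Rightarrow> real" where
  "ip J u v = (\<Sum>i\<in>J. u i * v i)"

definition orthonormal :: "'j set \<Rightarrow> nat \<Rightarrow> (nat \<Rightarrow> 'j \<Rightarrow> real) \<Rightarrow> bool" where
  "orthonormal J k x \<longleftrightarrow> (\<forall>a<k. \<forall>b<k. ip J (x a) (x b) = (if a = b then 1 else 0))"

definition app :: "'j set \<Rightarrow> ('j \<Rightarrow> 'j \<Rightarrow> real) \<Rightarrow> ('j \<Rightarrow> real) \<Rightarrow> 'j \<Rightarrow> real" where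
  "app J K u i = (\<Sum>j\<in>J. K i j * u j)"

definition eigenbasis ::
    "'j set \<Rightarrow> ('j \<Rightarrow> 'j \<Rightarrow> real) \<Rightarrow> (nat \<Rightarrow> real) \<Rightarrow> (nat \<Rightarrow> 'j \<Rightarrow> real) \<Rightarrow> bool" where
  "eigenbasis J K lam x \<longleftrightarrow>
     orthonormal J (card J) x \<and> (\<forall>a<card J. \<forall>i\<in>J. app J K (x a) i = lam a * x a i)"

lemma ip_commute: "ip J u v = ip J v u"
  by (simp add: ip_def mult.commute)

lemma ip_add_right: "ip J u (\<lambda>i. v i + w i) = ip J u v + ip J u w"
  by (simp add: ip_def algebra_simps sum.distrib)

lemma ip_diff_right: "ip J u (\<lambda>i. v i - w i) = ip J u v - ip J u w"
  by (simp add: ip_def algebra_simps sum_subtractf)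

lemma ip_scale_right: "ip J u (\<lambda>i. c * v i) = c * ip J u v"
  by (simp add: ip_def sum_distrib_left algebra_simps)

lemma ip_sum_right: "ip J u (\<lambda>i. \<Sum>b\<in>B. f b i) = (\<Sum>b\<in>B. ip J u (f b))"
  unfolding ip_def sum_distrib_left by (rule sum.swap)

lemma ip_add_left: "ip J (\<lambda>i. v i + w i) u = ip J v u + ip J w u"
  by (simp add: ip_def algebra_simps sum.distrib)

lemma ip_diff_left: "ip J (\<lambda>i. v i - w i) u = ip J v u - ip J w u"
  by (simp add: ip_def algebra_simps sum_subtractf)

lemma ip_scale_left: "ip J (\<lambda>i. c * v i) u = c * ip J v u"
  by (simp add: ip_def sum_distrib_left algebra_simps)

lemma ip_sum_left: "ip J (\<lambda>i. \<Sum>b\<in>B. f b i) u = (\<Sum>b\<in>B. ip J (f b) u)"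
  by (subst ip_commute, subst ip_sum_right) (simp add: ip_commute)

lemmas ip_linear = ip_add_right ip_diff_right ip_scale_right ip_sum_right
  ip_add_left ip_diff_left ip_scale_left ip_sum_left

lemma ip_cong: "(\<And>i. i \<in> J \<Longrightarrow> u i = u' i) \<Longrightarrow> (\<And>i. i \<in> J \<Longrightarrow> v i = v' i) \<Longrightarrow> ip J u v = ip J u' v'"
  by (simp add: ip_def)

lemma ip_self: "ip J u u = (\<Sum>i\<in>J. (u i)\<^sup>2)"
  by (simp add: ip_def power2_eq_square)

lemma ip_self_nonneg: "0 \<le> ip J u u"
  by (simp add: ip_self sum_nonneg)

lemma ip_self_zero: "finite J \<Longrightarrow> ip J u u = 0 \<Longrightarrow> i \<in> J \<Longrightarrow> u i = 0"
  by (simp add: ip_self sum_nonneg_eq_0_iff)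

lemma ip_Cauchy_Schwarz: "(ip J u v)\<^sup>2 \<le> ip J u u * ip J v v"
  unfolding ip_self by (simp add: ip_def Cauchy_Schwarz_ineq_sum)

lemma ip_indicator: "finite J \<Longrightarrow> i \<in> J \<Longrightarrow> ip J (\<lambda>j. if j = i then 1 else 0) u = u i"
  by (simp add: ip_def if_distrib if_distribR sum.delta cong: if_cong)

lemma ip_app_commute:
  assumes "\<And>i j. i \<in> J \<Longrightarrow> j \<in> J \<Longrightarrow> K i j = K j i"
  shows "ip J u (app J K v) = ip J (app J K u) v"
proof -
  have "ip J u (app J K v) = (\<Sum>i\<in>J. \<Sum>j\<in>J. u i * K i j * v j)"
    by (simp add: ip_def app_def sum_distrib_left mult.assoc)
  also have "\<dots> = (\<Sum>j\<in>J. \<Sum>i\<in>J. u i * K i j * v j)" by (rule sum.swap)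
  also have "\<dots> = (\<Sum>j\<in>J. \<Sum>i\<in>J. K j i * u i * v j)"
    using assms by (intro sum.cong refl) (simp add: mult.commute)
  also have "\<dots> = ip J (app J K u) v" by (simp add: ip_def app_def sum_distrib_right)
  finally show ?thesis .
qed

text \<open>\<open>r\<close> is the coordinate vector of \<open>i\<close> minus its projection onto
  the span of the \<open>x b\<close>. It is orthogonal to that span, so its squared norm is its own
  \<open>i\<close>-th entry.\<close>

lemma orthonormal_residual:
  fixes x :: "nat \<Rightarrow> 'j \<Rightarrow> real"
  assumes fin: "finite J" and on: "orthonormal J k x" and i: "i \<in> J"
  defines "r \<equiv> \<lambda>j. (if j = i then 1 else 0) - (\<Sum>b<k. x b i * x b j)"
  shows "\<And>a. a < k \<Longrightarrow> ip J r (x a) = 0" and "ip J r r = 1 - (\<Sum>b<k. (x b i)\<^sup>2)"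
proof -
  show orth: "ip J r (x a) = 0" if "a < k" for a
  proof -
    have "ip J r (x a) = x a i - (\<Sum>b<k. x b i * ip J (x b) (x a))"
      unfolding r_def by (simp add: ip_linear ip_indicator[OF fin i])
    also have "(\<Sum>b<k. x b i * ip J (x b) (x a)) = (\<Sum>b<k. if b = a then x b i else 0)"
      using on that by (intro sum.cong refl) (auto simp: orthonormal_def)
    also have "\<dots> = x a i" using that by simp
    finally show ?thesis by simp
  qed
  have "ip J r r = ip J r (\<lambda>j. if j = i then 1 else 0) - (\<Sum>b<k. x b i * ip J r (x b))"
    by (subst (2) r_def) (simp add: ip_linear)
  also have "\<dots> = r i" using orth by (simp add: ip_commute[of J r] ip_indicator[OF fin i])
  finally show "ip J r r = 1 - (\<Sum>b<k. (x b i)\<^sup>2)" by (simp add: r_def power2_eq_square)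
qed

lemma orthonormal_sum_squares:
  assumes "orthonormal J k x"
  shows "(\<Sum>i\<in>J. \<Sum>b<k. (x b i)\<^sup>2) = real k"
proof -
  have "(\<Sum>i\<in>J. \<Sum>b<k. (x b i)\<^sup>2) = (\<Sum>b<k. ip J (x b) (x b))"
    unfolding ip_self by (rule sum.swap)
  then show ?thesis using assms by (simp add: orthonormal_def)
qed

text \<open>The squared norms of the residuals of all coordinate vectors add up to
  \<open>card J - card J = 0\<close>, so every residual vanishes. This replaces any appeal to
  dimension.\<close>

lemma orthonormal_complete:
  fixes x :: "nat \<Rightarrow> 'j \<Rightarrow> real"
  assumes fin: "finite J" and on: "orthonormal J (card J) x" and ij: "i \<in> J" "j \<in> J"
  shows "(\<Sum>b<card J. x b i * x b j) = (if i = j then 1 else 0)"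
proof -
  define r where "r i = (\<lambda>j. (if j = i then 1 else 0) - (\<Sum>b<card J. x b i * x b j))" for i
  have rr: "ip J (r i) (r i) = 1 - (\<Sum>b<card J. (x b i)\<^sup>2)" if "i \<in> J" for i
    using orthonormal_residual(2)[OF fin on that] by (simp add: r_def)
  have "(\<Sum>i\<in>J. ip J (r i) (r i)) = (\<Sum>i\<in>J. 1 - (\<Sum>b<card J. (x b i)\<^sup>2))"
    by (intro sum.cong refl) (simp add: rr)
  also have "\<dots> = 0" by (simp add: sum_subtractf orthonormal_sum_squares[OF on])
  finally have "ip J (r i) (r i) = 0"
    using fin ij by (simp add: sum_nonneg_eq_0_iff ip_self_nonneg)
  from ip_self_zero[OF fin this ij(2)] show ?thesis by (simp add: r_def split: if_splits)
qed

lemma parseval: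
  assumes fin: "finite J" and on: "orthonormal J (card J) x"
  shows "(\<Sum>a<card J. ip J (x a) u * ip J (x a) v) = ip J u v"
proof -
  have "(\<Sum>a<card J. ip J (x a) u * ip J (x a) v)
      = (\<Sum>a<card J. \<Sum>i\<in>J. \<Sum>j\<in>J. x a i * x a j * u i * v j)"
    by (simp add: ip_def sum_product algebra_simps)
  also have "\<dots> = (\<Sum>i\<in>J. \<Sum>a<card J. \<Sum>j\<in>J. x a i * x a j * u i * v j)" by (rule sum.swap)
  also have "\<dots> = (\<Sum>i\<in>J. \<Sum>j\<in>J. \<Sum>a<card J. x a i * x a j * u i * v j)"
    by (intro sum.cong refl sum.swap)
  also have "\<dots> = (\<Sum>i\<in>J. \<Sum>j\<in>J. (\<Sum>a<card J. x a i * x a j) * (u i * v j))"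
    by (simp add: sum_distrib_right mult.assoc)
  also have "\<dots> = (\<Sum>i\<in>J. \<Sum>j\<in>J. (if i = j then 1 else 0) * (u i * v j))"
    by (intro sum.cong refl) (simp add: orthonormal_complete[OF fin on])
  also have "\<dots> = ip J u v"
    using fin by (simp add: ip_def if_distribR if_distrib[of "\<lambda>c. c * _"] cong: if_cong)
  finally show ?thesis .
qed

text \<open>By averaging: the squared lengths of the projected coordinate vectors sum to
  \<open>k < card J\<close>, so one of them is below 1 and has a nonzero residual.\<close>

lemma orthonormal_extend_exists:
  fixes x :: "nat \<Rightarrow> 'j \<Rightarrow> real"
  assumes fin: "finite J" and on: "orthonormal J k x" and k: "k < card J"
  shows "\<exists>u. ip J u u > 0 \<and> (\<forall>b<k. ip J u (x b) = 0)"
proof -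
  have "\<exists>i\<in>J. (\<Sum>b<k. (x b i)\<^sup>2) < 1"
  proof (rule ccontr)
    assume "\<not> ?thesis"
    then have "(\<Sum>i\<in>J. 1) \<le> (\<Sum>i\<in>J. \<Sum>b<k. (x b i)\<^sup>2)" by (intro sum_mono) auto
    then show False using orthonormal_sum_squares[OF on] k by simp
  qed
  then obtain i where i: "i \<in> J" "(\<Sum>b<k. (x b i)\<^sup>2) < 1" by blast
  let ?r = "\<lambda>j. (if j = i then 1 else 0) - (\<Sum>b<k. x b i * x b j)"
  have "0 < ip J ?r ?r" using orthonormal_residual(2)[OF fin on i(1)] i(2) by simp
  moreover have "\<forall>b<k. ip J ?r (x b) = 0" using orthonormal_residual(1)[OF fin on i(1)] by blast
  ultimately show ?thesis by blast
qed

text \<open>Tychonoff for functions on the whole index type. Coordinates outside \<open>J\<close>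
  are pinned to 0, so the type itself may be infinite.\<close>

lemma compact_unit_box:
  "compact {u :: 'j \<Rightarrow> real. \<forall>i. u i \<in> (if i \<in> J then {-1..1} else {0})}"
proof -
  have "compactin (product_topology (\<lambda>_. euclidean) UNIV)
      (PiE (UNIV :: 'j set) (\<lambda>i. if i \<in> J then {-1..1::real} else {0}))"
    by (subst compactin_PiE) auto
  also have "PiE (UNIV :: 'j set) (\<lambda>i. if i \<in> J then {-1..1::real} else {0})
      = {u. \<forall>i. u i \<in> (if i \<in> J then {-1..1} else {0})}"
    by (auto simp: PiE_def Pi_def)
  finally show ?thesis by (simp add: euclidean_product_topology)
qed

text \<open>First-order condition at a minimum: for small \<open>t\<close> of sign opposite to
  \<open>b\<close> the linear term would win. It replaces differentiation of the Rayleigh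
  quotient.\<close>

lemma nonneg_parabola_slope:
  fixes b c :: real
  assumes "\<And>t. 0 \<le> t * b + t\<^sup>2 * c"
  shows "b = 0"
proof (rule ccontr)
  assume b: "b \<noteq> 0"
  define t where "t = - b / (\<bar>c\<bar> + 1)"
  have "t * b + t\<^sup>2 * c \<le> t * b + t\<^sup>2 * \<bar>c\<bar>" by (intro add_left_mono mult_left_mono) auto
  also have "\<dots> = - b\<^sup>2 / (\<bar>c\<bar> + 1)\<^sup>2"
  proof -
    define d where "d = \<bar>c\<bar> + 1"
    then have d: "d > 0" "\<bar>c\<bar> = d - 1" by auto
    show ?thesis unfolding t_def d_def[symmetric] d(2)
      using d(1) by (simp add: field_simps power2_eq_square)
  qed
  also have "\<dots> < 0" using b by (simp add: divide_neg_pos zero_less_power2 add_pos_nonneg)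
  finally show False using assms[of t] by simp
qed

text \<open>The next eigenvector maximizes the Rayleigh quotient on the orthogonal complement of the
  previous ones.\<close>

lemma eigenvector_extend:
  fixes x :: "nat \<Rightarrow> 'j \<Rightarrow> real"
  assumes fin: "finite J" and sym: "\<And>i j. i \<in> J \<Longrightarrow> j \<in> J \<Longrightarrow> K i j = K j i"
    and on: "orthonormal J k x" and k: "k < card J"
    and ev: "\<And>a i. a < k \<Longrightarrow> i \<in> J \<Longrightarrow> app J K (x a) i = lam a * x a i"
  shows "\<exists>v l. ip J v v = 1 \<and> (\<forall>b<k. ip J v (x b) = 0) \<and> (\<forall>i\<in>J. app J K v i = l * v i)"
proof -
  define qf where "qf u = ip J u (app J K u)" for u
  define S where "S = {u :: 'j \<Rightarrow> real. \<forall>i. u i \<in> (if i \<in> J then {-1..1} else {0})} \<inter>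
    ({u. ip J u u = 1} \<inter> (\<Inter>b\<in>{..<k}. {u. ip J u (x b) = 0}))"
  have cont: "continuous_on UNIV (\<lambda>u :: 'j \<Rightarrow> real. u i)" for i
    by (rule continuous_on_product_coordinates)
  have contS: "continuous_on A qf" for A
    unfolding qf_def ip_def app_def
    by (intro continuous_intros continuous_on_subset[OF cont subset_UNIV])
  have "compact S" unfolding S_def
  proof (rule compact_Int_closed[OF compact_unit_box], intro closed_Int closed_INT ballI)
    show "closed {u :: 'j \<Rightarrow> real. ip J u u = 1}"
      unfolding ip_def by (intro closed_Collect_eq continuous_intros cont)
    show "closed {u :: 'j \<Rightarrow> real. ip J u (x b) = 0}" for b
      unfolding ip_def by (intro closed_Collect_eq continuous_intros cont)
  qed
  \<comment> \<open>Besides scaling, the vector is cut to 0 outside \<open>J\<close>; neither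
    \<open>ip J\<close> nor \<open>app J\<close> notices the cut, but membership in \<open>S\<close>
    requires it.\<close>
  have normalize: "\<exists>c > 0. c\<^sup>2 * ip J u u = 1 \<and> (\<lambda>i. if i \<in> J then c * u i else 0) \<in> S"
    if u: "ip J u u > 0" "\<forall>b<k. ip J u (x b) = 0" for u
  proof (intro exI conjI)
    define c where "c = 1 / sqrt (ip J u u)"
    show "c > 0" using u by (simp add: c_def)
    show c2: "c\<^sup>2 * ip J u u = 1" using u by (simp add: c_def power_divide)
    define v where "v i = (if i \<in> J then c * u i else 0)" for i
    have ipv: "ip J v w = c * ip J u w" for w
      by (simp add: v_def ip_def sum_distrib_left mult.assoc)
    have vv: "ip J v v = 1"
      using c2 by (simp add: ipv ip_commute[of J u v] power2_eq_square)
    have "(v i)\<^sup>2 \<le> 1" if "i \<in> J" for i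
      using member_le_sum[of i J "\<lambda>i. (v i)\<^sup>2"] fin that vv by (simp add: ip_self)
    then have "\<bar>v i\<bar> \<le> 1" if "i \<in> J" for i using that by (simp add: abs_square_le_1)
    then have "\<forall>i. v i \<in> (if i \<in> J then {-1..1} else {0})"
      by (auto simp: v_def abs_le_iff)
    then show "(\<lambda>i. if i \<in> J then c * u i else 0) \<in> S"
      using vv u by (simp add: S_def ipv flip: v_def)
  qed
  have "S \<noteq> {}" using orthonormal_extend_exists[OF fin on k] normalize by blast
  from continuous_attains_sup[OF \<open>compact S\<close> this contS]
  obtain v where v: "v \<in> S" and vmax: "\<And>u. u \<in> S \<Longrightarrow> qf u \<le> qf v" by blast
  define l where "l = qf v"
  have vv: "ip J v v = 1" and vx: "\<forall>b<k. ip J v (x b) = 0" using v by (auto simp: S_def)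
  have app_scale: "app J K (\<lambda>i. c * u i) = (\<lambda>i. c * app J K u i)" for c u
    by (simp add: app_def fun_eq_iff sum_distrib_left algebra_simps)
  have app_add: "app J K (\<lambda>i. u i + w i) = (\<lambda>i. app J K u i + app J K w i)" for u w
    by (simp add: app_def fun_eq_iff sum.distrib algebra_simps)
  have bound: "qf u \<le> l * ip J u u" if u: "\<forall>b<k. ip J u (x b) = 0" for u
  proof (cases "ip J u u = 0")
    case True
    then have "qf u = 0" using ip_self_zero[OF fin True] by (simp add: qf_def ip_def)
    then show ?thesis using True by simp
  next
    case False
    then have pos: "ip J u u > 0" using ip_self_nonneg[of J u] by linarith
    from normalize[OF this u] obtain c where c: "c > 0" "c\<^sup>2 * ip J u u = 1"
      and "(\<lambda>i. if i \<in> J then c * u i else 0) \<in> S" by blast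
    then have "qf (\<lambda>i. if i \<in> J then c * u i else 0) \<le> l" using vmax by (simp add: l_def)
    also have "qf (\<lambda>i. if i \<in> J then c * u i else 0) = qf (\<lambda>i. c * u i)"
      unfolding qf_def ip_def app_def by (intro sum.cong) auto
    also have "\<dots> = c\<^sup>2 * qf u"
      by (simp add: qf_def app_scale ip_linear power2_eq_square)
    finally have "c\<^sup>2 * qf u \<le> c\<^sup>2 * (l * ip J u u)" using c(2) by (simp add: mult.left_commute)
    then show ?thesis using c(1) by simp
  qed
  define y where "y = (\<lambda>i. app J K v i - l * v i)"
  have stationary: "ip J u y = 0" if u: "\<forall>b<k. ip J u (x b) = 0" for u
  proof -
    \<comment> \<open>Optimality of \<open>v\<close> tested along \<open>v + t * u\<close>; the
      constant terms cancel because \<open>v\<close> has norm 1 and value \<open>l\<close>.\<close>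
    have "0 \<le> t * (2 * l * ip J u v - 2 * ip J u (app J K v)) + t\<^sup>2 * (l * ip J u u - qf u)" for t
    proof -
      have "qf (\<lambda>i. v i + t * u i) \<le> l * ip J (\<lambda>i. v i + t * u i) (\<lambda>i. v i + t * u i)"
        using u vx by (intro bound) (simp add: ip_linear)
      also have "qf (\<lambda>i. v i + t * u i) = l + 2 * t * ip J u (app J K v) + t\<^sup>2 * qf u"
      proof -
        have "ip J v (app J K u) = ip J u (app J K v)"
          using ip_app_commute[of J K v u, OF sym] by (simp add: ip_commute)
        then show ?thesis
          by (simp add: qf_def l_def app_add app_scale ip_linear power2_eq_square algebra_simps)
      qed
      also have "ip J (\<lambda>i. v i + t * u i) (\<lambda>i. v i + t * u i) = 1 + 2 * t * ip J u v + t\<^sup>2 * ip J u u"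
        using ip_commute[of J u v] by (simp add: ip_linear vv power2_eq_square algebra_simps)
      finally show ?thesis by (simp add: algebra_simps)
    qed
    from nonneg_parabola_slope[OF this] show ?thesis by (simp add: y_def ip_linear)
  qed
  have "ip J y (x b) = 0" if b: "b < k" for b
  proof -
    have "ip J (app J K v) (x b) = ip J v (app J K (x b))"
      using ip_app_commute[of J K v "x b", OF sym] by simp
    also have "\<dots> = ip J v (\<lambda>i. lam b * x b i)" by (rule ip_cong) (simp_all add: ev b)
    finally show ?thesis using vx b by (simp add: y_def ip_linear)
  qed
  \<comment> \<open>Symmetry of \<open>K\<close> makes \<open>y\<close> orthogonal to the earlier
    eigenvectors, so \<open>y\<close> is itself an admissible direction and is orthogonal to
    itself.\<close>
  then have "ip J y y = 0" by (intro stationary) simp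
  from ip_self_zero[OF fin this] have "\<forall>i\<in>J. app J K v i = l * v i" by (simp add: y_def)
  then show ?thesis using vv vx by blast
qed

theorem spectral_theorem:
  fixes K :: "'j \<Rightarrow> 'j \<Rightarrow> real"
  assumes fin: "finite J" and sym: "\<And>i j. i \<in> J \<Longrightarrow> j \<in> J \<Longrightarrow> K i j = K j i"
  obtains lam x where "eigenbasis J K lam x"
proof -
  have "\<exists>lam x. orthonormal J k x \<and> (\<forall>a<k. \<forall>i\<in>J. app J K (x a) i = lam a * x a i)"
    if "k \<le> card J" for k
    using that
  proof (induction k)
    case 0
    then show ?case by (auto simp: orthonormal_def)
  next
    case (Suc k)
    then obtain lam x where on: "orthonormal J k x"
      and ev: "\<And>a i. a < k \<Longrightarrow> i \<in> J \<Longrightarrow> app J K (x a) i = lam a * x a i" by auto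
    have k: "k < card J" using Suc.prems by simp
    have "\<exists>v l. ip J v v = 1 \<and> (\<forall>b<k. ip J v (x b) = 0) \<and> (\<forall>i\<in>J. app J K v i = l * v i)"
      by (rule eigenvector_extend[where K = K and lam = lam and x = x, OF fin _ on k]) (fact sym ev)+
    then obtain v l where
      v: "ip J v v = 1" "\<forall>b<k. ip J v (x b) = 0" "\<forall>i\<in>J. app J K v i = l * v i" by (elim exE conjE)
    have "\<forall>b<k. ip J (x b) v = 0" using v(2) by (metis ip_commute)
    then have "orthonormal J (Suc k) (x(k := v))"
      using on v by (auto simp: orthonormal_def less_Suc_eq)
    moreover have "\<forall>a<Suc k. \<forall>i\<in>J. app J K ((x(k := v)) a) i = (lam(k := l)) a * (x(k := v)) a i"
      using ev v by (auto simp: less_Suc_eq)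
    ultimately show ?case by blast
  qed
  from this[of "card J"] show ?thesis using that by (auto simp: eigenbasis_def)
qed

section \<open>Moments of sums of independent rank-one matrices\<close>

definition nrm :: "'j set \<Rightarrow> ('j \<Rightarrow> real) \<Rightarrow> real" where
  "nrm J u = sqrt (ip J u u)"

text \<open>Operator norm at most \<open>s\<close>, phrased through the bilinear form so that no
  supremum has to be formed or shown to be finite.\<close>

definition op_bound :: "'j set \<Rightarrow> ('j \<Rightarrow> 'j \<Rightarrow> real) \<Rightarrow> real \<Rightarrow> bool" where
  "op_bound J K s \<longleftrightarrow> (\<forall>u v. \<bar>ip J u (app J K v)\<bar> \<le> s * nrm J u * nrm J v)"

lemma nrm_nonneg: "0 \<le> nrm J u"
  by (simp add: nrm_def ip_self_nonneg)

lemma nrm_square: "(nrm J u)\<^sup>2 = ip J u u"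
  by (simp add: nrm_def ip_self_nonneg)

lemma eigenbasis_ip_app:
  assumes fin: "finite J" and sym: "\<And>i j. i \<in> J \<Longrightarrow> j \<in> J \<Longrightarrow> K i j = K j i"
    and eb: "eigenbasis J K lam x"
  shows "ip J u (app J K v) = (\<Sum>a<card J. lam a * (ip J (x a) u * ip J (x a) v))"
proof -
  have on: "orthonormal J (card J) x" using eb by (simp add: eigenbasis_def)
  have "ip J (x a) (app J K v) = lam a * ip J (x a) v" if "a < card J" for a
  proof -
    have "ip J (x a) (app J K v) = ip J (app J K (x a)) v" by (rule ip_app_commute[OF sym])
    also have "\<dots> = ip J (\<lambda>i. lam a * x a i) v"
      using eb that by (intro ip_cong) (auto simp: eigenbasis_def)
    finally show ?thesis by (simp add: ip_linear)
  qed
  then show ?thesis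
    unfolding parseval[OF fin on, of u "app J K v", symmetric]
    by (intro sum.cong refl) simp
qed

lemma op_bound_of_eigenvalues:
  assumes fin: "finite J" and sym: "\<And>i j. i \<in> J \<Longrightarrow> j \<in> J \<Longrightarrow> K i j = K j i"
    and eb: "eigenbasis J K lam x" and lam: "\<And>a. a < card J \<Longrightarrow> \<bar>lam a\<bar> \<le> s" and s: "0 \<le> s"
  shows "op_bound J K s"
  unfolding op_bound_def
proof (intro allI)
  fix u v
  have on: "orthonormal J (card J) x" using eb by (simp add: eigenbasis_def)
  have eq: "ip J u (app J K v) = (\<Sum>a<card J. lam a * (ip J (x a) u * ip J (x a) v))"
    by (rule eigenbasis_ip_app[OF fin _ eb]) (fact sym)
  have L2: "L2_set (\<lambda>a. ip J (x a) w) {..<card J} = nrm J w" for w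
    using parseval[OF fin on, of w w] by (simp add: L2_set_def nrm_def power2_eq_square)
  have "\<bar>ip J u (app J K v)\<bar> \<le> (\<Sum>a<card J. \<bar>lam a * (ip J (x a) u * ip J (x a) v)\<bar>)"
    using eq by (simp only: sum_abs)
  also have "\<dots> \<le> (\<Sum>a<card J. s * (\<bar>ip J (x a) u\<bar> * \<bar>ip J (x a) v\<bar>))"
    using lam by (intro sum_mono) (auto simp: abs_mult intro!: mult_right_mono)
  also have "\<dots> = s * (\<Sum>a<card J. \<bar>ip J (x a) u\<bar> * \<bar>ip J (x a) v\<bar>)" by (simp add: sum_distrib_left)
  also have "\<dots> \<le> s * (L2_set (\<lambda>a. ip J (x a) u) {..<card J} * L2_set (\<lambda>a. ip J (x a) v) {..<card J})"
    by (intro mult_left_mono L2_set_mult_ineq s)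
  finally show "\<bar>ip J u (app J K v)\<bar> \<le> s * nrm J u * nrm J v" by (simp add: L2 mult.assoc)
qed

text \<open>The quotient \<open>(l^(k+1) - m^(k+1)) / (l - m)\<close> is a sum of
  \<open>k + 1\<close> monomials of degree \<open>k\<close>, each at most
  \<open>max \<bar>l\<bar> \<bar>m\<bar> ^ k\<close>. Evenness of \<open>k\<close> removes the
  absolute values.\<close>

lemma odd_power_diff_bound:
  fixes l m :: real
  assumes "even k"
  shows "(l ^ Suc k - m ^ Suc k) * (l - m) \<le> real (Suc k) * (l - m)\<^sup>2 * (l ^ k + m ^ k)"
proof -
  have ev: "\<bar>y\<bar> ^ k = y ^ k" for y :: real using assms by (simp add: power_even_abs)
  have tm: "m ^ (Suc k - Suc i) * l ^ i \<le> l ^ k + m ^ k" if "i < Suc k" for i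
  proof -
    define M where "M = max \<bar>l\<bar> \<bar>m\<bar>"
    have "m ^ (Suc k - Suc i) * l ^ i \<le> \<bar>m\<bar> ^ (k - i) * \<bar>l\<bar> ^ i"
      by (metis abs_ge_self abs_mult power_abs diff_Suc_Suc)
    also have "\<dots> \<le> M ^ (k - i) * M ^ i"
      by (intro mult_mono power_mono) (auto simp: M_def)
    also have "\<dots> = M ^ k" using that by (simp flip: power_add)
    also have "\<dots> \<le> \<bar>l\<bar> ^ k + \<bar>m\<bar> ^ k" by (auto simp: M_def max_def)
    finally show ?thesis by (simp add: ev)
  qed
  have "(l ^ Suc k - m ^ Suc k) * (l - m) = (l - m)\<^sup>2 * (\<Sum>i<Suc k. m ^ (Suc k - Suc i) * l ^ i)"
    by (subst power_diff_sumr2) (simp add: power2_eq_square algebra_simps)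
  also have "\<dots> \<le> (l - m)\<^sup>2 * (\<Sum>i<Suc k. l ^ k + m ^ k)"
    by (intro mult_left_mono sum_mono tm) auto
  finally show ?thesis by (simp add: algebra_simps)
qed

text \<open>Both sides are sums over pairs of eigenvectors of the two kernels, because
  \<open>(lam a - mu b) (x a \<bullet> y b) = c (x a \<bullet> w) (y b \<bullet> w)\<close>.\<close>

lemma rank_one_update_odd_power:
  fixes w :: "'j \<Rightarrow> real"
  assumes fin: "finite J"
    and sym: "\<And>i j. i \<in> J \<Longrightarrow> j \<in> J \<Longrightarrow> K0 i j = K0 j i"
    and upd: "\<And>i j. i \<in> J \<Longrightarrow> j \<in> J \<Longrightarrow> K1 i j = K0 i j + c * w i * w j"
    and eb1: "eigenbasis J K1 lam x" and eb0: "eigenbasis J K0 mu y"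
    and c: "c > 0" and k: "even k"
  shows "(\<Sum>a<card J. lam a ^ Suc k * (ip J (x a) w)\<^sup>2) - (\<Sum>b<card J. mu b ^ Suc k * (ip J (y b) w)\<^sup>2)
    \<le> real (Suc k) * c * ip J w w *
       ((\<Sum>a<card J. lam a ^ k * (ip J (x a) w)\<^sup>2) + (\<Sum>b<card J. mu b ^ k * (ip J (y b) w)\<^sup>2))"
proof -
  let ?N = "{..<card J}"
  have on1: "orthonormal J (card J) x" using eb1 by (simp add: eigenbasis_def)
  have on0: "orthonormal J (card J) y" using eb0 by (simp add: eigenbasis_def)
  define al where "al a = ip J (x a) w" for a
  define be where "be b = ip J (y b) w" for b
  define g where "g a b = ip J (x a) (y b)" for a b
  have gx: "(\<Sum>b\<in>?N. g a b * be b) = al a" for a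
    using parseval[OF fin on0, of "x a" w] by (simp add: g_def be_def al_def ip_commute[of J "x a" "y _"])
  have gy: "(\<Sum>a\<in>?N. g a b * al a) = be b" for b
    using parseval[OF fin on1, of "y b" w] by (simp add: g_def be_def al_def)
  have ga: "(\<Sum>b\<in>?N. (be b)\<^sup>2) = ip J w w"
    using parseval[OF fin on0, of w w] by (simp add: be_def power2_eq_square)
  have gb: "(\<Sum>a\<in>?N. (al a)\<^sup>2) = ip J w w"
    using parseval[OF fin on1, of w w] by (simp add: al_def power2_eq_square)
  have sym1: "K1 i j = K1 j i" if "i \<in> J" "j \<in> J" for i j
    using that by (simp add: upd sym mult.commute mult.left_commute)
  \<comment> \<open>Evaluate the form of \<open>K1\<close> at the pair \<open>x a\<close>,
    \<open>y b\<close> in both ways: \<open>K1\<close> acts on \<open>x a\<close> as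
    \<open>lam a\<close>, and on \<open>y b\<close> as \<open>mu b\<close> plus the rank-one
    term.\<close>
  have inter: "(lam a - mu b) * g a b = c * al a * be b" if "a \<in> ?N" "b \<in> ?N" for a b
  proof -
    have "lam a * g a b = ip J (app J K1 (x a)) (y b)"
    proof -
      have "ip J (app J K1 (x a)) (y b) = ip J (\<lambda>i. lam a * x a i) (y b)"
        using eb1 that by (intro ip_cong) (auto simp: eigenbasis_def)
      then show ?thesis by (simp add: ip_linear g_def)
    qed
    also have "\<dots> = ip J (x a) (app J K1 (y b))" by (rule ip_app_commute[OF sym1, symmetric])
    also have "\<dots> = ip J (x a) (\<lambda>i. mu b * y b i + c * be b * w i)"
    proof (rule ip_cong)
      fix i assume i: "i \<in> J"
      have "app J K1 (y b) i = app J K0 (y b) i + c * be b * w i"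
        using i by (simp add: app_def upd be_def ip_def sum.distrib algebra_simps sum_distrib_left)
      also have "app J K0 (y b) i = mu b * y b i" using eb0 that i by (auto simp: eigenbasis_def)
      finally show "app J K1 (y b) i = mu b * y b i + c * be b * w i" .
    qed simp
    also have "\<dots> = mu b * g a b + c * al a * be b" by (simp add: ip_linear g_def al_def)
    finally show ?thesis by (simp add: algebra_simps)
  qed
  \<comment> \<open>The extra factor \<open>c\<close> lets \<open>inter\<close> trade
    \<open>c * al a * be b\<close> for \<open>(lam a - mu b) * g a b\<close>. This produces the
    product bounded by \<open>odd_power_diff_bound\<close>, after which the trade is
    reversed.\<close>
  have "c * ((\<Sum>a\<in>?N. lam a ^ Suc k * (al a)\<^sup>2) - (\<Sum>b\<in>?N. mu b ^ Suc k * (be b)\<^sup>2))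
     = c * ((\<Sum>a\<in>?N. lam a ^ Suc k * al a * (\<Sum>b\<in>?N. g a b * be b)) -
            (\<Sum>b\<in>?N. mu b ^ Suc k * be b * (\<Sum>a\<in>?N. g a b * al a)))"
    by (simp add: gx gy power2_eq_square mult.assoc)
  also have "\<dots> = (\<Sum>a\<in>?N. \<Sum>b\<in>?N. (lam a ^ Suc k - mu b ^ Suc k) * (c * al a * be b) * g a b)"
    unfolding sum_distrib_left sum.swap[of "\<lambda>b a. mu b ^ Suc k * be b * (g a b * al a)"]
      sum_subtractf[symmetric]
    by (intro sum.cong refl) (simp add: algebra_simps)
  also have "\<dots> = (\<Sum>a\<in>?N. \<Sum>b\<in>?N. ((lam a ^ Suc k - mu b ^ Suc k) * (lam a - mu b)) * (g a b)\<^sup>2)"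
    by (intro sum.cong refl) (simp flip: inter add: power2_eq_square)
  also have "\<dots> \<le> (\<Sum>a\<in>?N. \<Sum>b\<in>?N. (real (Suc k) * (lam a - mu b)\<^sup>2 * (lam a ^ k + mu b ^ k)) * (g a b)\<^sup>2)"
    by (intro sum_mono mult_right_mono odd_power_diff_bound k) auto
  also have "\<dots> = (\<Sum>a\<in>?N. \<Sum>b\<in>?N. real (Suc k) * (c * al a * be b)\<^sup>2 * (lam a ^ k + mu b ^ k))"
    by (intro sum.cong refl) (simp flip: inter add: power_mult_distrib)
  also have "\<dots> = real (Suc k) * c\<^sup>2 * ((\<Sum>a\<in>?N. lam a ^ k * (al a)\<^sup>2 * (\<Sum>b\<in>?N. (be b)\<^sup>2)) +
       (\<Sum>b\<in>?N. mu b ^ k * (be b)\<^sup>2 * (\<Sum>a\<in>?N. (al a)\<^sup>2)))"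
    unfolding sum_distrib_left sum.swap[of "\<lambda>b a. mu b ^ k * (be b)\<^sup>2 * (al a)\<^sup>2"] sum.distrib[symmetric]
    by (intro sum.cong refl) (simp add: algebra_simps power_mult_distrib)
  also have "\<dots> = c * (real (Suc k) * c * ip J w w *
       ((\<Sum>a\<in>?N. lam a ^ k * (al a)\<^sup>2) + (\<Sum>b\<in>?N. mu b ^ k * (be b)\<^sup>2)))"
    unfolding ga gb sum_distrib_right[symmetric] by (simp add: power2_eq_square algebra_simps)
  finally show ?thesis using c by (simp add: al_def be_def)
qed

section \<open>Independent Bernoulli selections and conditioning on one of them\<close>

definition bern :: "'i set \<Rightarrow> real \<Rightarrow> ('i \<Rightarrow> bool) pmf" where
  "bern I q = Pi_pmf I False (\<lambda>_. bernoulli_pmf q)"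

lemma finite_set_bern: "finite I \<Longrightarrow> finite (set_pmf (bern I q))"
  unfolding bern_def by (rule finite_subset[OF set_Pi_pmf_subset']) (auto intro!: finite_PiE_dflt)

lemma integrable_bern: "finite I \<Longrightarrow> integrable (measure_pmf (bern I q)) (f :: _ \<Rightarrow> real)"
  by (rule integrable_measure_pmf_finite[OF finite_set_bern])

text \<open>The expectations on the right are again over all of \<open>bern I q\<close>: overwriting
  coordinate \<open>i\<close> erases its own randomness, so the reduced law and the full law agree
  on such functions.\<close>

lemma bern_split:
  fixes f :: "('i \<Rightarrow> bool) \<Rightarrow> real"
  assumes fin: "finite I" and i: "i \<in> I" and q: "0 \<le> q" "q \<le> 1"
  shows "measure_pmf.expectation (bern I q) f =
    q * measure_pmf.expectation (bern I q) (\<lambda>\<xi>. f (\<xi>(i := True))) +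
    (1 - q) * measure_pmf.expectation (bern I q) (\<lambda>\<xi>. f (\<xi>(i := False)))"
proof -
  define D where "D = bern (I - {i}) q"
  have finD: "finite (set_pmf D)" unfolding D_def using fin by (intro finite_set_bern) auto
  have *: "measure_pmf.expectation (bern I q) g =
      q * measure_pmf.expectation D (\<lambda>\<xi>. g (\<xi>(i := True))) +
      (1 - q) * measure_pmf.expectation D (\<lambda>\<xi>. g (\<xi>(i := False)))" for g :: "_ \<Rightarrow> real"
  proof -
    have "bern I q = bind_pmf (bernoulli_pmf q) (\<lambda>b. map_pmf (\<lambda>\<xi>. \<xi>(i := b)) D)"
      using Pi_pmf_insert'[of "I - {i}" i False "\<lambda>_. bernoulli_pmf q"] fin i
      by (simp add: bern_def D_def insert_absorb map_pmf_def)
    then have "measure_pmf.expectation (bern I q) g = (\<Sum>b\<in>UNIV. pmf (bernoulli_pmf q) b *\<^sub>R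
        measure_pmf.expectation (map_pmf (\<lambda>\<xi>. \<xi>(i := b)) D) g)"
      using finD by (simp only:) (rule pmf_expectation_bind, auto)
    then show ?thesis using q by (simp add: UNIV_bool)
  qed
  show ?thesis
    by (subst (1 2 3) *) (simp add: algebra_simps)
qed

lemma bern_expectation_centered:
  fixes g :: "('i \<Rightarrow> bool) \<Rightarrow> real"
  assumes "finite I" "i \<in> I" "0 < q" "q \<le> 1"
  shows "measure_pmf.expectation (bern I q) (\<lambda>\<xi>. (of_bool (\<xi> i) / q - 1) * g \<xi>) =
    (1 - q) * (measure_pmf.expectation (bern I q) (\<lambda>\<xi>. g (\<xi>(i := True))) -
               measure_pmf.expectation (bern I q) (\<lambda>\<xi>. g (\<xi>(i := False))))"
proof -
  have "measure_pmf.expectation (bern I q) (\<lambda>\<xi>. (of_bool (\<xi> i) / q - 1) * g \<xi>) =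
    q * ((1 / q - 1) * measure_pmf.expectation (bern I q) (\<lambda>\<xi>. g (\<xi>(i := True)))) +
    (1 - q) * (- measure_pmf.expectation (bern I q) (\<lambda>\<xi>. g (\<xi>(i := False))))"
    using assms by (subst bern_split[where i = i]) simp_all
  then show ?thesis using assms(3) by (simp add: field_simps)
qed

text \<open>Undoes the conditioning. The pair of frozen expectations with weight
  \<open>1 - q\<close>, left over from \<open>bern_expectation_centered\<close>, is absorbed into
  one expectation with a random weight; the true branch there has weight \<open>1 + q\<close>, and
  \<open>h \<ge> 0\<close> allows this excess.\<close>

lemma bern_expectation_weighted:
  fixes h :: "('i \<Rightarrow> bool) \<Rightarrow> real"
  assumes fin: "finite I" and "i \<in> I" "0 < q" "q \<le> 1" and h: "\<And>\<xi>. 0 \<le> h \<xi>"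
  shows "(1 - q) * (measure_pmf.expectation (bern I q) (\<lambda>\<xi>. h (\<xi>(i := True))) +
                    measure_pmf.expectation (bern I q) (\<lambda>\<xi>. h (\<xi>(i := False))))
    \<le> measure_pmf.expectation (bern I q) (\<lambda>\<xi>. (of_bool (\<xi> i) / q + 1) * h \<xi>)"
proof -
  have "0 \<le> 2 * q * measure_pmf.expectation (bern I q) (\<lambda>\<xi>. h (\<xi>(i := True)))"
    using assms by (intro mult_nonneg_nonneg Bochner_Integration.integral_nonneg) auto
  moreover have "measure_pmf.expectation (bern I q) (\<lambda>\<xi>. (of_bool (\<xi> i) / q + 1) * h \<xi>) =
      (1 + q) * measure_pmf.expectation (bern I q) (\<lambda>\<xi>. h (\<xi>(i := True))) +
      (1 - q) * measure_pmf.expectation (bern I q) (\<lambda>\<xi>. h (\<xi>(i := False)))"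
  proof -
    have "measure_pmf.expectation (bern I q) (\<lambda>\<xi>. (of_bool (\<xi> i) / q + 1) * h \<xi>) =
      q * ((1 / q + 1) * measure_pmf.expectation (bern I q) (\<lambda>\<xi>. h (\<xi>(i := True)))) +
      (1 - q) * measure_pmf.expectation (bern I q) (\<lambda>\<xi>. h (\<xi>(i := False)))"
      using assms by (subst bern_split[where i = i]) simp_all
    then show ?thesis using assms(3) by (simp add: field_simps)
  qed
  ultimately show ?thesis by (simp add: algebra_simps)
qed

section \<open>The random deviation kernel and its trace moments\<close>

definition dev_kernel :: "'i set \<Rightarrow> real \<Rightarrow> ('i \<Rightarrow> 'j \<Rightarrow> real) \<Rightarrow> ('i \<Rightarrow> bool) \<Rightarrow> 'j \<Rightarrow> 'j \<Rightarrow> real" where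
  "dev_kernel I q w \<xi> j l = (\<Sum>i\<in>I. (of_bool (\<xi> i) / q - 1) * w i j * w i l)"

lemma dev_kernel_sym: "dev_kernel I q w \<xi> j l = dev_kernel I q w \<xi> l j"
  by (simp add: dev_kernel_def algebra_simps)

lemma ip_app_dev_kernel:
  "ip J u (app J (dev_kernel I q w \<xi>) v) = (\<Sum>i\<in>I. (of_bool (\<xi> i) / q - 1) * ip J (w i) u * ip J (w i) v)"
proof -
  have "app J (dev_kernel I q w \<xi>) v = (\<lambda>j. \<Sum>i\<in>I. (of_bool (\<xi> i) / q - 1) * ip J (w i) v * w i j)"
  proof
    fix j
    have "app J (dev_kernel I q w \<xi>) v j = (\<Sum>l\<in>J. \<Sum>i\<in>I. (of_bool (\<xi> i) / q - 1) * w i j * w i l * v l)"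
      by (simp add: app_def dev_kernel_def sum_distrib_right)
    also have "\<dots> = (\<Sum>i\<in>I. \<Sum>l\<in>J. (of_bool (\<xi> i) / q - 1) * w i j * w i l * v l)" by (rule sum.swap)
    also have "\<dots> = (\<Sum>i\<in>I. (of_bool (\<xi> i) / q - 1) * ip J (w i) v * w i j)"
      by (intro sum.cong refl) (simp add: ip_def sum_distrib_left sum_distrib_right algebra_simps)
    finally show "app J (dev_kernel I q w \<xi>) v j = (\<Sum>i\<in>I. (of_bool (\<xi> i) / q - 1) * ip J (w i) v * w i j)" .
  qed
  then have "ip J u (app J (dev_kernel I q w \<xi>) v) =
      (\<Sum>i\<in>I. (of_bool (\<xi> i) / q - 1) * ip J (w i) v * ip J u (w i))"
    by (simp only: ip_linear)
  then show ?thesis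
    by (simp add: ip_commute[of J u "w _"] mult.commute mult.left_commute)
qed

context
  fixes I :: "'i set" and J :: "'j set" and q nu :: real and w :: "'i \<Rightarrow> 'j \<Rightarrow> real"
    and L :: "('i \<Rightarrow> bool) \<Rightarrow> nat \<Rightarrow> real" and V :: "('i \<Rightarrow> bool) \<Rightarrow> nat \<Rightarrow> 'j \<Rightarrow> real"
  assumes finI: "finite I" and finJ: "finite J" and q: "0 < q" "q \<le> 1"
    and w_small: "\<And>i. i \<in> I \<Longrightarrow> ip J (w i) (w i) \<le> nu * q"
    and w_sum: "\<And>u. (\<Sum>i\<in>I. (ip J (w i) u)\<^sup>2) \<le> ip J u u"
    and nu: "0 \<le> nu"
    and eb: "\<And>\<xi>. eigenbasis J (dev_kernel I q w \<xi>) (L \<xi>) (V \<xi>)"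
begin

private abbreviation "E \<equiv> measure_pmf.expectation (bern I q)"
text \<open>For the deviation kernel \<open>X\<close>, \<open>Q m i\<close> is the quadratic form of
  \<open>X^m\<close> at \<open>w i\<close>, and \<open>T m\<close> below is the trace of
  \<open>X^m\<close>. Both are read off an eigenbasis, so no kernel powers are formed.\<close>

private definition "Q m i \<xi> = (\<Sum>a<card J. L \<xi> a ^ m * (ip J (V \<xi> a) (w i))\<^sup>2)"
private definition "T m \<xi> = (\<Sum>a<card J. L \<xi> a ^ m)"

private lemma T_Suc: "T (Suc m) \<xi> = (\<Sum>i\<in>I. (of_bool (\<xi> i) / q - 1) * Q m i \<xi>)"
proof -
  have "L \<xi> a = (\<Sum>i\<in>I. (of_bool (\<xi> i) / q - 1) * (ip J (V \<xi> a) (w i))\<^sup>2)" if a: "a < card J" for a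
  proof -
    have "L \<xi> a = ip J (V \<xi> a) (\<lambda>i. L \<xi> a * V \<xi> a i)"
      using eb[of \<xi>] a by (simp add: ip_linear eigenbasis_def orthonormal_def)
    also have "\<dots> = ip J (V \<xi> a) (app J (dev_kernel I q w \<xi>) (V \<xi> a))"
      using eb[of \<xi>] a by (intro ip_cong) (auto simp: eigenbasis_def)
    finally show ?thesis
      by (simp add: ip_app_dev_kernel power2_eq_square ip_commute[of J "w _"] mult.assoc)
  qed
  then have "T (Suc m) \<xi> =
      (\<Sum>a<card J. (\<Sum>i\<in>I. (of_bool (\<xi> i) / q - 1) * (ip J (V \<xi> a) (w i))\<^sup>2) * L \<xi> a ^ m)"
    unfolding T_def by (intro sum.cong refl) simp
  also have "\<dots> = (\<Sum>i\<in>I. \<Sum>a<card J. (of_bool (\<xi> i) / q - 1) * (ip J (V \<xi> a) (w i))\<^sup>2 * L \<xi> a ^ m)"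
    unfolding sum_distrib_right by (rule sum.swap)
  also have "\<dots> = (\<Sum>i\<in>I. (of_bool (\<xi> i) / q - 1) * Q m i \<xi>)"
    by (simp add: Q_def sum_distrib_left algebra_simps)
  finally show ?thesis .
qed

private lemma Q_nonneg: "even k \<Longrightarrow> 0 \<le> Q k i \<xi>"
  unfolding Q_def by (intro sum_nonneg mult_nonneg_nonneg) (auto simp: zero_le_even_power)

private lemma Q_sum: "even k \<Longrightarrow> (\<Sum>i\<in>I. Q k i \<xi>) \<le> T k \<xi>"
proof -
  assume k: "even k"
  have "(\<Sum>i\<in>I. Q k i \<xi>) = (\<Sum>a<card J. L \<xi> a ^ k * (\<Sum>i\<in>I. (ip J (w i) (V \<xi> a))\<^sup>2))"
    unfolding Q_def sum_distrib_left by (subst sum.swap) (simp add: ip_commute)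
  also have "\<dots> \<le> (\<Sum>a<card J. L \<xi> a ^ k * 1)"
  proof (intro sum_mono mult_left_mono)
    fix a assume "a \<in> {..<card J}"
    then have "ip J (V \<xi> a) (V \<xi> a) = 1"
      using eb[of \<xi>] by (simp add: eigenbasis_def orthonormal_def)
    then show "(\<Sum>i\<in>I. (ip J (w i) (V \<xi> a))\<^sup>2) \<le> 1" using w_sum[of "V \<xi> a"] by simp
  qed (use k in \<open>auto simp: zero_le_even_power\<close>)
  finally show ?thesis by (simp add: T_def)
qed

text \<open>Switching one selection on adds the rank-one kernel with coefficient
  \<open>1 / q\<close>; together with the bound \<open>nu * q\<close> on the squared norm of
  \<open>w i\<close> this leaves exactly \<open>nu\<close>.\<close>

private lemma Q_diff:
  assumes i: "i \<in> I" and k: "even k"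
  shows "Q (Suc k) i (\<xi>(i := True)) - Q (Suc k) i (\<xi>(i := False))
    \<le> real (Suc k) * nu * (Q k i (\<xi>(i := True)) + Q k i (\<xi>(i := False)))"
proof -
  have "dev_kernel I q w (\<xi>(i := True)) j l = dev_kernel I q w (\<xi>(i := False)) j l + (1 / q) * w i j * w i l" for j l
    unfolding dev_kernel_def using i finI
    by (subst (1 2) sum.remove[of I i]) (auto simp: algebra_simps intro!: sum.cong)
  from rank_one_update_odd_power[OF finJ dev_kernel_sym this eb eb _ k]
  have "Q (Suc k) i (\<xi>(i := True)) - Q (Suc k) i (\<xi>(i := False))
    \<le> real (Suc k) * (1 / q) * ip J (w i) (w i) * (Q k i (\<xi>(i := True)) + Q k i (\<xi>(i := False)))"
    using q by (simp add: Q_def)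
  also have "\<dots> \<le> real (Suc k) * nu * (Q k i (\<xi>(i := True)) + Q k i (\<xi>(i := False)))"
  proof (intro mult_right_mono add_nonneg_nonneg Q_nonneg k)
    show "real (Suc k) * (1 / q) * ip J (w i) (w i) \<le> real (Suc k) * nu"
    proof -
      have "(1 / q) * ip J (w i) (w i) \<le> nu" using w_small[OF i] q by (simp add: field_simps)
      from mult_left_mono[OF this, of "real (Suc k)"] show ?thesis by (simp add: mult.assoc)
    qed
  qed
  finally show ?thesis .
qed

private lemma moment_recursion:
  assumes k: "even k"
  shows "E (T (Suc (Suc k))) \<le> real (Suc k) * nu * (E (T (Suc k)) + 2 * E (T k))"
proof -
  note int = integrable_bern[OF finI]
  have "E (T (Suc (Suc k))) = (\<Sum>i\<in>I. E (\<lambda>\<xi>. (of_bool (\<xi> i) / q - 1) * Q (Suc k) i \<xi>))"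
    unfolding T_Suc[abs_def] by (intro Bochner_Integration.integral_sum int)
  also have "\<dots> = (\<Sum>i\<in>I. (1 - q) * E (\<lambda>\<xi>. Q (Suc k) i (\<xi>(i := True)) - Q (Suc k) i (\<xi>(i := False))))"
    using finI q by (intro sum.cong refl)
      (simp add: bern_expectation_centered Bochner_Integration.integral_diff[OF int int])
  also have "\<dots> \<le> (\<Sum>i\<in>I. (1 - q) * E (\<lambda>\<xi>. real (Suc k) * nu * (Q k i (\<xi>(i := True)) + Q k i (\<xi>(i := False)))))"
    using q k by (intro sum_mono mult_left_mono integral_mono int Q_diff) auto
  also have "\<dots> = real (Suc k) * nu * (\<Sum>i\<in>I. (1 - q) * (E (\<lambda>\<xi>. Q k i (\<xi>(i := True))) + E (\<lambda>\<xi>. Q k i (\<xi>(i := False)))))"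
    by (simp add: Bochner_Integration.integral_add[OF int int] sum_distrib_left algebra_simps)
  also have "\<dots> \<le> real (Suc k) * nu * (\<Sum>i\<in>I. E (\<lambda>\<xi>. (of_bool (\<xi> i) / q + 1) * Q k i \<xi>))"
    using q k nu finI by (intro mult_left_mono sum_mono bern_expectation_weighted Q_nonneg) auto
  also have "(\<Sum>i\<in>I. E (\<lambda>\<xi>. (of_bool (\<xi> i) / q + 1) * Q k i \<xi>)) =
      E (\<lambda>\<xi>. \<Sum>i\<in>I. (of_bool (\<xi> i) / q + 1) * Q k i \<xi>)"
    by (intro Bochner_Integration.integral_sum[symmetric] int)
  \<comment> \<open>The weight is \<open>(of_bool (\<xi> i) / q - 1) + 2\<close>: the first part
    rebuilds one factor of the kernel under the trace, the second is handled by
    \<open>Q_sum\<close>.\<close>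
  also have "(\<lambda>\<xi>. \<Sum>i\<in>I. (of_bool (\<xi> i) / q + 1) * Q k i \<xi>) = (\<lambda>\<xi>. T (Suc k) \<xi> + 2 * (\<Sum>i\<in>I. Q k i \<xi>))"
    by (simp add: T_Suc fun_eq_iff sum.distrib sum_subtractf algebra_simps)
  also have "real (Suc k) * nu * E (\<lambda>\<xi>. T (Suc k) \<xi> + 2 * (\<Sum>i\<in>I. Q k i \<xi>)) \<le>
      real (Suc k) * nu * E (\<lambda>\<xi>. T (Suc k) \<xi> + 2 * T k \<xi>)"
    using nu k by (intro mult_left_mono integral_mono int add_left_mono Q_sum) auto
  also have "E (\<lambda>\<xi>. T (Suc k) \<xi> + 2 * T k \<xi>) = E (T (Suc k)) + 2 * E (T k)"
    by (simp add: Bochner_Integration.integral_add[OF int int])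
  finally show ?thesis .
qed

text \<open>The recursion is closed without Hoelder. Eigenvalues are cut at level \<open>t\<close>,
  so each lower power is at most a power of \<open>t\<close> plus the top power divided by
  \<open>t\<close> or \<open>t^2\<close>. The recursion then reads
  \<open>m \<le> (m + d * t^(k+2)) / 2\<close>, and \<open>m\<close> is absorbed on the
  left.\<close>

private lemma moment_bound:
  assumes t: "0 < t" and k: "even k" and small: "real (Suc k) * nu * (1 / t + 2 / t\<^sup>2) \<le> 1 / 2"
  shows "E (T (Suc (Suc k))) \<le> real (card J) * t ^ Suc (Suc k)"
proof -
  note int = integrable_bern[OF finI]
  let ?m = "E (T (Suc (Suc k)))"
  have ev: "\<bar>y\<bar> ^ k = y ^ k" for y :: real using k by (simp add: power_even_abs)
  have cut1: "y ^ Suc k \<le> t ^ Suc k + y ^ Suc (Suc k) / t" for y :: real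
  proof (cases "\<bar>y\<bar> \<le> t")
    case True
    have "y ^ Suc k \<le> \<bar>y\<bar> ^ Suc k" by (metis abs_ge_self power_abs)
    also have "\<dots> \<le> t ^ Suc k" using True by (intro power_mono) auto
    finally have "y ^ Suc k \<le> t ^ Suc k" .
    moreover have "0 \<le> y ^ Suc (Suc k) / t"
      using k t by (intro divide_nonneg_nonneg zero_le_even_power) auto
    ultimately show ?thesis by linarith
  next
    case False
    have "t * y ^ Suc k \<le> t * \<bar>y\<bar> ^ Suc k" using t by (intro mult_left_mono) (metis abs_ge_self power_abs, simp)
    also have "\<dots> \<le> \<bar>y\<bar> * \<bar>y\<bar> ^ Suc k" using False by (intro mult_right_mono) auto
    also have "\<dots> = y ^ Suc (Suc k)" using k by (simp add: ev)
    finally have "y ^ Suc k \<le> y ^ Suc (Suc k) / t" using t by (simp add: field_simps)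
    moreover have "0 \<le> t ^ Suc k" using t by simp
    ultimately show ?thesis by linarith
  qed
  have cut2: "y ^ k \<le> t ^ k + y ^ Suc (Suc k) / t\<^sup>2" for y :: real
  proof (cases "\<bar>y\<bar> \<le> t")
    case True
    then have "\<bar>y\<bar> ^ k \<le> t ^ k" by (intro power_mono) auto
    moreover have "0 \<le> y ^ Suc (Suc k) / t\<^sup>2" using k by (intro divide_nonneg_nonneg zero_le_even_power) auto
    ultimately show ?thesis by (simp add: ev)
  next
    case False
    then have "t\<^sup>2 \<le> y\<^sup>2" using t by (metis abs_le_square_iff abs_of_pos less_eq_real_def not_le)
    then have "t\<^sup>2 * y ^ k \<le> y\<^sup>2 * y ^ k" using k by (intro mult_right_mono zero_le_even_power) auto
    then have "y ^ k \<le> y ^ Suc (Suc k) / t\<^sup>2" using t by (simp add: field_simps power2_eq_square)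
    moreover have "0 \<le> t ^ k" using t by simp
    ultimately show ?thesis by linarith
  qed
  define d where "d = real (card J)"
  have T1: "T (Suc k) \<xi> \<le> d * t ^ Suc k + T (Suc (Suc k)) \<xi> / t" for \<xi>
  proof -
    have "T (Suc k) \<xi> \<le> (\<Sum>a<card J. t ^ Suc k + L \<xi> a ^ Suc (Suc k) / t)"
      unfolding T_def by (intro sum_mono cut1)
    then show ?thesis by (simp add: T_def d_def sum.distrib sum_divide_distrib)
  qed
  have T2: "T k \<xi> \<le> d * t ^ k + T (Suc (Suc k)) \<xi> / t\<^sup>2" for \<xi>
  proof -
    have "T k \<xi> \<le> (\<Sum>a<card J. t ^ k + L \<xi> a ^ Suc (Suc k) / t\<^sup>2)"
      unfolding T_def by (intro sum_mono cut2)
    then show ?thesis by (simp add: T_def d_def sum.distrib sum_divide_distrib)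
  qed
  have E1: "E (T (Suc k)) \<le> d * t ^ Suc k + ?m / t"
    using integral_mono[OF int int T1] by (simp add: Bochner_Integration.integral_add[OF int int])
  have E2: "E (T k) \<le> d * t ^ k + ?m / t\<^sup>2"
    using integral_mono[OF int int T2] by (simp add: Bochner_Integration.integral_add[OF int int])
  define c where "c = real (Suc k) * nu"
  have c: "0 \<le> c" using nu by (simp add: c_def)
  have m0: "0 \<le> ?m"
    using k unfolding T_def by (intro Bochner_Integration.integral_nonneg sum_nonneg zero_le_even_power) auto
  have "?m \<le> c * (E (T (Suc k)) + 2 * E (T k))" unfolding c_def by (rule moment_recursion[OF k])
  also have "\<dots> \<le> c * ((d * t ^ Suc k + ?m / t) + 2 * (d * t ^ k + ?m / t\<^sup>2))"
    using E1 E2 c by (intro mult_left_mono) auto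
  also have "\<dots> = (c * (1 / t + 2 / t\<^sup>2)) * (?m + d * t ^ Suc (Suc k))"
    using t by (simp add: field_simps power2_eq_square)
  also have "\<dots> \<le> (1 / 2) * (?m + d * t ^ Suc (Suc k))"
    using small m0 t by (intro mult_right_mono) (auto simp: c_def d_def)
  finally show ?thesis by (simp add: d_def)
qed

lemma dev_kernel_tail_aux:
  assumes s: "0 < s" "s \<le> 1" and p: "0 < p" and small: "96 * real p * nu \<le> s\<^sup>2"
  shows "measure_pmf.prob (bern I q) {\<xi>. \<not> op_bound J (dev_kernel I q w \<xi>) s}
    \<le> real (card J) * exp (- 2 * real p)"
proof -
  \<comment> \<open>With this level the Markov quotient \<open>(t / s)^(2 p)\<close> is
    \<open>exp (- 2 p)\<close>. \<open>moment_bound\<close> asks for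
    \<open>12 p nu \<le> t^2\<close>, and \<open>exp 1 ^ 2 \<le> 8\<close> turns this into the
    constant \<open>96 = 12 * 8\<close>.\<close>
  define t where "t = s / exp 1"
  have t: "0 < t" using s by (simp add: t_def)
  obtain k where k: "2 * p = Suc (Suc k)" "even k"
    using p by (intro that[of "2 * p - 2"]) auto
  have kk: "real (Suc k) \<le> 2 * real p" using k by linarith
  have e2: "(exp 1)\<^sup>2 \<le> (8::real)"
  proof -
    have "exp 1 \<le> (2.75::real)"  using e_less_272 by simp
    then have "(exp 1)\<^sup>2 \<le> (2.75::real)\<^sup>2" by (intro power_mono) auto
    then show ?thesis by (simp add: power2_eq_square)
  qed
  have t2: "s\<^sup>2 \<le> 8 * t\<^sup>2"
  proof -
    have "s\<^sup>2 = t\<^sup>2 * (exp 1)\<^sup>2" by (simp add: t_def power_divide)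
    also have "\<dots> \<le> t\<^sup>2 * 8" by (intro mult_left_mono e2) auto
    finally show ?thesis by simp
  qed
  have t1: "t \<le> 1" using s unfolding t_def by (simp add: field_simps) (use exp_ge_add_one_self[of "1::real"] in linarith)
  have "1 / t + 2 / t\<^sup>2 \<le> 3 / t\<^sup>2" using t t1 by (simp add: field_simps power2_eq_square)
  then have "real (Suc k) * nu * (1 / t + 2 / t\<^sup>2) \<le> 2 * real p * nu * (3 / t\<^sup>2)"
    using kk nu t by (intro mult_mono) auto
  also have "\<dots> \<le> 1 / 2"
  proof -
    have "12 * real p * nu \<le> t\<^sup>2" using small t2 by linarith
    then show ?thesis using t by (simp add: field_simps)
  qed
  finally have mb: "E (T (2 * p)) \<le> real (card J) * t ^ (2 * p)"
    using moment_bound[OF t k(2)] k(1) by simp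
  have sub: "{\<xi>. \<not> op_bound J (dev_kernel I q w \<xi>) s} \<subseteq> {\<xi>. s ^ (2 * p) \<le> T (2 * p) \<xi>}"
  proof safe
    fix \<xi> assume "\<not> op_bound J (dev_kernel I q w \<xi>) s"
    then have "\<not> (\<forall>a<card J. \<bar>L \<xi> a\<bar> \<le> s)"
      using op_bound_of_eigenvalues[OF finJ dev_kernel_sym eb, of \<xi> s] s by force
    then obtain a where a: "a < card J" "s < \<bar>L \<xi> a\<bar>" by (auto simp: not_le)
    have "s ^ (2 * p) \<le> \<bar>L \<xi> a\<bar> ^ (2 * p)" using a s by (intro power_mono) auto
    also have "\<dots> = L \<xi> a ^ (2 * p)" by (simp add: power_even_abs)
    also have "\<dots> \<le> T (2 * p) \<xi>" unfolding T_def
      using a by (intro member_le_sum) (auto simp: zero_le_even_power)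
    finally show "s ^ (2 * p) \<le> T (2 * p) \<xi>" .
  qed
  have "measure_pmf.prob (bern I q) {\<xi>. \<not> op_bound J (dev_kernel I q w \<xi>) s}
      \<le> measure_pmf.prob (bern I q) {\<xi>. s ^ (2 * p) \<le> T (2 * p) \<xi>}"
    by (intro measure_pmf.finite_measure_mono sub) auto
  also have "\<dots> \<le> E (T (2 * p)) / s ^ (2 * p)"
  proof -
    have "0 \<le> T (2 * p) \<xi>" for \<xi> by (auto simp: T_def zero_le_even_power intro!: sum_nonneg)
    then show ?thesis
      using integral_Markov_inequality_measure[where M = "measure_pmf (bern I q)" and u = "T (2 * p)"
          and A = "{}" and c = "s ^ (2 * p)"] integrable_bern[OF finI] s by simp
  qed
  also have "\<dots> \<le> real (card J) * t ^ (2 * p) / s ^ (2 * p)"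
    using mb s by (intro divide_right_mono) auto
  also have "\<dots> = real (card J) * exp (- 2 * real p)"
    using s by (simp add: t_def power_divide exp_minus field_simps flip: exp_of_nat_mult)
  finally show ?thesis .
qed

end

theorem dev_kernel_tail:
  fixes w :: "'i \<Rightarrow> 'j \<Rightarrow> real"
  assumes fin: "finite I" "finite J" and "0 < q" "q \<le> 1"
    and "\<And>i. i \<in> I \<Longrightarrow> ip J (w i) (w i) \<le> nu * q"
    and "\<And>u. (\<Sum>i\<in>I. (ip J (w i) u)\<^sup>2) \<le> ip J u u"
    and "0 \<le> nu" "0 < s" "s \<le> 1" "0 < p" "96 * real p * nu \<le> s\<^sup>2"
  shows "measure_pmf.prob (bern I q) {\<xi>. \<not> op_bound J (dev_kernel I q w \<xi>) s}
    \<le> real (card J) * exp (- 2 * real p)"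
proof -
  \<comment> \<open>An eigenbasis is chosen separately for every outcome; the law is discrete, so
    the choice raises no measurability question.\<close>
  have "\<forall>\<xi>. \<exists>lv. eigenbasis J (dev_kernel I q w \<xi>) (fst lv) (snd lv)"
  proof
    fix \<xi>
    obtain l x where "eigenbasis J (dev_kernel I q w \<xi>) l x"
      using spectral_theorem[OF fin(2), of "dev_kernel I q w \<xi>"] dev_kernel_sym by metis
    then show "\<exists>lv. eigenbasis J (dev_kernel I q w \<xi>) (fst lv) (snd lv)"
      by (intro exI[of _ "(l, x)"]) simp
  qed
  then obtain lv where "\<And>\<xi>. eigenbasis J (dev_kernel I q w \<xi>) (fst (lv \<xi>)) (snd (lv \<xi>))" by metis
  from dev_kernel_tail_aux[OF assms(1-7) this assms(8-11)] show ?thesis .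
qed

section \<open>Concentration in a single sampling round\<close>

lemma exp_le_quadratic:
  fixes y :: real
  assumes "\<bar>y\<bar> \<le> 1"
  shows "exp y \<le> 1 + y + y\<^sup>2"
proof (cases "0 \<le> y")
  case True
  then show ?thesis using exp_bound[of y] assms by simp
next
  case False
  define x where "x = - y"
  have x: "0 < x" "y = - x" using False by (auto simp: x_def)
  \<comment> \<open>The product equals \<open>1 + x^3\<close>. With \<open>1 + x \<le> exp x\<close>
    it bounds \<open>exp (- x)\<close> from above.\<close>
  have "1 \<le> (1 + x) * (1 - x + x\<^sup>2)" using x by (simp add: algebra_simps power2_eq_square)
  moreover have "0 \<le> 1 - x + x\<^sup>2" using sum_power2_ge_zero[of "x - 1/2" 0] by (simp add: power2_eq_square algebra_simps)
  ultimately have "1 \<le> exp x * (1 - x + x\<^sup>2)"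
    using exp_ge_add_one_self[of x] by (smt (verit) mult_right_mono)
  then have "exp (- x) \<le> 1 - x + x\<^sup>2" by (simp add: exp_minus field_simps)
  then show ?thesis using x by simp
qed

lemma bernoulli_exp_moment:
  fixes q y :: real
  assumes q: "0 \<le> q" "q \<le> 1" and y: "\<bar>y\<bar> \<le> 1"
  shows "measure_pmf.expectation (bernoulli_pmf q) (\<lambda>b. exp (y * (of_bool b - q))) \<le> exp (q * y\<^sup>2)"
proof -
  have "measure_pmf.expectation (bernoulli_pmf q) (\<lambda>b. exp (y * (of_bool b - q)))
      = q * exp (y * (1 - q)) + (1 - q) * exp (- (y * q))"
    using q by simp
  also have "\<dots> = exp (- (y * q)) * (1 + q * (exp y - 1))"
    by (simp add: algebra_simps flip: exp_add)
  also have "\<dots> \<le> exp (- (y * q)) * exp (q * (exp y - 1))"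
    by (intro mult_left_mono exp_ge_add_one_self) auto
  also have "\<dots> = exp (q * (exp y - 1 - y))" by (simp add: algebra_simps flip: exp_add)
  also have "\<dots> \<le> exp (q * y\<^sup>2)"
    using exp_le_quadratic[OF y] q by (auto intro!: mult_left_mono)
  finally show ?thesis .
qed

text \<open>Bernstein's inequality before optimization: the caller picks \<open>th\<close>, and
  \<open>small\<close> keeps every exponent in the range where the exponential is at most
  quadratic.\<close>

lemma bern_upper_tail:
  fixes a :: "'i \<Rightarrow> real"
  assumes fin: "finite I" and q: "0 < q" "q \<le> 1" and th: "0 < th"
    and small: "\<And>i. i \<in> I \<Longrightarrow> th * \<bar>a i\<bar> \<le> q" and var: "(\<Sum>i\<in>I. (a i)\<^sup>2) \<le> v"
  shows "measure_pmf.prob (bern I q) {\<xi>. c < (\<Sum>i\<in>I. (of_bool (\<xi> i) / q - 1) * a i)}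
    \<le> exp (- th * c + th\<^sup>2 * v / q)"
proof -
  define X where "X \<xi> = (\<Sum>i\<in>I. (of_bool (\<xi> i) / q - 1) * a i)" for \<xi> :: "'i \<Rightarrow> bool"
  define y where "y i = th * a i / q" for i
  have y: "\<bar>y i\<bar> \<le> 1" if "i \<in> I" for i
    using small[OF that] q th by (simp add: y_def abs_mult field_simps)
  have "exp (th * X \<xi>) = (\<Prod>i\<in>I. exp (y i * (of_bool (\<xi> i) - q)))" for \<xi>
    using q fin by (simp add: X_def y_def sum_distrib_left field_simps flip: exp_sum)
  then have "measure_pmf.expectation (bern I q) (\<lambda>\<xi>. exp (th * X \<xi>)) =
      measure_pmf.expectation (bern I q) (\<lambda>\<xi>. \<Prod>i\<in>I. exp (y i * (of_bool (\<xi> i) - q)))" by simp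
  also have "\<dots> = (\<Prod>i\<in>I. measure_pmf.expectation (bernoulli_pmf q) (\<lambda>b. exp (y i * (of_bool b - q))))"
    unfolding bern_def using fin by (intro expectation_prod_Pi_pmf) (auto intro: integrable_measure_pmf_finite)
  also have "\<dots> \<le> (\<Prod>i\<in>I. exp (q * (y i)\<^sup>2))"
    using q y by (intro prod_mono conjI bernoulli_exp_moment Bochner_Integration.integral_nonneg) auto
  also have "\<dots> = exp (\<Sum>i\<in>I. q * (y i)\<^sup>2)" using fin by (simp add: exp_sum)
  also have "(\<Sum>i\<in>I. q * (y i)\<^sup>2) = th\<^sup>2 * (\<Sum>i\<in>I. (a i)\<^sup>2) / q"
    using q by (simp add: y_def sum_distrib_left sum_divide_distrib power_mult_distrib power2_eq_square field_simps)
  also have "exp \<dots> \<le> exp (th\<^sup>2 * v / q)"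
    using var q by (auto intro!: divide_right_mono mult_left_mono)
  finally have mgf: "measure_pmf.expectation (bern I q) (\<lambda>\<xi>. exp (th * X \<xi>)) \<le> exp (th\<^sup>2 * v / q)" .
  have "measure_pmf.prob (bern I q) {\<xi>. c < X \<xi>}
      \<le> measure_pmf.prob (bern I q) {\<xi>. exp (th * c) \<le> exp (th * X \<xi>)}"
    using th by (intro measure_pmf.finite_measure_mono) auto
  also have "\<dots> \<le> measure_pmf.expectation (bern I q) (\<lambda>\<xi>. exp (th * X \<xi>)) / exp (th * c)"
    using integral_Markov_inequality_measure[where M = "measure_pmf (bern I q)" and u = "\<lambda>\<xi>. exp (th * X \<xi>)"
        and A = "{}" and c = "exp (th * c)"] integrable_bern[OF fin] by simp
  also have "\<dots> \<le> exp (th\<^sup>2 * v / q) / exp (th * c)" by (intro divide_right_mono mgf) auto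
  also have "\<dots> = exp (- th * c + th\<^sup>2 * v / q)" by (simp flip: exp_diff)
  finally show ?thesis by (simp add: X_def)
qed

lemma bern_two_sided_tail:
  fixes a :: "'i \<Rightarrow> real"
  assumes fin: "finite I" and q: "0 < q" "q \<le> 1" and th: "0 < th"
    and small: "\<And>i. i \<in> I \<Longrightarrow> th * \<bar>a i\<bar> \<le> q" and var: "(\<Sum>i\<in>I. (a i)\<^sup>2) \<le> v"
  shows "measure_pmf.prob (bern I q) {\<xi>. c < \<bar>\<Sum>i\<in>I. (of_bool (\<xi> i) / q - 1) * a i\<bar>}
    \<le> 2 * exp (- th * c + th\<^sup>2 * v / q)"
proof -
  have "{\<xi>. c < \<bar>\<Sum>i\<in>I. (of_bool (\<xi> i) / q - 1) * a i\<bar>}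
     \<subseteq> {\<xi>. c < (\<Sum>i\<in>I. (of_bool (\<xi> i) / q - 1) * a i)} \<union>
       {\<xi>. c < (\<Sum>i\<in>I. (of_bool (\<xi> i) / q - 1) * (- a i))}"
    by (auto simp: sum_negf abs_if split: if_splits)
  then have "measure_pmf.prob (bern I q) {\<xi>. c < \<bar>\<Sum>i\<in>I. (of_bool (\<xi> i) / q - 1) * a i\<bar>}
    \<le> measure_pmf.prob (bern I q) \<dots>"
    by (intro measure_pmf.finite_measure_mono) auto
  also have "\<dots> \<le> measure_pmf.prob (bern I q) {\<xi>. c < (\<Sum>i\<in>I. (of_bool (\<xi> i) / q - 1) * a i)} +
      measure_pmf.prob (bern I q) {\<xi>. c < (\<Sum>i\<in>I. (of_bool (\<xi> i) / q - 1) * (- a i))}"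
    by (intro measure_subadditive) auto
  also have "\<dots> \<le> exp (- th * c + th\<^sup>2 * v / q) + exp (- th * c + th\<^sup>2 * v / q)"
    using assms by (intro add_mono bern_upper_tail) auto
  finally show ?thesis by simp
qed

text \<open>The kernel of an orthogonal projection. Its diagonal entry at \<open>a\<close> is the
  squared norm of the projected coordinate vector, so \<open>tau\<close> is where incoherence
  enters.\<close>

definition proj_kernel :: "'c set \<Rightarrow> ('c \<Rightarrow> 'c \<Rightarrow> real) \<Rightarrow> real \<Rightarrow> bool" where
  "proj_kernel E G tau \<longleftrightarrow>
     (\<forall>a\<in>E. \<forall>b\<in>E. G a b = G b a) \<and> (\<forall>a\<in>E. \<forall>b\<in>E. (\<Sum>c\<in>E. G a c * G c b) = G a b) \<and>
     (\<forall>a\<in>E. G a a \<le> tau)"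

lemma proj_kernelD:
  assumes "proj_kernel E G tau" "a \<in> E"
  shows "b \<in> E \<Longrightarrow> G a b = G b a" and "b \<in> E \<Longrightarrow> (\<Sum>c\<in>E. G a c * G c b) = G a b"
    and "G a a \<le> tau"
  using assms unfolding proj_kernel_def by blast+

lemma proj_kernel_row:
  assumes "proj_kernel E G tau" "a \<in> E" "b \<in> E"
  shows "ip E (G a) (G b) = G a b"
proof -
  have "ip E (G a) (G b) = (\<Sum>c\<in>E. G a c * G c b)"
    unfolding ip_def by (intro sum.cong refl) (metis proj_kernelD(1)[OF assms(1)] assms(3))
  then show ?thesis using proj_kernelD(2)[OF assms] by simp
qed

lemma proj_kernel_entry_bound:
  assumes "proj_kernel E G tau" "a \<in> E" "b \<in> E"
  shows "\<bar>G a b\<bar> \<le> tau"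
proof -
  note row = proj_kernel_row[OF assms(1)]
  have diag: "0 \<le> G c c" "G c c \<le> tau" if "c \<in> E" for c
    using ip_self_nonneg[of E "G c"] row[OF that that] assms(1) that by (auto simp: proj_kernel_def)
  have "(G a b)\<^sup>2 \<le> G a a * G b b"
    using ip_Cauchy_Schwarz[of E "G a" "G b"] assms by (simp add: row)
  also have "\<dots> \<le> tau * tau"
    using diag[OF assms(2)] diag[OF assms(3)] by (intro mult_mono) linarith+
  finally have "(G a b)\<^sup>2 \<le> tau\<^sup>2" by (simp add: power2_eq_square)
  moreover have "0 \<le> tau" using diag[OF assms(2)] by linarith
  ultimately show ?thesis using abs_le_square_iff[of "G a b" tau] by simp
qed

lemma proj_kernel_app_idem:
  assumes "proj_kernel E G tau" "a \<in> E"
  shows "app E G (app E G u) a = app E G u a"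
proof -
  have "app E G (app E G u) a = (\<Sum>c\<in>E. \<Sum>b\<in>E. G a c * G c b * u b)"
    by (simp add: app_def sum_distrib_left mult.assoc)
  also have "\<dots> = (\<Sum>b\<in>E. \<Sum>c\<in>E. G a c * G c b * u b)" by (rule sum.swap)
  also have "\<dots> = (\<Sum>b\<in>E. (\<Sum>c\<in>E. G a c * G c b) * u b)" by (simp add: sum_distrib_right)
  also have "\<dots> = app E G u a"
    unfolding app_def by (intro sum.cong refl) (simp add: proj_kernelD(2)[OF assms])
  finally show ?thesis .
qed

lemma proj_kernel_app_self:
  assumes "proj_kernel E G tau"
  shows "ip E u (app E G v) = ip E (app E G u) (app E G v)"
proof -
  have "ip E (app E G u) (app E G v) = ip E u (app E G (app E G v))"
    using assms by (intro ip_app_commute[symmetric]) (auto simp: proj_kernel_def)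
  also have "\<dots> = ip E u (app E G v)"
    by (intro ip_cong) (simp_all add: proj_kernel_app_idem[OF assms])
  finally show ?thesis by simp
qed

lemma proj_kernel_contraction:
  assumes "proj_kernel E G tau"
  shows "ip E (app E G u) (app E G u) \<le> ip E u u"
proof -
  have "0 \<le> ip E (\<lambda>i. u i - app E G u i) (\<lambda>i. u i - app E G u i)" by (rule ip_self_nonneg)
  also have "\<dots> = ip E u u - ip E (app E G u) (app E G u)"
    using proj_kernel_app_self[OF assms, of u u] by (simp add: ip_linear ip_commute)
  finally show ?thesis by simp
qed

text \<open>An operator bound for the centered sampling operator, restricted to the mask
  \<open>S\<close> and compressed by the projection \<open>G\<close> on both sides. Since it holds
  for all \<open>u\<close> and \<open>v\<close> at once, it may later be tested on vectors that
  depend on the sample.\<close>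

definition frob_event :: "'c set \<Rightarrow> ('c \<Rightarrow> 'c \<Rightarrow> real) \<Rightarrow> real \<Rightarrow> 'c set \<Rightarrow> real \<Rightarrow> ('c \<Rightarrow> bool) \<Rightarrow> bool" where
  "frob_event E G q S s \<xi> \<longleftrightarrow> (\<forall>u v.
     \<bar>\<Sum>c\<in>E. (of_bool (\<xi> c) / q - 1) * of_bool (c \<in> S) * app E G u c * app E G v c\<bar> \<le> s * nrm E u * nrm E v)"

lemma frob_event_prob:
  assumes fin: "finite E" and G: "proj_kernel E G tau" and q: "0 < q" "q \<le> 1"
    and tau: "0 \<le> tau" and s: "0 < s" "s \<le> 1" and p: "0 < p" "96 * real p * (tau / q) \<le> s\<^sup>2"
  shows "measure_pmf.prob (bern E q) {\<xi>. \<not> frob_event E G q S s \<xi>} \<le> real (card E) * exp (- 2 * real p)"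
proof -
  \<comment> \<open>Masked rows of the projection: their squared norms are diagonal entries of
    \<open>G\<close>, at most \<open>tau\<close>, and their rank-one sum is dominated by the
    projection, hence by the identity.\<close>
  define w where "w c a = of_bool (c \<in> S) * G c a" for c a
  have ipw: "ip E (w c) u = of_bool (c \<in> S) * app E G u c" for c u
    by (simp add: w_def ip_def app_def)
  have "measure_pmf.prob (bern E q) {\<xi>. \<not> op_bound E (dev_kernel E q w \<xi>) s} \<le> real (card E) * exp (- 2 * real p)"
  proof (rule dev_kernel_tail[OF fin fin q _ _ _ s p])
    fix c assume c: "c \<in> E"
    have "ip E (w c) (w c) = of_bool (c \<in> S) * ip E (G c) (G c)" by (auto simp: w_def[abs_def] ip_def)
    also have "\<dots> \<le> tau" using c tau G by (auto simp: proj_kernel_row[OF G] proj_kernel_def)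
    finally show "ip E (w c) (w c) \<le> tau / q * q" using q by simp
  next
    fix u
    have "(\<Sum>c\<in>E. (ip E (w c) u)\<^sup>2) \<le> (\<Sum>c\<in>E. (app E G u c)\<^sup>2)"
      by (intro sum_mono) (auto simp: ipw)
    also have "\<dots> \<le> ip E u u" using proj_kernel_contraction[OF G, of u] by (simp add: ip_self)
    finally show "(\<Sum>c\<in>E. (ip E (w c) u)\<^sup>2) \<le> ip E u u" .
  qed (use tau q in auto)
  moreover have "frob_event E G q S s \<xi> \<longleftrightarrow> op_bound E (dev_kernel E q w \<xi>) s" for \<xi>
  proof -
    have "(\<Sum>c\<in>E. (of_bool (\<xi> c) / q - 1) * of_bool (c \<in> S) * app E G u c * app E G v c) =
        ip E u (app E (dev_kernel E q w \<xi>) v)" for u v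
      unfolding ip_app_dev_kernel ipw by (intro sum.cong refl) auto
    then show ?thesis by (simp add: frob_event_def op_bound_def)
  qed
  ultimately show ?thesis by simp
qed

abbreviation cells :: "nat \<Rightarrow> nat \<Rightarrow> (nat \<times> nat) set" where
  "cells n1 n2 \<equiv> {..<n1} \<times> {..<n2}"

definition spec_event :: "nat \<Rightarrow> nat \<Rightarrow> real \<Rightarrow> (nat \<times> nat \<Rightarrow> real) \<Rightarrow> real \<Rightarrow> (nat \<times> nat \<Rightarrow> bool) \<Rightarrow> bool" where
  "spec_event n1 n2 q Z b \<xi> \<longleftrightarrow> (\<forall>x y.
     \<bar>\<Sum>c\<in>cells n1 n2. (of_bool (\<xi> c) / q - 1) * Z c * x (fst c) * y (snd c)\<bar>
       \<le> b * nrm {..<n1} x * nrm {..<n2} y)"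

text \<open>Each entry is an off-diagonal entry of a positive semidefinite matrix of rank one,
  which reduces the rectangular case to \<open>dev_kernel_tail\<close> on the disjoint union of the
  row and the column indices.\<close>

lemma spec_event_prob:
  fixes n1 n2 :: nat
  defines "n \<equiv> real n1 + real n2"
  assumes n: "0 < n1" "0 < n2" and Z: "\<And>c. c \<in> cells n1 n2 \<Longrightarrow> \<bar>Z c\<bar> \<le> z" and z: "0 < z"
    and q: "0 < q" "q \<le> 1" and s: "0 < s" "s \<le> 1" and p: "0 < p" "96 * real p * (1 / (n * q)) \<le> s\<^sup>2"
  shows "measure_pmf.prob (bern (cells n1 n2) q) {\<xi>. \<not> spec_event n1 n2 q Z (2 * z * n * s) \<xi>}
    \<le> n * exp (- 2 * real p)"
proof -
  define E where "E = cells n1 n2"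
  define J where "J = {..<n1} <+> {..<n2}"
  have finE: "finite E" and finJ: "finite J" by (simp_all add: E_def J_def)
  have n0: "0 < n" using n by (simp add: n_def)
  \<comment> \<open>Both blocks of \<open>w c\<close> carry the square root of the entry, the sign
    sitting on the column side, so the off-diagonal entry of the rank-one matrix is
    \<open>Z c / (2 * z * n)\<close>. The denominator keeps the squared norm below
    \<open>1 / n\<close>; as each row or column index meets at most \<open>n\<close> cells, the
    rank-one matrices sum to at most the identity.\<close>
  define al where "al c = sqrt (\<bar>Z c\<bar> / (2 * z * n))" for c
  define w where "w c k = (case k of Inl i \<Rightarrow> if i = fst c then al c else 0
    | Inr j \<Rightarrow> if j = snd c then sgn (Z c) * al c else 0)" for c k
  have al2: "(al c)\<^sup>2 = \<bar>Z c\<bar> / (2 * z * n)" for c using z n0 by (simp add: al_def)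
  have al2_le: "(al c)\<^sup>2 \<le> 1 / (2 * n)" if "c \<in> E" for c
    using Z[of c] that z n0 by (simp add: al2 E_def field_simps)
  have sumJ: "ip J u v = (\<Sum>i<n1. u (Inl i) * v (Inl i)) + (\<Sum>j<n2. u (Inr j) * v (Inr j))" for u v
    by (simp add: ip_def J_def sum.Plus)
  have ipw: "ip J (w c) u = al c * u (Inl (fst c)) + sgn (Z c) * al c * u (Inr (snd c))" if "c \<in> E" for c u
    using that by (auto simp: sumJ w_def E_def if_distribR if_distrib[of "\<lambda>t. t * _"] cong: if_cong)
  have sgn2: "(sgn (Z c))\<^sup>2 \<le> 1" for c by (simp add: sgn_if)
  have "measure_pmf.prob (bern E q) {\<xi>. \<not> op_bound J (dev_kernel E q w \<xi>) s} \<le> real (card J) * exp (- 2 * real p)"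
  proof (rule dev_kernel_tail[OF finE finJ q _ _ _ s p])
    fix c assume c: "c \<in> E"
    have "ip J (w c) (w c) = (al c)\<^sup>2 + (sgn (Z c))\<^sup>2 * (al c)\<^sup>2"
      unfolding ipw[OF c] by (simp add: w_def power2_eq_square)
    also have "\<dots> \<le> (al c)\<^sup>2 + 1 * (al c)\<^sup>2" by (intro add_left_mono mult_right_mono sgn2) auto
    also have "\<dots> \<le> 1 / n" using al2_le[OF c] n0 by (simp add: field_simps)
    finally show "ip J (w c) (w c) \<le> 1 / (n * q) * q" using q by simp
  next
    fix u
    have "(ip J (w c) u)\<^sup>2 \<le> (1 / n) * ((u (Inl (fst c)))\<^sup>2 + (u (Inr (snd c)))\<^sup>2)" if c: "c \<in> E" for c
    proof -
      define x where "x = u (Inl (fst c))"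
      define y where "y = sgn (Z c) * u (Inr (snd c))"
      have "y\<^sup>2 = (sgn (Z c))\<^sup>2 * (u (Inr (snd c)))\<^sup>2" by (simp add: y_def power_mult_distrib)
      also have "\<dots> \<le> 1 * (u (Inr (snd c)))\<^sup>2" by (intro mult_right_mono sgn2) auto
      finally have y2: "y\<^sup>2 \<le> (u (Inr (snd c)))\<^sup>2" by simp
      have "(x + y)\<^sup>2 \<le> 2 * (x\<^sup>2 + y\<^sup>2)"
        using sum_power2_ge_zero[of "x - y" 0] by (simp add: power2_eq_square algebra_simps)
      also have "\<dots> \<le> 2 * (x\<^sup>2 + (u (Inr (snd c)))\<^sup>2)" using y2 by simp
      finally have xy: "(x + y)\<^sup>2 \<le> 2 * (x\<^sup>2 + (u (Inr (snd c)))\<^sup>2)" .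
      have "(ip J (w c) u)\<^sup>2 = (al c)\<^sup>2 * (x + y)\<^sup>2"
        by (simp add: ipw[OF c] x_def y_def power2_eq_square algebra_simps)
      also have "\<dots> \<le> 1 / (2 * n) * (2 * (x\<^sup>2 + (u (Inr (snd c)))\<^sup>2))"
        using al2_le[OF c] xy n0 by (intro mult_mono) auto
      also have "\<dots> = (1 / n) * (x\<^sup>2 + (u (Inr (snd c)))\<^sup>2)" using n0 by (simp add: field_simps)
      finally show ?thesis by (simp add: x_def)
    qed
    then have "(\<Sum>c\<in>E. (ip J (w c) u)\<^sup>2) \<le> (\<Sum>c\<in>E. (1 / n) * ((u (Inl (fst c)))\<^sup>2 + (u (Inr (snd c)))\<^sup>2))"
      by (intro sum_mono)
    also have "\<dots> = (1 / n) * (\<Sum>i<n1. \<Sum>j<n2. (u (Inl i))\<^sup>2 + (u (Inr j))\<^sup>2)"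
      unfolding sum_distrib_left[symmetric]
      by (simp only: E_def sum.cartesian_product case_prod_unfold)
    also have "\<dots> = (1 / n) * (real n2 * (\<Sum>i<n1. (u (Inl i))\<^sup>2) + real n1 * (\<Sum>j<n2. (u (Inr j))\<^sup>2))"
      by (simp add: sum.distrib sum_distrib_left)
    also have "\<dots> \<le> (1 / n) * (n * (\<Sum>i<n1. (u (Inl i))\<^sup>2) + n * (\<Sum>j<n2. (u (Inr j))\<^sup>2))"
      using n0 by (intro mult_left_mono add_mono mult_right_mono sum_nonneg) (auto simp: n_def)
    also have "\<dots> = ip J u u" using n0 by (simp add: sumJ power2_eq_square field_simps)
    finally show "(\<Sum>c\<in>E. (ip J (w c) u)\<^sup>2) \<le> ip J u u" .
  qed (use n0 q in auto)
  moreover have "spec_event n1 n2 q Z (2 * z * n * s) \<xi>" if ob: "op_bound J (dev_kernel E q w \<xi>) s" for \<xi>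
    unfolding spec_event_def E_def[symmetric]
  proof (intro allI)
    fix x y :: "nat \<Rightarrow> real"
    \<comment> \<open>Support on the rows for \<open>u\<close> and on the columns for
      \<open>v\<close> isolates the off-diagonal block.\<close>
    define u where "u k = (case k of Inl i \<Rightarrow> x i | Inr j \<Rightarrow> 0)" for k :: "nat + nat"
    define v where "v k = (case k of Inl i \<Rightarrow> 0 | Inr j \<Rightarrow> y j)" for k :: "nat + nat"
    have nu: "nrm J u = nrm {..<n1} x" and nv: "nrm J v = nrm {..<n2} y"
      by (simp_all add: nrm_def sumJ u_def v_def) (simp_all add: ip_def)
    have "ip J (w c) u * ip J (w c) v = Z c * x (fst c) * y (snd c) / (2 * z * n)" if c: "c \<in> E" for c
    proof -
      have "ip J (w c) u * ip J (w c) v = (sgn (Z c) * (al c)\<^sup>2) * x (fst c) * y (snd c)"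
        unfolding ipw[OF c] by (simp add: u_def v_def power2_eq_square)
      also have "sgn (Z c) * (al c)\<^sup>2 = Z c / (2 * z * n)"
        unfolding al2 by (simp only: times_divide_eq_right sgn_mult_abs)
      finally show ?thesis by simp
    qed
    then have "ip J u (app J (dev_kernel E q w \<xi>) v) =
        (\<Sum>c\<in>E. (of_bool (\<xi> c) / q - 1) * (Z c * x (fst c) * y (snd c) / (2 * z * n)))"
      unfolding ip_app_dev_kernel mult.assoc by (intro sum.cong refl) (simp add: mult.assoc)
    also have "\<dots> = (\<Sum>c\<in>E. (of_bool (\<xi> c) / q - 1) * Z c * x (fst c) * y (snd c)) / (2 * z * n)"
      by (simp add: sum_divide_distrib mult.assoc)
    finally have eq: "ip J u (app J (dev_kernel E q w \<xi>) v) =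
        (\<Sum>c\<in>E. (of_bool (\<xi> c) / q - 1) * Z c * x (fst c) * y (snd c)) / (2 * z * n)" .
    have "\<bar>ip J u (app J (dev_kernel E q w \<xi>) v)\<bar> \<le> s * nrm J u * nrm J v"
      using ob by (simp add: op_bound_def)
    then have "\<bar>(\<Sum>c\<in>E. (of_bool (\<xi> c) / q - 1) * Z c * x (fst c) * y (snd c)) / (2 * z * n)\<bar>
        \<le> s * nrm {..<n1} x * nrm {..<n2} y"
      unfolding eq nu nv .
    then show "\<bar>\<Sum>c\<in>E. (of_bool (\<xi> c) / q - 1) * Z c * x (fst c) * y (snd c)\<bar>
        \<le> 2 * z * n * s * nrm {..<n1} x * nrm {..<n2} y"
      using z n0 by (simp add: field_simps)
  qed
  then have "measure_pmf.prob (bern E q) {\<xi>. \<not> spec_event n1 n2 q Z (2 * z * n * s) \<xi>} \<le>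
      measure_pmf.prob (bern E q) {\<xi>. \<not> op_bound J (dev_kernel E q w \<xi>) s}"
    by (intro measure_pmf.finite_measure_mono) auto
  moreover have "real (card J) = n" by (simp add: J_def n_def card_Plus)
  ultimately show ?thesis by (simp add: E_def)
qed

definition max_event :: "'c set \<Rightarrow> ('c \<Rightarrow> 'c \<Rightarrow> real) \<Rightarrow> real \<Rightarrow> ('c \<Rightarrow> real) \<Rightarrow> real \<Rightarrow> ('c \<Rightarrow> bool) \<Rightarrow> bool" where
  "max_event E G q Z b \<xi> \<longleftrightarrow> (\<forall>a\<in>E. \<bar>\<Sum>c\<in>E. (of_bool (\<xi> c) / q - 1) * (Z c * G c a)\<bar> \<le> b)"

lemma max_event_prob:
  assumes fin: "finite E" and G: "proj_kernel E G tau" and q: "0 < q" "q \<le> 1"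
    and tau: "0 < tau" and Z: "\<And>c. c \<in> E \<Longrightarrow> \<bar>Z c\<bar> \<le> z" and z: "0 < z" and e: "0 < e" "e \<le> 2"
  shows "measure_pmf.prob (bern E q) {\<xi>. \<not> max_event E G q Z (e * z) \<xi>}
    \<le> real (card E) * (2 * exp (- (e\<^sup>2 * q / (4 * tau))))"
proof -
  let ?X = "\<lambda>a \<xi>. \<Sum>c\<in>E. (of_bool (\<xi> c) / q - 1) * (Z c * G c a)"
  \<comment> \<open>The minimizer of \<open>- th * (e * z) + th^2 * (z^2 * tau) / q\<close>; the
    side condition of the tail bound becomes \<open>e \<le> 2\<close>.\<close>
  define th where "th = e * q / (2 * z * tau)"
  have th: "0 < th" using e q z tau by (simp add: th_def)
  have one: "measure_pmf.prob (bern E q) {\<xi>. e * z < \<bar>?X a \<xi>\<bar>} \<le> 2 * exp (- (e\<^sup>2 * q / (4 * tau)))"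
    if a: "a \<in> E" for a
  proof -
    have "measure_pmf.prob (bern E q) {\<xi>. e * z < \<bar>?X a \<xi>\<bar>} \<le> 2 * exp (- th * (e * z) + th\<^sup>2 * (z\<^sup>2 * tau) / q)"
    proof (rule bern_two_sided_tail[OF fin q th])
      fix c assume c: "c \<in> E"
      have "th * \<bar>Z c * G c a\<bar> \<le> th * (z * tau)"
        unfolding abs_mult using Z[OF c] proj_kernel_entry_bound[OF G c a] z th
        by (intro mult_left_mono mult_mono) auto
      also have "\<dots> = (e / 2) * q" using z tau by (simp add: th_def field_simps)
      also have "\<dots> \<le> 1 * q" using e q by (intro mult_right_mono) auto
      finally show "th * \<bar>Z c * G c a\<bar> \<le> q" by simp
    next
      have "(\<Sum>c\<in>E. (Z c * G c a)\<^sup>2) \<le> (\<Sum>c\<in>E. z\<^sup>2 * (G a c)\<^sup>2)"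
      proof (intro sum_mono)
        fix c assume c: "c \<in> E"
        have "(Z c)\<^sup>2 \<le> z\<^sup>2" using Z[OF c] z by (simp add: abs_le_square_iff[symmetric])
        moreover have "G c a = G a c" using G a c by (auto simp: proj_kernel_def)
        ultimately show "(Z c * G c a)\<^sup>2 \<le> z\<^sup>2 * (G a c)\<^sup>2"
          by (simp add: power_mult_distrib mult_right_mono)
      qed
      also have "\<dots> = z\<^sup>2 * ip E (G a) (G a)" by (simp add: ip_self sum_distrib_left)
      also have "\<dots> \<le> z\<^sup>2 * tau"
        using G a by (intro mult_left_mono) (auto simp: proj_kernel_row[OF G] proj_kernel_def)
      finally show "(\<Sum>c\<in>E. (Z c * G c a)\<^sup>2) \<le> z\<^sup>2 * tau" .
    qed
    also have "- th * (e * z) + th\<^sup>2 * (z\<^sup>2 * tau) / q = - (e\<^sup>2 * q / (4 * tau))"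
      using z tau q by (simp add: th_def field_simps power2_eq_square)
    finally show ?thesis .
  qed
  have "{\<xi>. \<not> max_event E G q Z (e * z) \<xi>} \<subseteq> (\<Union>a\<in>E. {\<xi>. e * z < \<bar>?X a \<xi>\<bar>})"
    by (auto simp: max_event_def not_le)
  then have "measure_pmf.prob (bern E q) {\<xi>. \<not> max_event E G q Z (e * z) \<xi>}
      \<le> measure_pmf.prob (bern E q) (\<Union>a\<in>E. {\<xi>. e * z < \<bar>?X a \<xi>\<bar>})"
    by (intro measure_pmf.finite_measure_mono) auto
  also have "\<dots> \<le> (\<Sum>a\<in>E. measure_pmf.prob (bern E q) {\<xi>. e * z < \<bar>?X a \<xi>\<bar>})"
    using fin by (intro measure_UNION_le) auto
  also have "\<dots> \<le> (\<Sum>a\<in>E. 2 * exp (- (e\<^sup>2 * q / (4 * tau))))" by (intro sum_mono one)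
  finally show ?thesis by simp
qed

text \<open>Fubini for rounds. All rounds other than \<open>k\<close> are frozen in a history
  \<open>g\<close>, and round \<open>k\<close> is fresh. \<open>step\<close> is uniform in
  \<open>g\<close>, so averaging over histories keeps the bound. By \<open>dep\<close> the event
  must be visible from the history with round \<open>k\<close> blanked out and the fresh
  sample.\<close>

lemma bern_round_bound:
  fixes E :: "'c set" and R :: "'k set"
  assumes fin: "finite R" "finite E" and k: "k \<in> R" and q: "0 \<le> q" "q \<le> 1"
    and step: "\<And>g. measure_pmf.prob (bern E q) {\<xi>. Bad g \<xi>} \<le> eta"
    and dep: "\<And>\<xi>. bad \<xi> \<Longrightarrow> Bad (\<lambda>(l, c). l \<noteq> k \<and> \<xi> (l, c)) (\<lambda>c. \<xi> (k, c))"
  shows "measure_pmf.prob (bern (R \<times> E) q) {\<xi>. bad \<xi>} \<le> eta"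
proof -
  define B where "B = (R - {k}) \<times> E"
  have un: "R \<times> E = ({k} \<times> E) \<union> B" using k by (auto simp: B_def)
  have cyl: "bern ({k} \<times> E) q = map_pmf (\<lambda>\<xi> (l, c). l = k \<and> c \<in> E \<and> \<xi> c) (bern E q)"
  proof -
    have "bern E q = map_pmf (\<lambda>g. g \<circ> (\<lambda>c. (k, c))) (bern ({k} \<times> E) q)"
      unfolding bern_def using fin
      by (intro Pi_pmf_bij_betw) (auto simp: bij_betw_def inj_on_def)
    then have "map_pmf (\<lambda>\<xi> (l, c). l = k \<and> c \<in> E \<and> \<xi> c) (bern E q) =
        map_pmf (\<lambda>g (l, c). l = k \<and> c \<in> E \<and> g (k, c)) (bern ({k} \<times> E) q)"
      by (simp add: map_pmf_comp case_prod_unfold)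
    also have "\<dots> = map_pmf (\<lambda>g. g) (bern ({k} \<times> E) q)"
    proof (intro map_pmf_cong refl ext)
      fix g x assume "g \<in> set_pmf (bern ({k} \<times> E) q)"
      then have "\<forall>x. x \<notin> {k} \<times> E \<longrightarrow> g x = False"
        unfolding bern_def using set_Pi_pmf_subset[of "{k} \<times> E" False] fin by blast
      then show "(case x of (l, c) \<Rightarrow> l = k \<and> c \<in> E \<and> g (k, c)) = g x"
        by (cases x) auto
    qed
    finally show ?thesis by simp
  qed
  define D where "D = bern B q"
  have "bern (R \<times> E) q = map_pmf (\<lambda>(f, g) x. if x \<in> {k} \<times> E then f x else g x) (pair_pmf (bern ({k} \<times> E) q) D)"
    unfolding un bern_def D_def using fin by (intro Pi_pmf_union) (auto simp: B_def)
  also have "\<dots> = bind_pmf D (\<lambda>g. map_pmf (\<lambda>\<xi> x. if x \<in> {k} \<times> E then \<xi> (snd x) else g x) (bern E q))"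
    unfolding cyl pair_pmf_def map_bind_pmf bind_map_pmf
    by (subst bind_commute_pmf) (simp add: map_pmf_def bind_return_pmf bind_assoc_pmf,
        intro bind_pmf_cong refl arg_cong[of _ _ return_pmf] ext, auto)
  finally have eq: "bern (R \<times> E) q =
      bind_pmf D (\<lambda>g. map_pmf (\<lambda>\<xi> x. if x \<in> {k} \<times> E then \<xi> (snd x) else g x) (bern E q))" .
  have supp: "\<xi> c \<Longrightarrow> c \<in> E" if "\<xi> \<in> set_pmf (bern E q)" for \<xi> c
    using that set_Pi_pmf_subset[of E False] fin unfolding bern_def by blast
  have suppD: "g x \<Longrightarrow> x \<in> B" if "g \<in> set_pmf D" for g x
    using that set_Pi_pmf_subset[of B False] fin unfolding bern_def D_def B_def by blast
  have cond: "measure_pmf.prob (map_pmf (\<lambda>\<xi> x. if x \<in> {k} \<times> E then \<xi> (snd x) else g x) (bern E q)) {\<xi>. bad \<xi>} \<le> eta"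
    if g: "g \<in> set_pmf D" for g
  proof -
    let ?m = "\<lambda>\<xi> x. if x \<in> {k} \<times> E then \<xi> (snd x) else g x"
    have "measure_pmf.prob (map_pmf ?m (bern E q)) {\<xi>. bad \<xi>} = measure_pmf.prob (bern E q) {\<xi>. bad (?m \<xi>)}"
      by (simp add: vimage_def)
    also have "\<dots> = measure_pmf.prob (bern E q) ({\<xi>. bad (?m \<xi>)} \<inter> set_pmf (bern E q))"
      by (simp add: measure_Int_set_pmf)
    also have "\<dots> \<le> measure_pmf.prob (bern E q) {\<xi>. Bad g \<xi>}"
    proof (intro measure_pmf.finite_measure_mono subsetI)
      fix \<xi> assume "\<xi> \<in> {\<xi>. bad (?m \<xi>)} \<inter> set_pmf (bern E q)"
      then have b: "bad (?m \<xi>)" and x: "\<xi> \<in> set_pmf (bern E q)" by auto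
      have "(\<lambda>(l, c). l \<noteq> k \<and> ?m \<xi> (l, c)) = g"
        using suppD[OF g] by (fastforce simp: fun_eq_iff B_def)
      moreover have "(\<lambda>c. ?m \<xi> (k, c)) = \<xi>"
        using supp[OF x] suppD[OF g] by (fastforce simp: fun_eq_iff B_def)
      ultimately show "\<xi> \<in> {\<xi>. Bad g \<xi>}" using dep[OF b] by simp
    qed auto
    also have "\<dots> \<le> eta" by (rule step)
    finally show ?thesis .
  qed
  have eta: "0 \<le> eta" using order_trans[OF measure_nonneg step] .
  have "emeasure (bern (R \<times> E) q) {\<xi>. bad \<xi>} \<le> (\<integral>\<^sup>+ g. ennreal eta \<partial>D)"
    unfolding eq emeasure_bind_pmf
    by (intro nn_integral_mono_AE)
      (simp add: AE_measure_pmf_iff cond measure_pmf.emeasure_eq_measure ennreal_leI del: measure_map_pmf)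
  then show ?thesis using eta by (simp add: measure_pmf.emeasure_eq_measure)
qed

section \<open>Matrix norms and the tangent space\<close>

lemma abs_ip_le: "\<bar>ip J u v\<bar> \<le> nrm J u * nrm J v"
proof -
  have "sqrt ((ip J u v)\<^sup>2) \<le> sqrt (ip J u u * ip J v v)"
    by (intro real_sqrt_le_mono ip_Cauchy_Schwarz)
  then show ?thesis by (simp add: nrm_def real_sqrt_mult)
qed

lemma nrm_scale: "nrm J (\<lambda>i. c * u i) = \<bar>c\<bar> * nrm J u"
  by (simp add: nrm_def ip_linear real_sqrt_mult flip: power2_eq_square mult.assoc)

lemma nrm_cong: "(\<And>i. i \<in> J \<Longrightarrow> u i = v i) \<Longrightarrow> nrm J u = nrm J v"
  by (simp add: nrm_def cong: ip_cong)

lemma nrm_zero_iff: "finite J \<Longrightarrow> nrm J u = 0 \<longleftrightarrow> (\<forall>i\<in>J. u i = 0)"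
  by (auto simp: nrm_def ip_self sum_nonneg_eq_0_iff)

lemma nrm_le_iff_ip: "0 \<le> s \<Longrightarrow> nrm J u \<le> s \<longleftrightarrow> ip J u u \<le> s\<^sup>2"
  using real_sqrt_le_iff[of "ip J u u" "s\<^sup>2"] by (simp add: nrm_def)

lemma nrm_mono_abs:
  "(\<And>i. i \<in> J \<Longrightarrow> \<bar>u i\<bar> \<le> \<bar>v i\<bar>) \<Longrightarrow> nrm J u \<le> nrm J v"
  by (simp add: nrm_def ip_self) (intro sum_mono, simp add: abs_le_square_iff)

lemma nrm_triangle: "nrm J (\<lambda>i. u i + v i) \<le> nrm J u + nrm J v"
proof -
  have "ip J (\<lambda>i. u i + v i) (\<lambda>i. u i + v i) = (nrm J u)\<^sup>2 + 2 * ip J u v + (nrm J v)\<^sup>2"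
    unfolding nrm_square using ip_commute[of J u v] by (simp add: ip_linear)
  also have "\<dots> \<le> (nrm J u)\<^sup>2 + 2 * (nrm J u * nrm J v) + (nrm J v)\<^sup>2"
    using abs_ip_le[of J u v] by simp
  also have "\<dots> = (nrm J u + nrm J v)\<^sup>2" by (simp add: power2_eq_square algebra_simps)
  finally show ?thesis by (simp add: nrm_le_iff_ip nrm_nonneg)
qed

lemma sum_cells: "(\<Sum>c\<in>cells n1 n2. f c) = (\<Sum>i<n1. \<Sum>j<n2. f (i, j))"
  by (simp add: sum.cartesian_product)

text \<open>Spectral norm at most \<open>s\<close> for a matrix given as a function on cells. Unlike
  \<open>spec_norm\<close> it is stable under sums and entrywise congruence without any carrier
  conditions.\<close>

definition bil_bound :: "nat \<Rightarrow> nat \<Rightarrow> (nat \<times> nat \<Rightarrow> real) \<Rightarrow> real \<Rightarrow> bool" where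
  "bil_bound n1 n2 z s \<longleftrightarrow> (\<forall>x y.
     \<bar>\<Sum>c\<in>cells n1 n2. z c * x (fst c) * y (snd c)\<bar> \<le> s * nrm {..<n1} x * nrm {..<n2} y)"

lemma nrm_tensor:
  "nrm (cells n1 n2) (\<lambda>c. x (fst c) * y (snd c)) = nrm {..<n1} x * nrm {..<n2} y"
proof -
  have "ip (cells n1 n2) (\<lambda>c. x (fst c) * y (snd c)) (\<lambda>c. x (fst c) * y (snd c)) =
      ip {..<n1} x x * ip {..<n2} y y"
    by (simp add: ip_def sum_cells sum_product algebra_simps)
  then show ?thesis by (simp add: nrm_def real_sqrt_mult)
qed

lemma bil_bound_nrm: "bil_bound n1 n2 z (nrm (cells n1 n2) z)"
  unfolding bil_bound_def
proof (intro allI)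
  fix x y
  have "(\<Sum>c\<in>cells n1 n2. z c * x (fst c) * y (snd c)) =
      ip (cells n1 n2) z (\<lambda>c. x (fst c) * y (snd c))"
    by (simp add: ip_def mult.assoc)
  then show "\<bar>\<Sum>c\<in>cells n1 n2. z c * x (fst c) * y (snd c)\<bar>
      \<le> nrm (cells n1 n2) z * nrm {..<n1} x * nrm {..<n2} y"
    using abs_ip_le[of "cells n1 n2" z "\<lambda>c. x (fst c) * y (snd c)"]
    by (simp add: nrm_tensor mult.assoc)
qed

lemma bil_bound_add:
  assumes "bil_bound n1 n2 z s" "bil_bound n1 n2 w t"
  shows "bil_bound n1 n2 (\<lambda>c. z c + w c) (s + t)"
  unfolding bil_bound_def
proof (intro allI)
  fix x y
  have "\<bar>\<Sum>c\<in>cells n1 n2. (z c + w c) * x (fst c) * y (snd c)\<bar> \<le>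
     \<bar>\<Sum>c\<in>cells n1 n2. z c * x (fst c) * y (snd c)\<bar> +
     \<bar>\<Sum>c\<in>cells n1 n2. w c * x (fst c) * y (snd c)\<bar>"
    by (simp add: distrib_right sum.distrib abs_triangle_ineq)
  also have "\<dots> \<le> s * nrm {..<n1} x * nrm {..<n2} y + t * nrm {..<n1} x * nrm {..<n2} y"
    using assms by (intro add_mono) (auto simp: bil_bound_def)
  finally show "\<bar>\<Sum>c\<in>cells n1 n2. (z c + w c) * x (fst c) * y (snd c)\<bar>
      \<le> (s + t) * nrm {..<n1} x * nrm {..<n2} y" by (simp add: algebra_simps)
qed

lemma bil_bound_mono: "bil_bound n1 n2 z s \<Longrightarrow> s \<le> t \<Longrightarrow> bil_bound n1 n2 z t"
  unfolding bil_bound_def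
  by (meson mult_right_mono nrm_nonneg order_trans)

lemma bil_bound_sum:
  fixes s :: "'a \<Rightarrow> real"
  assumes "finite A" "\<And>k. k \<in> A \<Longrightarrow> bil_bound n1 n2 (z k) (s k)"
  shows "bil_bound n1 n2 (\<lambda>c. \<Sum>k\<in>A. z k c) (\<Sum>k\<in>A. s k)"
  using assms
proof (induction A rule: finite_induct)
  case empty
  then show ?case by (simp add: bil_bound_def)
next
  case (insert k A)
  have "bil_bound n1 n2 (\<lambda>c. z k c + (\<Sum>k\<in>A. z k c)) (s k + (\<Sum>k\<in>A. s k))"
    using insert by (intro bil_bound_add) auto
  then show ?case using insert by simp
qed

lemma bil_bound_cong:
  assumes "\<And>c. c \<in> cells n1 n2 \<Longrightarrow> z c = w c"
  shows "bil_bound n1 n2 z s \<longleftrightarrow> bil_bound n1 n2 w s"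
proof -
  have "(\<Sum>c\<in>cells n1 n2. z c * x (fst c) * y (snd c)) =
      (\<Sum>c\<in>cells n1 n2. w c * x (fst c) * y (snd c))" for x y
    by (intro sum.cong refl) (simp add: assms)
  then show ?thesis by (simp add: bil_bound_def)
qed

lemma vnorm_nrm: "vnorm v = nrm {..<dim_vec v} (vec_index v)"
  by (simp add: vnorm_def nrm_def ip_def scalar_prod_def atLeast0LessThan)

lemma mult_mat_vec_index:
  "A \<in> carrier_mat n1 n2 \<Longrightarrow> x \<in> carrier_vec n2 \<Longrightarrow> i < n1 \<Longrightarrow>
    vec_index (A *\<^sub>v x) i = (\<Sum>j<n2. A $$ (i, j) * vec_index x j)"
  by (simp add: scalar_prod_def atLeast0LessThan)

lemma vnorm_mult_le:
  assumes A: "A \<in> carrier_mat n1 n2" and x: "x \<in> carrier_vec n2" and b: "bil_bound n1 n2 (($$) A) s"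
    and s: "0 \<le> s"
  shows "vnorm (A *\<^sub>v x) \<le> s * vnorm x"
proof -
  \<comment> \<open>The image itself serves as the left test vector, which gives a square on one
    side.\<close>
  define u where "u = vec_index (A *\<^sub>v x)"
  have nu: "vnorm (A *\<^sub>v x) = nrm {..<n1} u" using A by (simp add: vnorm_nrm u_def)
  have nx: "vnorm x = nrm {..<n2} (vec_index x)" using x by (simp add: vnorm_nrm)
  have "ip {..<n1} u u = (\<Sum>i<n1. u i * (\<Sum>j<n2. A $$ (i, j) * vec_index x j))"
    unfolding ip_def u_def using mult_mat_vec_index[OF A x] by (intro sum.cong refl) simp
  also have "\<dots> = (\<Sum>c\<in>cells n1 n2. A $$ c * u (fst c) * vec_index x (snd c))"
    by (simp add: sum_cells sum_distrib_left algebra_simps)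
  also have "\<dots> \<le> s * nrm {..<n1} u * nrm {..<n2} (vec_index x)"
    using b unfolding bil_bound_def by (meson abs_le_D1)
  finally have "(nrm {..<n1} u)\<^sup>2 \<le> nrm {..<n1} u * (s * vnorm x)"
    by (simp add: nrm_square nx algebra_simps)
  moreover have "0 \<le> s * vnorm x" using s by (simp add: nx nrm_nonneg)
  ultimately show ?thesis
    using nrm_nonneg[of "{..<n1}" u] unfolding nu
    by (cases "nrm {..<n1} u = 0") (auto simp: power2_eq_square)
qed

text \<open>A real-valued \<open>SUP\<close> bounds its members only over a bounded set; the
  Frobenius norm supplies the bound.\<close>

lemma spec_norm_bdd:
  assumes A: "A \<in> carrier_mat n1 n2"
  shows "bdd_above ((\<lambda>x. vnorm (A *\<^sub>v x)) ` {x \<in> carrier_vec (dim_col A). vnorm x \<le> 1})"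
proof (intro bdd_aboveI2)
  fix x assume x: "x \<in> {x \<in> carrier_vec (dim_col A). vnorm x \<le> 1}"
  define s where "s = nrm (cells n1 n2) (($$) A)"
  have "vnorm (A *\<^sub>v x) \<le> s * vnorm x"
    using A x vnorm_mult_le[OF A _ bil_bound_nrm nrm_nonneg] by (simp add: s_def)
  also have "\<dots> \<le> s * 1" using x by (intro mult_left_mono) (auto simp: s_def nrm_nonneg)
  finally show "vnorm (A *\<^sub>v x) \<le> s" by simp
qed

lemma spec_norm_le:
  assumes A: "A \<in> carrier_mat n1 n2" and b: "bil_bound n1 n2 (($$) A) s" and s: "0 \<le> s"
  shows "spec_norm A \<le> s"
  unfolding spec_norm_def
proof (rule cSUP_least)
  have "0\<^sub>v (dim_col A) \<in> {x \<in> carrier_vec (dim_col A). vnorm x \<le> 1}" by (simp add: vnorm_def)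
  then show "{x \<in> carrier_vec (dim_col A). vnorm x \<le> 1} \<noteq> {}" by blast
next
  fix x assume x: "x \<in> {x \<in> carrier_vec (dim_col A). vnorm x \<le> 1}"
  have "vnorm (A *\<^sub>v x) \<le> s * vnorm x" using A x vnorm_mult_le[OF A _ b s] by simp
  also have "\<dots> \<le> s * 1" using x s by (intro mult_left_mono) auto
  finally show "vnorm (A *\<^sub>v x) \<le> s" by simp
qed

lemma spec_norm_nonneg:
  assumes A: "A \<in> carrier_mat n1 n2"
  shows "0 \<le> spec_norm A"
proof -
  have "0 \<le> vnorm (A *\<^sub>v 0\<^sub>v (dim_col A))" by (simp add: vnorm_nrm nrm_nonneg)
  also have "\<dots> \<le> spec_norm A" unfolding spec_norm_def
    by (intro cSUP_upper spec_norm_bdd[OF A]) (simp add: vnorm_def)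
  finally show ?thesis .
qed

lemma bil_bound_spec_norm:
  assumes A: "A \<in> carrier_mat n1 n2"
  shows "bil_bound n1 n2 (($$) A) (spec_norm A)"
  unfolding bil_bound_def
proof (intro allI)
  fix x y
  let ?S = "\<Sum>c\<in>cells n1 n2. A $$ c * x (fst c) * y (snd c)"
  show "\<bar>?S\<bar> \<le> spec_norm A * nrm {..<n1} x * nrm {..<n2} y"
  proof (cases "nrm {..<n2} y = 0")
    case True
    then have "?S = 0" by (intro sum.neutral) (auto simp: nrm_zero_iff)
    then show ?thesis using True by simp
  next
    case False
    define t where "t = nrm {..<n2} y"
    have t: "0 < t" using False nrm_nonneg[of "{..<n2}" y] by (simp add: t_def)
    define v where "v = Matrix.vec n2 (\<lambda>j. (1 / t) * y j)"
    have v: "v \<in> carrier_vec n2" by (simp add: v_def)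
    have "vnorm v = nrm {..<n2} (vec_index v)" by (simp add: vnorm_nrm v_def)
    also have "\<dots> = nrm {..<n2} (\<lambda>j. (1 / t) * y j)" by (rule nrm_cong) (simp add: v_def)
    also have "\<dots> = 1" unfolding nrm_scale using t by (simp add: t_def)
    finally have v1: "vnorm v = 1" .
    have "?S = t * ip {..<n1} x (vec_index (A *\<^sub>v v))"
    proof -
      have "ip {..<n1} x (vec_index (A *\<^sub>v v)) = (\<Sum>i<n1. x i * (\<Sum>j<n2. A $$ (i, j) * ((1 / t) * y j)))"
        unfolding ip_def using mult_mat_vec_index[OF A v] by (intro sum.cong refl) (simp add: v_def)
      also have "\<dots> = (1 / t) * ?S" by (simp add: sum_cells sum_distrib_left algebra_simps)
      finally show ?thesis using t by simp
    qed
    also have "\<bar>\<dots>\<bar> \<le> t * (nrm {..<n1} x * nrm {..<n1} (vec_index (A *\<^sub>v v)))"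
      unfolding abs_mult using t by (auto intro!: mult_left_mono abs_ip_le)
    also have "nrm {..<n1} (vec_index (A *\<^sub>v v)) = vnorm (A *\<^sub>v v)" using A by (simp add: vnorm_nrm)
    also have "t * (nrm {..<n1} x * vnorm (A *\<^sub>v v)) \<le> t * (nrm {..<n1} x * spec_norm A)"
      using t v v1 A unfolding spec_norm_def
      by (intro mult_left_mono cSUP_upper spec_norm_bdd[OF A]) (auto simp: nrm_nonneg)
    finally show ?thesis by (simp add: t_def algebra_simps)
  qed
qed

lemma mat_inner_ip:
  "A \<in> carrier_mat n1 n2 \<Longrightarrow> mat_inner A B = ip (cells n1 n2) (($$) A) (($$) B)"
  by (simp add: mat_inner_def ip_def sum_cells)

lemma frob_norm_nrm: "A \<in> carrier_mat n1 n2 \<Longrightarrow> frob_norm A = nrm (cells n1 n2) (($$) A)"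
  by (simp add: frob_norm_def nrm_def mat_inner_ip)

lemma finite_elements_mat: "finite (elements_mat A)"
  by (simp add: elements_mat_def)

lemma max_norm_ge:
  "A \<in> carrier_mat n1 n2 \<Longrightarrow> c \<in> cells n1 n2 \<Longrightarrow> \<bar>A $$ c\<bar> \<le> max_norm A"
  unfolding max_norm_def by (intro Max_ge finite_imageI finite_elements_mat) auto

lemma max_norm_le:
  assumes "A \<in> carrier_mat n1 n2" "0 < n1" "0 < n2" "\<And>c. c \<in> cells n1 n2 \<Longrightarrow> \<bar>A $$ c\<bar> \<le> b"
  shows "max_norm A \<le> b"
proof -
  have "A $$ (0, 0) \<in> elements_mat A" using assms by auto
  then show ?thesis
    unfolding max_norm_def using assms
    by (subst Max_le_iff) (auto simp: finite_elements_mat dest!: elements_matD)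
qed

section \<open>Orthonormal columns and the kernel of the tangent projection\<close>

definition orthocols :: "nat \<Rightarrow> nat \<Rightarrow> real mat \<Rightarrow> bool" where
  "orthocols n r U \<longleftrightarrow> U \<in> carrier_mat n r \<and>
     (\<forall>k<r. \<forall>l<r. (\<Sum>i<n. U $$ (i, k) * U $$ (i, l)) = of_bool (k = l))"

lemma orthocolsI:
  assumes U: "U \<in> carrier_mat n r" and UU: "transpose_mat U * U = 1\<^sub>m r"
  shows "orthocols n r U"
  unfolding orthocols_def
proof (intro conjI allI impI U)
  fix k l assume kl: "k < r" "l < r"
  have "(transpose_mat U * U) $$ (k, l) = (\<Sum>i<n. U $$ (i, k) * U $$ (i, l))"
    using U kl by (simp add: scalar_prod_def atLeast0LessThan)
  then show "(\<Sum>i<n. U $$ (i, k) * U $$ (i, l)) = of_bool (k = l)" using kl by (auto simp: UU)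
qed

text \<open>The entries of \<open>1 - U U^T\<close>, the projection onto the orthogonal complement
  of the columns of \<open>U\<close>.\<close>

definition comp_proj :: "real mat \<Rightarrow> nat \<Rightarrow> nat \<Rightarrow> real" where
  "comp_proj U i a = of_bool (i = a) - (\<Sum>k<dim_col U. U $$ (i, k) * U $$ (a, k))"

lemma comp_proj_sym: "comp_proj U i a = comp_proj U a i"
  by (simp add: comp_proj_def mult.commute eq_commute[of i a])

lemma comp_proj_col:
  assumes U: "orthocols n r U" and "i < n" "k < r"
  shows "(\<Sum>a<n. comp_proj U i a * U $$ (a, k)) = 0"
proof -
  have dim: "dim_col U = r" using U by (auto simp: orthocols_def)
  have "(\<Sum>a<n. comp_proj U i a * U $$ (a, k)) =
      (\<Sum>a<n. of_bool (i = a) * U $$ (a, k)) - (\<Sum>a<n. \<Sum>l<r. U $$ (i, l) * (U $$ (a, l) * U $$ (a, k)))"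
    by (simp add: comp_proj_def dim left_diff_distrib sum_subtractf sum_distrib_right mult.assoc)
  also have "(\<Sum>a<n. of_bool (i = a) * U $$ (a, k)) = U $$ (i, k)"
    using assms by (simp add: of_bool_def if_distribR if_distrib[of "\<lambda>t. t * _"] cong: if_cong)
  also have "(\<Sum>a<n. \<Sum>l<r. U $$ (i, l) * (U $$ (a, l) * U $$ (a, k))) =
      (\<Sum>l<r. U $$ (i, l) * (\<Sum>a<n. U $$ (a, l) * U $$ (a, k)))"
    unfolding sum_distrib_left by (rule sum.swap)
  also have "\<dots> = (\<Sum>l<r. if l = k then U $$ (i, l) else 0)"
    using U assms(3) by (intro sum.cong refl) (simp add: orthocols_def)
  also have "\<dots> = U $$ (i, k)" using assms by simp
  finally show ?thesis by simp
qed

lemma comp_proj_idem: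
  assumes U: "orthocols n r U" and ij: "i < n" "j < n"
  shows "(\<Sum>a<n. comp_proj U i a * comp_proj U a j) = comp_proj U i j"
proof -
  have dim: "dim_col U = r" using U by (auto simp: orthocols_def)
  have "(\<Sum>a<n. comp_proj U i a * comp_proj U a j) =
      (\<Sum>a<n. comp_proj U i a * of_bool (a = j)) -
      (\<Sum>a<n. \<Sum>k<r. (comp_proj U i a * U $$ (a, k)) * U $$ (j, k))"
    unfolding comp_proj_def[of U _ j] dim
    by (simp add: right_diff_distrib sum_subtractf sum_distrib_left mult.assoc)
  also have "(\<Sum>a<n. comp_proj U i a * of_bool (a = j)) = comp_proj U i j"
    using ij by (simp add: of_bool_def if_distrib[of "\<lambda>t. _ * t"] cong: if_cong)
  also have "(\<Sum>a<n. \<Sum>k<r. (comp_proj U i a * U $$ (a, k)) * U $$ (j, k)) =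
      (\<Sum>k<r. (\<Sum>a<n. comp_proj U i a * U $$ (a, k)) * U $$ (j, k))"
    unfolding sum_distrib_right by (rule sum.swap)
  also have "\<dots> = 0" using comp_proj_col[OF U ij(1)] by simp
  finally show ?thesis by simp
qed

lemma comp_proj_diag_nonneg:
  assumes U: "orthocols n r U" and i: "i < n"
  shows "0 \<le> comp_proj U i i"
proof -
  have "comp_proj U i i = (\<Sum>a<n. comp_proj U i a * comp_proj U i a)"
    unfolding comp_proj_idem[OF U i i, symmetric]
    by (intro sum.cong refl) (metis comp_proj_sym)
  then show ?thesis by (simp add: sum_nonneg)
qed

text \<open>The usual formula \<open>U U^T Z + Z V V^T - U U^T Z V V^T\<close>, rewritten as
  \<open>Z - (1 - U U^T) Z (1 - V V^T)\<close> and viewed as a kernel on pairs of cells.\<close>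

definition tan_kernel :: "real mat \<Rightarrow> real mat \<Rightarrow> nat \<times> nat \<Rightarrow> nat \<times> nat \<Rightarrow> real" where
  "tan_kernel U V c d = of_bool (c = d) - comp_proj U (fst c) (fst d) * comp_proj V (snd c) (snd d)"

lemma app_tan_kernel:
  assumes "i < n1" "j < n2"
  shows "app (cells n1 n2) (tan_kernel U V) z (i, j) =
    z (i, j) - (\<Sum>a<n1. \<Sum>b<n2. comp_proj U i a * z (a, b) * comp_proj V b j)"
proof -
  have "app (cells n1 n2) (tan_kernel U V) z (i, j) =
     (\<Sum>c\<in>cells n1 n2. of_bool ((i, j) = c) * z c) -
     (\<Sum>c\<in>cells n1 n2. comp_proj U i (fst c) * comp_proj V j (snd c) * z c)"
    by (simp add: app_def tan_kernel_def left_diff_distrib sum_subtractf)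
  also have "(\<Sum>c\<in>cells n1 n2. of_bool ((i, j) = c) * z c) = z (i, j)"
    using assms by (simp add: of_bool_def if_distrib[of "\<lambda>t. t * _"] cong: if_cong)
  also have "(\<Sum>c\<in>cells n1 n2. comp_proj U i (fst c) * comp_proj V j (snd c) * z c) =
      (\<Sum>a<n1. \<Sum>b<n2. comp_proj U i a * z (a, b) * comp_proj V b j)"
    unfolding sum_cells by (intro sum.cong refl) (simp add: comp_proj_sym[of V j] algebra_simps)
  finally show ?thesis .
qed

text \<open>\<open>1 - Q\<close> is idempotent because \<open>Q\<close> is. On the diagonal it is
  \<open>1 - (1 - s) * (1 - t) \<le> s + t\<close>, where \<open>s\<close> and \<open>t\<close> are
  the squared row norms of \<open>U\<close> and \<open>V\<close>.\<close>

lemma tan_kernel_proj: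
  assumes U: "orthocols n1 r U" and V: "orthocols n2 r V"
    and tau: "\<And>i j. i < n1 \<Longrightarrow> j < n2 \<Longrightarrow> (\<Sum>k<r. (U $$ (i, k))\<^sup>2) + (\<Sum>k<r. (V $$ (j, k))\<^sup>2) \<le> tau"
  shows "proj_kernel (cells n1 n2) (tan_kernel U V) tau"
proof -
  let ?E = "cells n1 n2"
  let ?Q = "\<lambda>c d. comp_proj U (fst c) (fst d) * comp_proj V (snd c) (snd d)"
  have dim: "dim_col U = r" "dim_col V = r" using U V by (auto simp: orthocols_def)
  have QQ: "(\<Sum>c\<in>?E. ?Q a c * ?Q c b) = ?Q a b" if "a \<in> ?E" "b \<in> ?E" for a b
  proof -
    have "(\<Sum>c\<in>?E. ?Q a c * ?Q c b) =
      (\<Sum>i<n1. comp_proj U (fst a) i * comp_proj U i (fst b)) * (\<Sum>j<n2. comp_proj V (snd a) j * comp_proj V j (snd b))"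
      by (simp add: sum_cells sum_product algebra_simps)
    then show ?thesis using that comp_proj_idem[OF U] comp_proj_idem[OF V] by auto
  qed
  have "(\<Sum>c\<in>?E. tan_kernel U V a c * tan_kernel U V c b) = tan_kernel U V a b"
    if ab: "a \<in> ?E" "b \<in> ?E" for a b
  proof -
    have "(\<Sum>c\<in>?E. tan_kernel U V a c * tan_kernel U V c b) =
      (\<Sum>c\<in>?E. (if c = a then of_bool (a = b) - ?Q a b else 0) - (if c = b then ?Q a b else 0) + ?Q a c * ?Q c b)"
      by (intro sum.cong refl) (auto simp: tan_kernel_def algebra_simps)
    also have "\<dots> = of_bool (a = b) - ?Q a b - ?Q a b + ?Q a b"
      using ab by (simp add: sum.distrib sum_subtractf QQ[OF ab])
    finally show ?thesis by (simp add: tan_kernel_def)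
  qed
  moreover have "tan_kernel U V a a \<le> tau" if a: "a \<in> ?E" for a
  proof -
    obtain i j where ij: "a = (i, j)" "i < n1" "j < n2" using a by auto
    define s where "s = (\<Sum>k<r. (U $$ (i, k))\<^sup>2)"
    define t where "t = (\<Sum>k<r. (V $$ (j, k))\<^sup>2)"
    have "tan_kernel U V a a = 1 - (1 - s) * (1 - t)"
      by (simp add: tan_kernel_def ij comp_proj_def dim s_def t_def power2_eq_square)
    also have "\<dots> \<le> s + t" by (simp add: algebra_simps s_def t_def sum_nonneg)
    also have "\<dots> \<le> tau" using tau[OF ij(2,3)] by (simp add: s_def t_def)
    finally show ?thesis .
  qed
  moreover have "tan_kernel U V a b = tan_kernel U V b a" for a b
    using comp_proj_sym[of U "fst a" "fst b"] comp_proj_sym[of V "snd a" "snd b"]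
    by (simp add: tan_kernel_def eq_commute[of a b])
  ultimately show ?thesis by (auto simp: proj_kernel_def)
qed

text \<open>The complement of \<open>tan_kernel\<close> is a tensor product of two projections.\<close>

lemma bil_bound_tan_complement:
  assumes U: "orthocols n1 r U" and V: "orthocols n2 r V" and z: "bil_bound n1 n2 z s" and s: "0 \<le> s"
  shows "bil_bound n1 n2 (\<lambda>c. z c - app (cells n1 n2) (tan_kernel U V) z c) s"
  unfolding bil_bound_def
proof (intro allI)
  fix x y
  let ?S = "\<lambda>z x y. \<Sum>c\<in>cells n1 n2. z c * x (fst c) * y (snd c)"
  have contr: "nrm {..<n} (app {..<n} (comp_proj W) x) \<le> nrm {..<n} x" if W: "orthocols n r W" for n W x
  proof -
    have "(\<Sum>a<n. comp_proj W i a * comp_proj W a j) = comp_proj W i j" if "i < n" "j < n" for i j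
      using comp_proj_idem[OF W that] .
    \<comment> \<open>Any bound on the diagonal will do as \<open>tau\<close>; the maximum over the
      diagonal provides one.\<close>
    then have "proj_kernel {..<n} (comp_proj W) (Max (insert 0 ((\<lambda>i. comp_proj W i i) ` {..<n})))"
      by (auto simp: proj_kernel_def comp_proj_sym intro!: Max_ge)
    from proj_kernel_contraction[OF this, of x] show ?thesis by (simp add: nrm_def)
  qed
  have "?S (\<lambda>c. z c - app (cells n1 n2) (tan_kernel U V) z c) x y =
      (\<Sum>i<n1. \<Sum>j<n2. (\<Sum>a<n1. \<Sum>b<n2. comp_proj U i a * z (a, b) * comp_proj V b j) * x i * y j)"
    by (simp add: sum_cells app_tan_kernel)
  also have "\<dots> = (\<Sum>i<n1. \<Sum>j<n2. \<Sum>a<n1. \<Sum>b<n2. z (a, b) * (comp_proj U a i * x i) * (comp_proj V b j * y j))"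
    by (intro sum.cong refl) (simp add: sum_distrib_left sum_distrib_right comp_proj_sym algebra_simps)
  also have "\<dots> = (\<Sum>i<n1. \<Sum>a<n1. \<Sum>j<n2. \<Sum>b<n2. z (a, b) * (comp_proj U a i * x i) * (comp_proj V b j * y j))"
    by (intro sum.cong refl sum.swap)
  also have "\<dots> = (\<Sum>a<n1. \<Sum>i<n1. \<Sum>j<n2. \<Sum>b<n2. z (a, b) * (comp_proj U a i * x i) * (comp_proj V b j * y j))"
    by (rule sum.swap)
  also have "\<dots> = (\<Sum>a<n1. \<Sum>i<n1. \<Sum>b<n2. \<Sum>j<n2. z (a, b) * (comp_proj U a i * x i) * (comp_proj V b j * y j))"
    by (intro sum.cong refl sum.swap)
  also have "\<dots> = (\<Sum>a<n1. \<Sum>b<n2. \<Sum>i<n1. \<Sum>j<n2. z (a, b) * (comp_proj U a i * x i) * (comp_proj V b j * y j))"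
    by (intro sum.cong refl sum.swap)
  also have "\<dots> = ?S z (app {..<n1} (comp_proj U) x) (app {..<n2} (comp_proj V) y)"
    unfolding sum_cells app_def fst_conv snd_conv
    by (intro sum.cong refl) (simp only: mult.assoc sum_product, simp only: sum_distrib_left)
  finally have "\<bar>?S (\<lambda>c. z c - app (cells n1 n2) (tan_kernel U V) z c) x y\<bar> \<le>
      s * nrm {..<n1} (app {..<n1} (comp_proj U) x) * nrm {..<n2} (app {..<n2} (comp_proj V) y)"
    using z by (simp add: bil_bound_def)
  also have "\<dots> \<le> s * nrm {..<n1} x * nrm {..<n2} y"
    using s contr[OF U, of x] contr[OF V, of y] by (intro mult_mono) (auto simp: nrm_nonneg)
  finally show "\<bar>?S (\<lambda>c. z c - app (cells n1 n2) (tan_kernel U V) z c) x y\<bar>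
      \<le> s * nrm {..<n1} x * nrm {..<n2} y" .
qed

section \<open>Trace norm duality\<close>

lemma comp_proj_apply:
  assumes "i < n"
  shows "(\<Sum>a<n. comp_proj U i a * f a) =
    f i - (\<Sum>k<dim_col U. U $$ (i, k) * (\<Sum>a<n. U $$ (a, k) * f a))"
proof -
  have "(\<Sum>a<n. comp_proj U i a * f a) =
      (\<Sum>a<n. of_bool (i = a) * f a) - (\<Sum>a<n. \<Sum>k<dim_col U. U $$ (i, k) * (U $$ (a, k) * f a))"
    by (simp add: comp_proj_def left_diff_distrib sum_subtractf sum_distrib_right mult.assoc)
  also have "(\<Sum>a<n. of_bool (i = a) * f a) = f i"
    using assms by (simp add: of_bool_def if_distrib[of "\<lambda>t. t * _"] cong: if_cong)
  also have "(\<Sum>a<n. \<Sum>k<dim_col U. U $$ (i, k) * (U $$ (a, k) * f a)) =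
      (\<Sum>k<dim_col U. U $$ (i, k) * (\<Sum>a<n. U $$ (a, k) * f a))"
    unfolding sum_distrib_left by (rule sum.swap)
  finally show ?thesis .
qed

text \<open>Writes a projected matrix explicitly as a sum of terms \<open>u_k y^T\<close> and
  \<open>x v_k^T\<close>. It gives membership in the span for \<open>tangent_iff\<close>, and later
  shows that a matrix orthogonal to all \<open>u_k\<close> and \<open>v_k\<close> projects to
  0.\<close>

lemma app_tan_kernel_expand:
  fixes U V :: "real mat" and z :: "nat \<times> nat \<Rightarrow> real"
  assumes "i < n1" "j < n2"
  defines "m \<equiv> \<lambda>z :: nat \<times> nat \<Rightarrow> real. \<lambda>i b. (\<Sum>a<n1. comp_proj U i a * z (a, b))"
  shows "app (cells n1 n2) (tan_kernel U V) z (i, j) =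
    (\<Sum>k<dim_col U. U $$ (i, k) * (\<Sum>a<n1. U $$ (a, k) * z (a, j))) +
    (\<Sum>k<dim_col V. (\<Sum>b<n2. V $$ (b, k) * m z i b) * V $$ (j, k))"
proof -
  have "(\<Sum>a<n1. \<Sum>b<n2. comp_proj U i a * z (a, b) * comp_proj V b j) = (\<Sum>b<n2. comp_proj V j b * m z i b)"
    unfolding m_def sum_distrib_left
    by (subst sum.swap) (intro sum.cong refl, simp add: comp_proj_sym[of V j] algebra_simps)
  also have "\<dots> = m z i j - (\<Sum>k<dim_col V. V $$ (j, k) * (\<Sum>b<n2. V $$ (b, k) * m z i b))"
    by (rule comp_proj_apply[OF assms(2)])
  also have "m z i j = z (i, j) - (\<Sum>k<dim_col U. U $$ (i, k) * (\<Sum>a<n1. U $$ (a, k) * z (a, j)))"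
    unfolding m_def by (rule comp_proj_apply[OF assms(1)])
  finally show ?thesis by (simp add: app_tan_kernel[OF assms(1,2)] mult.commute)
qed

lemma app_add: "app J K (\<lambda>i. u i + v i) = (\<lambda>i. app J K u i + app J K v i)"
  by (simp add: app_def fun_eq_iff distrib_left sum.distrib)

lemma app_diff: "app J K (\<lambda>i. u i - v i) = (\<lambda>i. app J K u i - app J K v i)"
  by (simp add: app_def fun_eq_iff right_diff_distrib sum_subtractf)

lemma app_scale: "app J K (\<lambda>i. c * u i) = (\<lambda>i. c * app J K u i)"
  by (simp add: app_def fun_eq_iff sum_distrib_left mult.left_commute)

lemma app_cong: "(\<And>i. i \<in> J \<Longrightarrow> u i = v i) \<Longrightarrow> app J K u = app J K v"
  by (simp add: app_def fun_eq_iff)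

text \<open>The fixed points of the projection form a submodule containing the generators, hence the
  span. Conversely, a fixed point equals its own expansion, a finite sum of generators.\<close>

lemma tangent_iff:
  assumes U: "orthocols n1 r U" and V: "orthocols n2 r V"
  shows "Z \<in> tangent U V \<longleftrightarrow> Z \<in> carrier_mat n1 n2 \<and>
    (\<forall>c\<in>cells n1 n2. app (cells n1 n2) (tan_kernel U V) (($$) Z) c = Z $$ c)"
proof -
  let ?E = "cells n1 n2"
  let ?P = "app ?E (tan_kernel U V)"
  let ?M = "module_mat TYPE(real) n1 n2"
  define N where "N = {Z \<in> carrier_mat n1 n2. \<forall>c\<in>?E. ?P (($$) Z) c = Z $$ c}"
  define S where "S = {outer (col U k) y | k y. k < dim_col U \<and> y \<in> carrier_vec (dim_row V)} \<union>
      {outer x (col V k) | k x. k < dim_col V \<and> x \<in> carrier_vec (dim_row U)}"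
  have dU: "dim_row U = n1" "dim_col U = r" and dV: "dim_row V = n2" "dim_col V = r"
    using U V by (auto simp: orthocols_def)
  interpret vs: vectorspace "class_ring :: real ring" ?M by (rule matrix_vs)
  have T: "tangent U V = vs.span S" by (simp add: tangent_def S_def dU dV)
  have Sc: "S \<subseteq> carrier_mat n1 n2" by (auto simp: S_def outer_def dU dV)
  have sub: "submodule class_ring (vs.span S) ?M"
    using Sc by (intro vs.span_is_submodule) (simp add: module_mat_simps)
  have gen: "S \<subseteq> vs.span S" using Sc by (intro vs.in_own_span) (simp add: module_mat_simps)
  have addT: "A + B \<in> tangent U V" if "A \<in> tangent U V" "B \<in> tangent U V" for A B
    using submodule.m_closed[OF sub, of A B] that by (simp add: T module_mat_simps)
  have zeroT: "0\<^sub>m n1 n2 \<in> tangent U V"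
    using submodule.zero_closed[OF sub] by (simp add: T module_mat_simps)
  have "S \<subseteq> N"
  proof
    fix Z assume "Z \<in> S"
    then consider (l) k y where "k < r" "y \<in> carrier_vec n2" "Z = outer (col U k) y"
      | (r) k x where "k < r" "x \<in> carrier_vec n1" "Z = outer x (col V k)"
      by (auto simp: S_def dU dV)
    then show "Z \<in> N"
    proof cases
      case l
      have "?P (($$) Z) (i, j) = Z $$ (i, j)" if ij: "i < n1" "j < n2" for i j
      proof -
        have "(\<Sum>a<n1. \<Sum>b<n2. comp_proj U i a * Z $$ (a, b) * comp_proj V b j) =
          (\<Sum>a<n1. comp_proj U i a * U $$ (a, k)) * (\<Sum>b<n2. vec_index y b * comp_proj V b j)"
          unfolding sum_product
          using l by (intro sum.cong refl) (simp add: outer_def dU dV algebra_simps)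
        then show ?thesis using ij l comp_proj_col[OF U] by (simp add: app_tan_kernel)
      qed
      then show ?thesis using l by (auto simp: N_def outer_def dU)
    next
      case r
      have "?P (($$) Z) (i, j) = Z $$ (i, j)" if ij: "i < n1" "j < n2" for i j
      proof -
        have "(\<Sum>a<n1. \<Sum>b<n2. comp_proj U i a * Z $$ (a, b) * comp_proj V b j) =
          (\<Sum>a<n1. comp_proj U i a * vec_index x a) * (\<Sum>b<n2. comp_proj V j b * V $$ (b, k))"
          unfolding sum_product
          using r by (intro sum.cong refl) (simp add: outer_def dU dV comp_proj_sym[of V j] algebra_simps)
        then show ?thesis using ij r comp_proj_col[OF V] by (simp add: app_tan_kernel)
      qed
      then show ?thesis using r by (auto simp: N_def outer_def dV)
    qed
  qed
  moreover have "submodule class_ring N ?M"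
  proof (rule submodule.intro)
    show "module class_ring ?M" ..
    show "N \<subseteq> carrier ?M" by (auto simp: N_def module_mat_simps)
    show "A \<oplus>\<^bsub>?M\<^esub> B \<in> N" if "A \<in> N" "B \<in> N" for A B
    proof -
      have AB: "A \<in> carrier_mat n1 n2" "B \<in> carrier_mat n1 n2" using that by (auto simp: N_def)
      have "?P (($$) (A + B)) = ?P (\<lambda>c. A $$ c + B $$ c)"
        using AB by (intro app_cong) auto
      then show ?thesis using that AB by (auto simp: N_def module_mat_simps app_add)
    qed
    have "?P (($$) (0\<^sub>m n1 n2)) = ?P (\<lambda>c. 0)" by (intro app_cong) auto
    then show "\<zero>\<^bsub>?M\<^esub> \<in> N" by (auto simp: N_def module_mat_simps) (simp add: app_def)
    show "t \<odot>\<^bsub>?M\<^esub> A \<in> N" if "A \<in> N" for t A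
    proof -
      have A: "A \<in> carrier_mat n1 n2" using that by (auto simp: N_def)
      have "?P (($$) (t \<cdot>\<^sub>m A)) = ?P (\<lambda>c. t * A $$ c)"
        using A by (intro app_cong) auto
      then show ?thesis using that A by (auto simp: N_def module_mat_simps app_scale)
    qed
  qed
  ultimately have "tangent U V \<subseteq> N" unfolding T by (rule vs.span_is_subset)
  moreover have "N \<subseteq> tangent U V"
  proof
    fix Z assume Z: "Z \<in> N"
    define y where "y k j = (\<Sum>a<n1. U $$ (a, k) * Z $$ (a, j))" for k j
    define x where "x k i = (\<Sum>b<n2. V $$ (b, k) * (\<Sum>a<n1. comp_proj U i a * Z $$ (a, b)))" for k i
    \<comment> \<open>Induction over partial sums, because closure of the span under addition is
      available for two summands only.\<close>
    have left: "Matrix.mat n1 n2 (\<lambda>(i, j). \<Sum>k<m. U $$ (i, k) * y k j) \<in> tangent U V" if "m \<le> r" for m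
      using that
    proof (induction m)
      case 0
      have "Matrix.mat n1 n2 (\<lambda>(i, j). \<Sum>k<0. U $$ (i, k) * y k j) = 0\<^sub>m n1 n2"
        by (intro eq_matI) auto
      then show ?case by (simp only: zeroT)
    next
      case (Suc m)
      have "Matrix.mat n1 n2 (\<lambda>(i, j). \<Sum>k<Suc m. U $$ (i, k) * y k j) =
         Matrix.mat n1 n2 (\<lambda>(i, j). \<Sum>k<m. U $$ (i, k) * y k j) + outer (col U m) (Matrix.vec n2 (y m))"
        using Suc.prems by (intro eq_matI) (auto simp: outer_def dU)
      moreover have "outer (col U m) (Matrix.vec n2 (y m)) \<in> tangent U V"
      proof -
        have "outer (col U m) (Matrix.vec n2 (y m)) \<in> S"
          unfolding S_def using Suc.prems
          by (intro UnI1 CollectI exI[of _ m] exI[of _ "Matrix.vec n2 (y m)"]) (auto simp: dU dV)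
        then show ?thesis using gen T by blast
      qed
      ultimately show ?case using Suc addT by simp
    qed
    have right: "Matrix.mat n1 n2 (\<lambda>(i, j). \<Sum>k<m. x k i * V $$ (j, k)) \<in> tangent U V" if "m \<le> r" for m
      using that
    proof (induction m)
      case 0
      have "Matrix.mat n1 n2 (\<lambda>(i, j). \<Sum>k<0. x k i * V $$ (j, k)) = 0\<^sub>m n1 n2"
        by (intro eq_matI) auto
      then show ?case by (simp only: zeroT)
    next
      case (Suc m)
      have "Matrix.mat n1 n2 (\<lambda>(i, j). \<Sum>k<Suc m. x k i * V $$ (j, k)) =
         Matrix.mat n1 n2 (\<lambda>(i, j). \<Sum>k<m. x k i * V $$ (j, k)) + outer (Matrix.vec n1 (x m)) (col V m)"
        using Suc.prems by (intro eq_matI) (auto simp: outer_def dV)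
      moreover have "outer (Matrix.vec n1 (x m)) (col V m) \<in> tangent U V"
      proof -
        have "outer (Matrix.vec n1 (x m)) (col V m) \<in> S"
          unfolding S_def using Suc.prems
          by (intro UnI2 CollectI exI[of _ m] exI[of _ "Matrix.vec n1 (x m)"]) (auto simp: dU dV)
        then show ?thesis using gen T by blast
      qed
      ultimately show ?case using Suc addT by simp
    qed
    have "Z = Matrix.mat n1 n2 (\<lambda>(i, j). \<Sum>k<r. U $$ (i, k) * y k j) +
        Matrix.mat n1 n2 (\<lambda>(i, j). \<Sum>k<r. x k i * V $$ (j, k))"
    proof (intro eq_matI)
      fix i j
      assume "i < dim_row (Matrix.mat n1 n2 (\<lambda>(i, j). \<Sum>k<r. U $$ (i, k) * y k j) +
          Matrix.mat n1 n2 (\<lambda>(i, j). \<Sum>k<r. x k i * V $$ (j, k)))"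
        and "j < dim_col (Matrix.mat n1 n2 (\<lambda>(i, j). \<Sum>k<r. U $$ (i, k) * y k j) +
          Matrix.mat n1 n2 (\<lambda>(i, j). \<Sum>k<r. x k i * V $$ (j, k)))"
      then have ij: "i < n1" "j < n2" by auto
      have "Z $$ (i, j) = ?P (($$) Z) (i, j)" using Z ij by (auto simp: N_def)
      then show "Z $$ (i, j) = (Matrix.mat n1 n2 (\<lambda>(i, j). \<Sum>k<r. U $$ (i, k) * y k j) +
          Matrix.mat n1 n2 (\<lambda>(i, j). \<Sum>k<r. x k i * V $$ (j, k))) $$ (i, j)"
        using ij by (simp add: app_tan_kernel_expand dU dV y_def x_def)
    qed (use Z in \<open>auto simp: N_def\<close>)
    then show "Z \<in> tangent U V" using addT[OF left right] by simp
  qed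
  ultimately show ?thesis by (auto simp: N_def)
qed

text \<open>Discharges the definite description in \<open>orth_proj\<close>: the kernel projection
  meets the characterization, and two candidates differ by a tangent matrix orthogonal to
  itself.\<close>

lemma proj_T_eq:
  assumes U: "orthocols n1 r U" and V: "orthocols n2 r V" and Z: "Z \<in> carrier_mat n1 n2"
    and G: "proj_kernel (cells n1 n2) (tan_kernel U V) tau"
  shows "proj_T U V Z = Matrix.mat n1 n2 (app (cells n1 n2) (tan_kernel U V) (($$) Z))"
proof -
  let ?E = "cells n1 n2"
  let ?P = "app ?E (tan_kernel U V)"
  define W where "W = Matrix.mat n1 n2 (?P (($$) Z))"
  have Wc: "W \<in> carrier_mat n1 n2" by (simp add: W_def)
  have We: "W $$ c = ?P (($$) Z) c" if "c \<in> ?E" for c using that by (auto simp: W_def)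
  have "?P (($$) W) = ?P (?P (($$) Z))" by (intro app_cong We)
  then have WT: "W \<in> tangent U V"
    unfolding tangent_iff[OF U V] using Wc We proj_kernel_app_idem[OF G] by simp
  have inner: "mat_inner (Z - A) Y = ip ?E (($$) Z) (($$) Y) - ip ?E (($$) A) (($$) Y)"
    if "A \<in> carrier_mat n1 n2" for A Y
  proof -
    have "mat_inner (Z - A) Y = ip ?E (($$) (Z - A)) (($$) Y)" using that Z by (intro mat_inner_ip) auto
    also have "\<dots> = ip ?E (\<lambda>c. Z $$ c - A $$ c) (($$) Y)" using that Z by (intro ip_cong) auto
    finally show ?thesis by (simp add: ip_linear)
  qed
  have WP: "ip ?E (($$) Z) (($$) Y) = ip ?E (($$) W) (($$) Y)" if Y: "Y \<in> tangent U V" for Y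
  proof -
    have "ip ?E (($$) Z) (($$) Y) = ip ?E (($$) Z) (?P (($$) Y))"
      using Y unfolding tangent_iff[OF U V] by (intro ip_cong) auto
    also have "\<dots> = ip ?E (?P (($$) Z)) (($$) Y)"
      using G by (intro ip_app_commute) (auto simp: proj_kernel_def)
    also have "\<dots> = ip ?E (($$) W) (($$) Y)" by (intro ip_cong) (auto simp: We)
    finally show ?thesis .
  qed
  have "orth_proj (tangent U V) Z = W"
    unfolding orth_proj_def
  proof (rule the_equality)
    show "W \<in> tangent U V \<and> (\<forall>Y\<in>tangent U V. mat_inner (Z - W) Y = 0)"
      using WT WP by (simp add: inner[OF Wc])
  next
    fix A assume A: "A \<in> tangent U V \<and> (\<forall>Y\<in>tangent U V. mat_inner (Z - A) Y = 0)"
    then have Ac: "A \<in> carrier_mat n1 n2" by (simp add: tangent_iff[OF U V])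
    have eq: "ip ?E (($$) A) (($$) Y) = ip ?E (($$) W) (($$) Y)" if "Y \<in> tangent U V" for Y
      using A that WP[OF that] by (simp add: inner[OF Ac])
    have "ip ?E (\<lambda>c. A $$ c - W $$ c) (\<lambda>c. A $$ c - W $$ c) = 0"
      using eq[of A] eq[of W] A WT ip_commute[of ?E "($$) A" "($$) W"] by (simp add: ip_linear)
    then have "A $$ c = W $$ c" if "c \<in> ?E" for c
      using ip_self_zero[of ?E "\<lambda>c. A $$ c - W $$ c" c] that by simp
    then show "A = W" using Ac Wc by (intro eq_matI) auto
  qed
  then show ?thesis by (simp add: W_def)
qed

section \<open>Singular vectors and attainment of the duality\<close>

lemma bessel_inequality:
  assumes "finite S" and on: "\<And>a b. a \<in> S \<Longrightarrow> b \<in> S \<Longrightarrow> ip J (h a) (h b) = of_bool (a = b)"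
  shows "(\<Sum>a\<in>S. (ip J (h a) x)\<^sup>2) \<le> ip J x x"
proof -
  define p where "p i = (\<Sum>a\<in>S. ip J (h a) x * h a i)" for i
  have px: "ip J p x = (\<Sum>a\<in>S. (ip J (h a) x)\<^sup>2)"
    unfolding p_def[abs_def] by (simp add: ip_linear power2_eq_square)
  have "ip J p p = (\<Sum>a\<in>S. ip J (h a) x * (\<Sum>b\<in>S. ip J (h b) x * ip J (h b) (h a)))"
    unfolding p_def[abs_def] by (simp add: ip_linear)
  also have "\<dots> = (\<Sum>a\<in>S. ip J (h a) x * (\<Sum>b\<in>S. if b = a then ip J (h b) x else 0))"
    by (intro sum.cong refl arg_cong2[of _ _ _ _ "(*)"]) (auto simp: on)
  also have "\<dots> = (\<Sum>a\<in>S. (ip J (h a) x)\<^sup>2)" using assms(1) by (simp add: power2_eq_square)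
  finally have pp: "ip J p p = (\<Sum>a\<in>S. (ip J (h a) x)\<^sup>2)" .
  have "0 \<le> ip J (\<lambda>i. x i - p i) (\<lambda>i. x i - p i)" by (rule ip_self_nonneg)
  also have "\<dots> = ip J x x - (\<Sum>a\<in>S. (ip J (h a) x)\<^sup>2)"
    using px pp ip_commute[of J x p] by (simp add: ip_linear)
  finally show ?thesis by simp
qed

lemma proots_linear_factors: "proots (\<Prod>a\<leftarrow>as. [:- a, 1:]) = mset (as :: real list)"
proof (induction as)
  case (Cons a as)
  have "(\<Prod>a\<leftarrow>as. [:- a, 1:]) \<noteq> 0" unfolding prod_list_zero_iff by auto
  then have "proots ([:- a, 1:] * (\<Prod>a\<leftarrow>as. [:- a, 1:])) = proots [:- a, 1:] + proots (\<Prod>a\<leftarrow>as. [:- a, 1:])"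
    by (intro proots_mult) auto
  then show ?case using Cons by simp
qed simp

lemma index_mult_mat_sum:
  "A \<in> carrier_mat n m \<Longrightarrow> B \<in> carrier_mat m k \<Longrightarrow> i < n \<Longrightarrow> j < k \<Longrightarrow>
    (A * B) $$ (i, j) = (\<Sum>a<m. A $$ (i, a) * B $$ (a, j))"
  by (simp add: scalar_prod_def atLeast0LessThan)

text \<open>Links the definition through roots of a characteristic polynomial to an eigenbasis: the
  Gram matrix is orthogonally similar to a diagonal matrix, whose characteristic polynomial splits
  visibly, with multiplicities.\<close>

lemma trace_norm_eigenbasis:
  assumes A: "A \<in> carrier_mat n1 n2"
    and eb: "eigenbasis {..<n2} (\<lambda>j l. \<Sum>i<n1. A $$ (i, j) * A $$ (i, l)) lam v"
  shows "trace_norm A = (\<Sum>a<n2. sqrt (lam a))"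
proof -
  define K where "K j l = (\<Sum>i<n1. A $$ (i, j) * A $$ (i, l))" for j l
  define Q where "Q = Matrix.mat n2 n2 (\<lambda>(j, a). v a j)"
  define D where "D = Matrix.mat n2 n2 (\<lambda>(a, b). if a = b then lam a else 0)"
  have eb': "eigenbasis {..<n2} K lam v" using eb by (simp add: K_def[abs_def])
  have on: "orthonormal {..<n2} (card {..<n2}) v" using eb by (simp add: eigenbasis_def)
  have Qc: "Q \<in> carrier_mat n2 n2" and Dc: "D \<in> carrier_mat n2 n2" by (simp_all add: Q_def D_def)
  have QtQ: "transpose_mat Q * Q = 1\<^sub>m n2"
    using on by (intro eq_matI)
      (auto simp: Q_def scalar_prod_def atLeast0LessThan orthonormal_def ip_def)
  have QQt: "Q * transpose_mat Q = 1\<^sub>m n2"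
    using orthonormal_complete[OF _ on]
    by (intro eq_matI) (auto simp: Q_def scalar_prod_def atLeast0LessThan)
  have QD: "(Q * D) $$ (j, b) = v b j * lam b" if "j < n2" "b < n2" for j b
    using that by (simp add: Q_def D_def scalar_prod_def atLeast0LessThan if_distrib[of "\<lambda>t. _ * t"] cong: if_cong)
  have AA: "transpose_mat A * A = Q * D * transpose_mat Q"
  proof (intro eq_matI)
    fix j l assume "j < dim_row (Q * D * transpose_mat Q)" "l < dim_col (Q * D * transpose_mat Q)"
    then have jl: "j < n2" "l < n2" by (simp_all add: Q_def)
    have "(transpose_mat A * A) $$ (j, l) = K j l"
      using A jl by (simp add: K_def scalar_prod_def atLeast0LessThan)
    also have "\<dots> = (\<Sum>m<n2. K j m * (\<Sum>a<n2. v a m * v a l))"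
      using orthonormal_complete[OF _ on, of _ l] jl
      by (simp add: if_distrib[of "\<lambda>t. _ * t"] cong: if_cong)
    also have "\<dots> = (\<Sum>a<n2. (\<Sum>m<n2. K j m * v a m) * v a l)"
      unfolding sum_distrib_left sum_distrib_right by (subst sum.swap) (simp add: mult.assoc)
    also have "\<dots> = (\<Sum>a<n2. v a j * lam a * v a l)"
      using eb' jl by (intro sum.cong refl) (simp add: eigenbasis_def app_def)
    also have "\<dots> = (\<Sum>a<n2. (Q * D) $$ (j, a) * transpose_mat Q $$ (a, l))"
      using jl by (intro sum.cong refl) (simp add: QD, simp add: Q_def)
    also have "\<dots> = (Q * D * transpose_mat Q) $$ (j, l)"
      using jl Qc Dc by (subst index_mult_mat_sum[of _ n2 n2 _ n2]) auto
    finally show "(transpose_mat A * A) $$ (j, l) = (Q * D * transpose_mat Q) $$ (j, l)" .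
  qed (use A in \<open>auto simp: Q_def\<close>)
  have "similar_mat_wit (transpose_mat A * A) D Q (transpose_mat Q)"
    using A Qc Dc by (intro similar_mat_witI[OF QQt QtQ AA]) auto
  then have "similar_mat (transpose_mat A * A) D" unfolding similar_mat_def by blast
  then have "char_poly (transpose_mat A * A) = char_poly D" by (rule char_poly_similar)
  also have "\<dots> = (\<Prod>a\<leftarrow>diag_mat D. [:- a, 1:])"
    by (rule char_poly_upper_triangular[OF Dc]) (auto simp: upper_triangular_def D_def)
  also have "diag_mat D = map lam [0..<n2]"
    by (auto simp: diag_mat_def D_def intro!: nth_equalityI)
  finally have "trace_norm A = (\<Sum>x\<in>#mset (map lam [0..<n2]). sqrt x)"
    unfolding trace_norm_def by (simp only: proots_linear_factors)
  also have "\<dots> = sum_list (map (\<lambda>a. sqrt (lam a)) [0..<n2])"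
    unfolding mset_map[symmetric] sum_mset_sum_list by (simp add: comp_def)
  also have "\<dots> = (\<Sum>a<n2. sqrt (lam a))"
    by (simp add: interv_sum_list_conv_sum_set_nat atLeast0LessThan)
  finally show ?thesis .
qed

text \<open>A singular value decomposition with the left vectors \<open>g a = A v_a\<close>
  unnormalized, so that vanishing singular values need no separate treatment;
  \<open>sqrt (lam a)\<close> is the norm of \<open>g a\<close>.\<close>

lemma trace_norm_decomposition:
  assumes A: "A \<in> carrier_mat n1 n2"
  obtains lam v g where "orthonormal {..<n2} n2 v" "\<And>a. a < n2 \<Longrightarrow> 0 \<le> lam a"
    "\<And>a b. a < n2 \<Longrightarrow> b < n2 \<Longrightarrow> ip {..<n1} (g a) (g b) = lam a * of_bool (a = b)"
    "\<And>a i. g a i = (\<Sum>j<n2. A $$ (i, j) * v a j)"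
    "\<And>a j. a < n2 \<Longrightarrow> j < n2 \<Longrightarrow> lam a * v a j = (\<Sum>i<n1. A $$ (i, j) * g a i)"
    "\<And>i j. i < n1 \<Longrightarrow> j < n2 \<Longrightarrow> A $$ (i, j) = (\<Sum>a<n2. g a i * v a j)"
    "trace_norm A = (\<Sum>a<n2. sqrt (lam a))"
proof -
  define K where "K j l = (\<Sum>i<n1. A $$ (i, j) * A $$ (i, l))" for j l
  obtain lam v where eb: "eigenbasis {..<n2} K lam v"
    using spectral_theorem[of "{..<n2}" K] by (auto simp: K_def mult.commute)
  have on: "orthonormal {..<n2} (card {..<n2}) v" using eb by (simp add: eigenbasis_def)
  define g where "g a i = (\<Sum>j<n2. A $$ (i, j) * v a j)" for a i
  have lam_v: "lam a * v a j = (\<Sum>i<n1. A $$ (i, j) * g a i)" if "a < n2" "j < n2" for a j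
  proof -
    have "lam a * v a j = (\<Sum>l<n2. K j l * v a l)" using eb that by (simp add: eigenbasis_def app_def)
    also have "\<dots> = (\<Sum>i<n1. A $$ (i, j) * g a i)"
      unfolding K_def g_def sum_distrib_left sum_distrib_right
      by (subst sum.swap) (simp add: mult.assoc)
    finally show ?thesis .
  qed
  have gg: "ip {..<n1} (g a) (g b) = lam a * of_bool (a = b)" if ab: "a < n2" "b < n2" for a b
  proof -
    have "ip {..<n1} (g a) (g b) = (\<Sum>j<n2. (\<Sum>i<n1. A $$ (i, j) * g a i) * v b j)"
      unfolding ip_def g_def[of b] sum_distrib_left sum_distrib_right
      by (subst sum.swap) (simp add: algebra_simps)
    also have "\<dots> = (\<Sum>j<n2. (lam a * v a j) * v b j)"
      using ab by (intro sum.cong refl) (simp add: lam_v)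
    also have "\<dots> = lam a * ip {..<n2} (v a) (v b)" by (simp add: ip_def sum_distrib_left mult.assoc)
    finally show ?thesis using on ab by (simp add: orthonormal_def)
  qed
  have lam0: "0 \<le> lam a" if "a < n2" for a
    using gg[OF that that] ip_self_nonneg[of "{..<n1}" "g a"] by simp
  have Ae: "A $$ (i, j) = (\<Sum>a<n2. g a i * v a j)" if "i < n1" "j < n2" for i j
  proof -
    have "(\<Sum>a<n2. g a i * v a j) = (\<Sum>l<n2. A $$ (i, l) * (\<Sum>a<n2. v a l * v a j))"
      unfolding g_def sum_distrib_left sum_distrib_right by (subst sum.swap) (simp add: mult.assoc)
    also have "\<dots> = A $$ (i, j)"
      using orthonormal_complete[OF _ on, of _ j] that
      by (simp add: if_distrib[of "\<lambda>t. _ * t"] cong: if_cong)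
    finally show ?thesis by simp
  qed
  have tr: "trace_norm A = (\<Sum>a<n2. sqrt (lam a))"
    using eb by (intro trace_norm_eigenbasis[OF A]) (simp add: K_def[abs_def])
  have on': "orthonormal {..<n2} n2 v" using on by simp
  show ?thesis by (rule that[OF on' lam0 gg g_def lam_v Ae tr])
qed

lemma trace_norm_dual_bound:
  assumes A: "A \<in> carrier_mat n1 n2" and B: "bil_bound n1 n2 B s"
  shows "\<bar>ip (cells n1 n2) B (($$) A)\<bar> \<le> s * trace_norm A"
proof -
  obtain lam v g where d: "orthonormal {..<n2} n2 v" "\<And>a. a < n2 \<Longrightarrow> 0 \<le> lam a"
    "\<And>a b. a < n2 \<Longrightarrow> b < n2 \<Longrightarrow> ip {..<n1} (g a) (g b) = lam a * of_bool (a = b)"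
    "\<And>i j. i < n1 \<Longrightarrow> j < n2 \<Longrightarrow> A $$ (i, j) = (\<Sum>a<n2. g a i * v a j)"
    "trace_norm A = (\<Sum>a<n2. sqrt (lam a))"
    by (rule trace_norm_decomposition[OF A]) (rule that)
  have "ip (cells n1 n2) B (($$) A) = (\<Sum>c\<in>cells n1 n2. \<Sum>a<n2. B c * g a (fst c) * v a (snd c))"
    unfolding ip_def by (intro sum.cong refl) (auto simp: d(4) sum_distrib_left mult.assoc)
  also have "\<dots> = (\<Sum>a<n2. \<Sum>c\<in>cells n1 n2. B c * g a (fst c) * v a (snd c))" by (rule sum.swap)
  finally have "\<bar>ip (cells n1 n2) B (($$) A)\<bar> \<le>
      (\<Sum>a<n2. \<bar>\<Sum>c\<in>cells n1 n2. B c * g a (fst c) * v a (snd c)\<bar>)"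
    by (simp only: sum_abs)
  also have "\<dots> \<le> (\<Sum>a<n2. s * nrm {..<n1} (g a) * nrm {..<n2} (v a))"
    using B by (intro sum_mono) (simp add: bil_bound_def)
  also have "\<dots> = (\<Sum>a<n2. s * sqrt (lam a))"
    using d(1) by (intro sum.cong refl) (simp add: nrm_def d(3) orthonormal_def)
  finally show ?thesis by (simp add: d(5) sum_distrib_left)
qed

text \<open>Duality tested with the matrix itself, whose spectral norm is at most its Frobenius
  norm.\<close>

lemma nrm_le_trace_norm:
  assumes A: "A \<in> carrier_mat n1 n2"
  shows "nrm (cells n1 n2) (($$) A) \<le> trace_norm A"
proof -
  let ?m = "nrm (cells n1 n2) (($$) A)"
  have tr: "0 \<le> trace_norm A"
    using trace_norm_dual_bound[OF A, of "\<lambda>_. 0" 1] by (simp add: bil_bound_def nrm_nonneg ip_def)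
  have "?m * ?m \<le> ?m * trace_norm A"
    using trace_norm_dual_bound[OF A bil_bound_nrm[of n1 n2 "($$) A"]]
    by (simp add: nrm_square[symmetric] power2_eq_square)
  then show ?thesis using nrm_nonneg[of "cells n1 n2" "($$) A"] tr
    by (cases "?m = 0") auto
qed

text \<open>\<open>W\<close> is the polar factor of \<open>A\<close>. The last two conclusions say
  that left and right null vectors of \<open>A\<close> are null vectors of \<open>W\<close>; so if
  \<open>A\<close> is orthogonal to the tangent space, \<open>W\<close> is too.\<close>

lemma trace_norm_dual_attained:
  assumes A: "A \<in> carrier_mat n1 n2"
  obtains W where "bil_bound n1 n2 W 1" "ip (cells n1 n2) W (($$) A) = trace_norm A"
    "\<And>x j. (\<And>j. j < n2 \<Longrightarrow> (\<Sum>i<n1. x i * A $$ (i, j)) = 0) \<Longrightarrow> j < n2 \<Longrightarrow> (\<Sum>i<n1. x i * W (i, j)) = 0"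
    "\<And>y i. (\<And>i. i < n1 \<Longrightarrow> (\<Sum>j<n2. A $$ (i, j) * y j) = 0) \<Longrightarrow> i < n1 \<Longrightarrow> (\<Sum>j<n2. W (i, j) * y j) = 0"
proof -
  obtain lam v g where d: "orthonormal {..<n2} n2 v" "\<And>a. a < n2 \<Longrightarrow> 0 \<le> lam a"
    "\<And>a b. a < n2 \<Longrightarrow> b < n2 \<Longrightarrow> ip {..<n1} (g a) (g b) = lam a * of_bool (a = b)"
    "\<And>a i. g a i = (\<Sum>j<n2. A $$ (i, j) * v a j)"
    "\<And>a j. a < n2 \<Longrightarrow> j < n2 \<Longrightarrow> lam a * v a j = (\<Sum>i<n1. A $$ (i, j) * g a i)"
    "\<And>i j. i < n1 \<Longrightarrow> j < n2 \<Longrightarrow> A $$ (i, j) = (\<Sum>a<n2. g a i * v a j)"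
    "trace_norm A = (\<Sum>a<n2. sqrt (lam a))"
    by (rule trace_norm_decomposition[OF A]) (rule that)
  \<comment> \<open>Only nonzero singular values: there \<open>g a\<close> can be normalized, and
    \<open>W\<close> stays within the row and column space of \<open>A\<close>.\<close>
  define S where "S = {a. a < n2 \<and> lam a \<noteq> 0}"
  have finS: "finite S" by (simp add: S_def)
  define h where "h a i = (1 / sqrt (lam a)) * g a i" for a i
  define W where "W c = (\<Sum>a\<in>S. h a (fst c) * v a (snd c))" for c
  have Sn: "a < n2" "lam a > 0" if "a \<in> S" for a
    using that d(2)[of a] by (auto simp: S_def)
  have hh: "ip {..<n1} (h a) (h b) = of_bool (a = b)" if "a \<in> S" "b \<in> S" for a b
    unfolding h_def[abs_def] ip_linear using that Sn[of a] Sn[of b] d(3)[of a b] by simp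
  have "bil_bound n1 n2 W 1" unfolding bil_bound_def
  proof (intro allI)
    fix x y
    have "(\<Sum>c\<in>cells n1 n2. W c * x (fst c) * y (snd c)) =
        (\<Sum>c\<in>cells n1 n2. \<Sum>a\<in>S. (h a (fst c) * x (fst c)) * (v a (snd c) * y (snd c)))"
      unfolding W_def sum_distrib_right by (intro sum.cong refl) (simp add: algebra_simps)
    also have "\<dots> = (\<Sum>a\<in>S. \<Sum>c\<in>cells n1 n2. (h a (fst c) * x (fst c)) * (v a (snd c) * y (snd c)))"
      by (rule sum.swap)
    also have "\<dots> = (\<Sum>a\<in>S. ip {..<n1} (h a) x * ip {..<n2} (v a) y)"
      by (simp add: sum_cells ip_def sum_product)
    finally have "\<bar>\<Sum>c\<in>cells n1 n2. W c * x (fst c) * y (snd c)\<bar> \<le>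
        (\<Sum>a\<in>S. \<bar>ip {..<n1} (h a) x\<bar> * \<bar>ip {..<n2} (v a) y\<bar>)"
      by (simp add: sum_abs flip: abs_mult)
    also have "\<dots> \<le> L2_set (\<lambda>a. ip {..<n1} (h a) x) S * L2_set (\<lambda>a. ip {..<n2} (v a) y) S"
      by (rule L2_set_mult_ineq)
    also have "\<dots> \<le> nrm {..<n1} x * nrm {..<n2} y"
    proof (intro mult_mono)
      show "L2_set (\<lambda>a. ip {..<n1} (h a) x) S \<le> nrm {..<n1} x"
        unfolding L2_set_def nrm_def by (intro real_sqrt_le_mono bessel_inequality finS hh)
      show "L2_set (\<lambda>a. ip {..<n2} (v a) y) S \<le> nrm {..<n2} y"
        unfolding L2_set_def nrm_def using d(1) Sn
        by (intro real_sqrt_le_mono bessel_inequality finS) (auto simp: orthonormal_def)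
    qed (auto simp: nrm_nonneg)
    finally show "\<bar>\<Sum>c\<in>cells n1 n2. W c * x (fst c) * y (snd c)\<bar> \<le> 1 * nrm {..<n1} x * nrm {..<n2} y"
      by simp
  qed
  moreover have "ip (cells n1 n2) W (($$) A) = trace_norm A"
  proof -
    have "ip (cells n1 n2) W (($$) A) = (\<Sum>c\<in>cells n1 n2. \<Sum>a\<in>S. h a (fst c) * (A $$ c * v a (snd c)))"
      unfolding ip_def W_def sum_distrib_right by (intro sum.cong refl) (simp add: algebra_simps)
    also have "\<dots> = (\<Sum>a\<in>S. \<Sum>c\<in>cells n1 n2. h a (fst c) * (A $$ c * v a (snd c)))" by (rule sum.swap)
    also have "\<dots> = (\<Sum>a\<in>S. ip {..<n1} (h a) (g a))"
      by (simp add: sum_cells ip_def d(4) sum_distrib_left)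
    also have "\<dots> = (\<Sum>a\<in>S. sqrt (lam a))"
      unfolding h_def[abs_def] ip_linear using Sn by (intro sum.cong refl) (simp add: d(3) real_div_sqrt less_imp_le)
    also have "\<dots> = (\<Sum>a<n2. sqrt (lam a))"
      by (intro sum.mono_neutral_left) (auto simp: S_def)
    finally show ?thesis by (simp add: d(7))
  qed
  moreover have "(\<Sum>i<n1. x i * W (i, j)) = 0"
    if x: "\<And>j. j < n2 \<Longrightarrow> (\<Sum>i<n1. x i * A $$ (i, j)) = 0" and "j < n2" for x j
  proof -
    have "ip {..<n1} x (g a) = 0" for a
    proof -
      have "ip {..<n1} x (g a) = (\<Sum>j<n2. (\<Sum>i<n1. x i * A $$ (i, j)) * v a j)"
        unfolding ip_def d(4) sum_distrib_left sum_distrib_right by (subst sum.swap) (simp add: mult.assoc)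
      then show ?thesis using x by simp
    qed
    then have xh: "ip {..<n1} x (h a) = 0" for a unfolding h_def[abs_def] ip_linear by simp
    have "(\<Sum>i<n1. x i * W (i, j)) = (\<Sum>a\<in>S. ip {..<n1} x (h a) * v a j)"
      unfolding W_def ip_def sum_distrib_left sum_distrib_right by (subst sum.swap) (simp add: mult.assoc)
    then show ?thesis by (simp add: xh)
  qed
  moreover have "(\<Sum>j<n2. W (i, j) * y j) = 0"
    if y: "\<And>i. i < n1 \<Longrightarrow> (\<Sum>j<n2. A $$ (i, j) * y j) = 0" and "i < n1" for y i
  proof -
    have vy: "ip {..<n2} (v a) y = 0" if a: "a \<in> S" for a
    proof -
      have "lam a * ip {..<n2} (v a) y = (\<Sum>j<n2. (\<Sum>i<n1. A $$ (i, j) * g a i) * y j)"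
        using Sn[OF a] by (simp add: ip_def sum_distrib_left d(5) flip: mult.assoc)
      also have "\<dots> = (\<Sum>i<n1. g a i * (\<Sum>j<n2. A $$ (i, j) * y j))"
        unfolding sum_distrib_left sum_distrib_right by (subst sum.swap) (simp add: algebra_simps)
      also have "\<dots> = 0" using y by simp
      finally show ?thesis using Sn[OF a] by simp
    qed
    have "(\<Sum>j<n2. W (i, j) * y j) = (\<Sum>a\<in>S. h a i * ip {..<n2} (v a) y)"
      unfolding W_def ip_def sum_distrib_left sum_distrib_right by (subst sum.swap) (simp add: mult.assoc)
    then show ?thesis by (simp add: vy)
  qed
  ultimately show ?thesis by (rule that)
qed

section \<open>Optimality from an approximate dual certificate\<close>

lemma ip_tensor:
  "ip (cells n1 n2) (\<lambda>c. x (fst c) * y (snd c)) (\<lambda>c. x' (fst c) * y' (snd c)) =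
    ip {..<n1} x x' * ip {..<n2} y y'"
  by (simp add: ip_def sum_cells sum_product algebra_simps)

lemma ip_tensor_right:
  "ip (cells n1 n2) z (\<lambda>c. x (fst c) * y (snd c)) = (\<Sum>c\<in>cells n1 n2. z c * x (fst c) * y (snd c))"
  by (simp add: ip_def mult.assoc)

lemma nrm_col:
  "orthocols n r U \<Longrightarrow> k < r \<Longrightarrow> nrm {..<n} (\<lambda>i. U $$ (i, k)) = 1"
  by (simp add: nrm_def ip_def orthocols_def)

lemma comp_proj_pythagoras:
  assumes U: "orthocols n r U"
  shows "(nrm {..<n} (app {..<n} (comp_proj U) x))\<^sup>2 + (\<Sum>k<r. (\<Sum>i<n. U $$ (i, k) * x i)\<^sup>2) = (nrm {..<n} x)\<^sup>2"
proof -
  let ?Q = "app {..<n} (comp_proj U)"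
  have dim: "dim_col U = r" using U by (auto simp: orthocols_def)
  have "proj_kernel {..<n} (comp_proj U) (Max (insert 0 ((\<lambda>i. comp_proj U i i) ` {..<n})))"
    using comp_proj_idem[OF U] by (auto simp: proj_kernel_def comp_proj_sym intro!: Max_ge)
  from proj_kernel_app_self[OF this, of x x]
  have "(nrm {..<n} (?Q x))\<^sup>2 = ip {..<n} x (?Q x)" by (simp add: nrm_square)
  also have "\<dots> = ip {..<n} x (\<lambda>i. x i - (\<Sum>k<r. (\<Sum>a<n. U $$ (a, k) * x a) * U $$ (i, k)))"
    by (intro ip_cong) (simp_all add: app_def comp_proj_apply dim mult.commute[of _ "U $$ _"])
  also have "\<dots> = ip {..<n} x x - (\<Sum>k<r. (\<Sum>a<n. U $$ (a, k) * x a) * ip {..<n} x (\<lambda>i. U $$ (i, k)))"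
    by (simp only: ip_linear)
  also have "(\<Sum>k<r. (\<Sum>a<n. U $$ (a, k) * x a) * ip {..<n} x (\<lambda>i. U $$ (i, k))) =
      (\<Sum>k<r. (\<Sum>i<n. U $$ (i, k) * x i)\<^sup>2)"
    by (intro sum.cong refl) (simp add: ip_def power2_eq_square mult.commute)
  finally show ?thesis by (simp add: nrm_square)
qed

lemma two_term_Cauchy_Schwarz:
  fixes a b c d :: real
  assumes "a\<^sup>2 + c\<^sup>2 = p\<^sup>2" "b\<^sup>2 + d\<^sup>2 = q\<^sup>2" "0 \<le> p" "0 \<le> q"
  shows "a * b + c * d \<le> p * q"
proof (rule power2_le_imp_le)
  have "(p * q)\<^sup>2 = (a\<^sup>2 + c\<^sup>2) * (b\<^sup>2 + d\<^sup>2)" by (simp add: assms power_mult_distrib)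
  also have "\<dots> = (a * b + c * d)\<^sup>2 + (a * d - c * b)\<^sup>2"
    by (simp add: power2_eq_square algebra_simps)
  finally show "(a * b + c * d)\<^sup>2 \<le> (p * q)\<^sup>2" by simp
qed (use assms in auto)

text \<open>\<open>U V^T\<close> sees only the components of \<open>x\<close> and \<open>y\<close>
  in the column spans, and \<open>W\<close> only the complementary ones. By Pythagoras the two
  contributions combine through Cauchy-Schwarz in the plane, so the norms do not add.\<close>

lemma bil_bound_subgradient:
  assumes U: "orthocols n1 r U" and V: "orthocols n2 r V" and W: "bil_bound n1 n2 W 1"
    and left: "\<And>k j. k < r \<Longrightarrow> j < n2 \<Longrightarrow> (\<Sum>i<n1. U $$ (i, k) * W (i, j)) = 0"
    and right: "\<And>k i. k < r \<Longrightarrow> i < n1 \<Longrightarrow> (\<Sum>j<n2. W (i, j) * V $$ (j, k)) = 0"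
  shows "bil_bound n1 n2 (\<lambda>c. (\<Sum>k<r. U $$ (fst c, k) * V $$ (snd c, k)) + W c) 1"
  unfolding bil_bound_def
proof (intro allI)
  fix x y
  let ?S = "\<lambda>z x y. \<Sum>c\<in>cells n1 n2. z c * x (fst c) * y (snd c)"
  have dim: "dim_col U = r" "dim_col V = r" using U V by (auto simp: orthocols_def)
  define ux where "ux k = (\<Sum>i<n1. U $$ (i, k) * x i)" for k
  define vy where "vy k = (\<Sum>j<n2. V $$ (j, k) * y j)" for k
  define x' where "x' = app {..<n1} (comp_proj U) x"
  define y' where "y' = app {..<n2} (comp_proj V) y"
  have x'i: "x' i = x i - (\<Sum>k<r. U $$ (i, k) * ux k)" if "i < n1" for i
    using that by (simp add: x'_def app_def comp_proj_apply dim ux_def)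
  have y'j: "y' j = y j - (\<Sum>k<r. V $$ (j, k) * vy k)" if "j < n2" for j
    using that by (simp add: y'_def app_def comp_proj_apply dim vy_def)
  have Wx: "(\<Sum>i<n1. W (i, j) * x' i) = (\<Sum>i<n1. W (i, j) * x i)" if j: "j < n2" for j
  proof -
    have "(\<Sum>i<n1. W (i, j) * x' i) =
        (\<Sum>i<n1. W (i, j) * x i) - (\<Sum>i<n1. \<Sum>k<r. U $$ (i, k) * W (i, j) * ux k)"
      by (simp add: x'i right_diff_distrib sum_subtractf sum_distrib_left algebra_simps)
    also have "(\<Sum>i<n1. \<Sum>k<r. U $$ (i, k) * W (i, j) * ux k) = (\<Sum>k<r. (\<Sum>i<n1. U $$ (i, k) * W (i, j)) * ux k)"
      unfolding sum_distrib_right by (rule sum.swap)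
    also have "\<dots> = 0" using left[OF _ j] by simp
    finally show ?thesis by simp
  qed
  have Wy: "(\<Sum>j<n2. W (i, j) * y' j) = (\<Sum>j<n2. W (i, j) * y j)" if i: "i < n1" for i
  proof -
    have "(\<Sum>j<n2. W (i, j) * y' j) =
        (\<Sum>j<n2. W (i, j) * y j) - (\<Sum>j<n2. \<Sum>k<r. W (i, j) * V $$ (j, k) * vy k)"
      by (simp add: y'j right_diff_distrib sum_subtractf sum_distrib_left algebra_simps)
    also have "(\<Sum>j<n2. \<Sum>k<r. W (i, j) * V $$ (j, k) * vy k) = (\<Sum>k<r. (\<Sum>j<n2. W (i, j) * V $$ (j, k)) * vy k)"
      unfolding sum_distrib_right by (rule sum.swap)
    also have "\<dots> = 0" using right[OF _ i] by simp
    finally show ?thesis by simp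
  qed
  have "?S W x y = (\<Sum>i<n1. x i * (\<Sum>j<n2. W (i, j) * y j))"
    by (simp add: sum_cells sum_distrib_left algebra_simps)
  also have "\<dots> = (\<Sum>i<n1. x i * (\<Sum>j<n2. W (i, j) * y' j))" by (simp add: Wy)
  also have "\<dots> = (\<Sum>j<n2. (\<Sum>i<n1. W (i, j) * x i) * y' j)"
    unfolding sum_distrib_left sum_distrib_right by (subst sum.swap) (simp add: algebra_simps)
  also have "\<dots> = (\<Sum>j<n2. (\<Sum>i<n1. W (i, j) * x' i) * y' j)" by (simp add: Wx)
  also have "\<dots> = ?S W x' y'"
    unfolding sum_cells sum_distrib_right by (subst sum.swap) simp
  finally have SW: "\<bar>?S W x y\<bar> \<le> nrm {..<n1} x' * nrm {..<n2} y'"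
    using W by (simp add: bil_bound_def)
  define t where "t = L2_set ux {..<r}"
  define u where "u = L2_set vy {..<r}"
  have "?S (\<lambda>c. \<Sum>k<r. U $$ (fst c, k) * V $$ (snd c, k)) x y =
      (\<Sum>c\<in>cells n1 n2. \<Sum>k<r. (U $$ (fst c, k) * x (fst c)) * (V $$ (snd c, k) * y (snd c)))"
    unfolding sum_distrib_right by (intro sum.cong refl) (simp add: algebra_simps)
  also have "\<dots> = (\<Sum>k<r. \<Sum>c\<in>cells n1 n2. (U $$ (fst c, k) * x (fst c)) * (V $$ (snd c, k) * y (snd c)))"
    by (rule sum.swap)
  also have "\<dots> = (\<Sum>k<r. ux k * vy k)"
    by (simp add: ux_def vy_def sum_cells sum_product)
  finally have "\<bar>?S (\<lambda>c. \<Sum>k<r. U $$ (fst c, k) * V $$ (snd c, k)) x y\<bar> \<le> (\<Sum>k<r. \<bar>ux k\<bar> * \<bar>vy k\<bar>)"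
    by (simp add: sum_abs flip: abs_mult)
  also have "\<dots> \<le> t * u" unfolding t_def u_def by (rule L2_set_mult_ineq)
  finally have SE: "\<bar>?S (\<lambda>c. \<Sum>k<r. U $$ (fst c, k) * V $$ (snd c, k)) x y\<bar> \<le> t * u" .
  have "\<bar>?S (\<lambda>c. (\<Sum>k<r. U $$ (fst c, k) * V $$ (snd c, k)) + W c) x y\<bar> \<le>
      \<bar>?S (\<lambda>c. \<Sum>k<r. U $$ (fst c, k) * V $$ (snd c, k)) x y\<bar> + \<bar>?S W x y\<bar>"
    by (simp add: distrib_right sum.distrib abs_triangle_ineq)
  also have "\<dots> \<le> t * u + nrm {..<n1} x' * nrm {..<n2} y'" by (intro add_mono SE SW)
  also have "\<dots> \<le> nrm {..<n1} x * nrm {..<n2} y"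
  proof (rule two_term_Cauchy_Schwarz)
    show "t\<^sup>2 + (nrm {..<n1} x')\<^sup>2 = (nrm {..<n1} x)\<^sup>2"
      using comp_proj_pythagoras[OF U, of x] by (simp add: t_def x'_def ux_def L2_set_def sum_nonneg)
    show "u\<^sup>2 + (nrm {..<n2} y')\<^sup>2 = (nrm {..<n2} y)\<^sup>2"
      using comp_proj_pythagoras[OF V, of y] by (simp add: u_def y'_def vy_def L2_set_def sum_nonneg)
  qed (auto simp: nrm_nonneg)
  finally show "\<bar>?S (\<lambda>c. (\<Sum>k<r. U $$ (fst c, k) * V $$ (snd c, k)) + W c) x y\<bar>
      \<le> 1 * nrm {..<n1} x * nrm {..<n2} y" by simp
qed

lemma index_UVt:
  assumes "orthocols n1 r U" "orthocols n2 r V" "c \<in> cells n1 n2"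
  shows "(U * transpose_mat V) $$ c = (\<Sum>k<r. U $$ (fst c, k) * V $$ (snd c, k))"
  using assms by (cases c) (auto simp: orthocols_def index_mult_mat_sum[of U n1 r _ n2])

lemma skinny_svdD:
  assumes "skinny_svd M r U S V" "M \<in> carrier_mat n1 n2"
  shows "orthocols n1 r U" "orthocols n2 r V" "\<And>k. k < r \<Longrightarrow> 0 < S $$ (k, k)"
    "\<And>c. c \<in> cells n1 n2 \<Longrightarrow> M $$ c = (\<Sum>k<r. S $$ (k, k) * (U $$ (fst c, k) * V $$ (snd c, k)))"
proof -
  have U: "U \<in> carrier_mat n1 r" and V: "V \<in> carrier_mat n2 r" and S: "S \<in> carrier_mat r r"
    and M: "M = U * S * transpose_mat V" and d: "diagonal_mat S"
    using assms by (auto simp: skinny_svd_def)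
  show "orthocols n1 r U" "orthocols n2 r V" "\<And>k. k < r \<Longrightarrow> 0 < S $$ (k, k)"
    using assms U V by (auto simp: skinny_svd_def intro!: orthocolsI)
  fix c assume "c \<in> cells n1 n2"
  then obtain i j where c: "c = (i, j)" "i < n1" "j < n2" by auto
  have "(U * S) $$ (i, k) = S $$ (k, k) * U $$ (i, k)" if k: "k < r" for k
  proof -
    have "(U * S) $$ (i, k) = (\<Sum>l<r. U $$ (i, l) * S $$ (l, k))"
      using U S c k by (intro index_mult_mat_sum)
    also have "\<dots> = (\<Sum>l<r. if l = k then S $$ (k, k) * U $$ (i, k) else 0)"
      using d S k by (intro sum.cong refl) (auto simp: diagonal_mat_def)
    finally show ?thesis using k by simp
  qed
  then show "M $$ c = (\<Sum>k<r. S $$ (k, k) * (U $$ (fst c, k) * V $$ (snd c, k)))"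
    unfolding M c using U V S c
    by (subst index_mult_mat_sum[of _ n1 r _ n2]) (auto intro!: sum.cong)
qed

lemma app_tan_kernel_UVt:
  assumes U: "orthocols n1 r U" and V: "orthocols n2 r V" and c: "c \<in> cells n1 n2"
  shows "app (cells n1 n2) (tan_kernel U V) (($$) (U * transpose_mat V)) c = (U * transpose_mat V) $$ c"
proof -
  obtain i j where ij: "c = (i, j)" "i < n1" "j < n2" using c by auto
  have "(\<Sum>a<n1. \<Sum>b<n2. comp_proj U i a * (U * transpose_mat V) $$ (a, b) * comp_proj V b j) =
      (\<Sum>a<n1. \<Sum>b<n2. \<Sum>k<r. comp_proj U i a * U $$ (a, k) * V $$ (b, k) * comp_proj V b j)"
    using index_UVt[OF U V]
    by (intro sum.cong refl) (simp add: sum_distrib_left sum_distrib_right algebra_simps)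
  also have "\<dots> = (\<Sum>b<n2. \<Sum>a<n1. \<Sum>k<r. comp_proj U i a * U $$ (a, k) * V $$ (b, k) * comp_proj V b j)"
    by (rule sum.swap)
  also have "\<dots> = (\<Sum>b<n2. \<Sum>k<r. (\<Sum>a<n1. comp_proj U i a * U $$ (a, k)) * (V $$ (b, k) * comp_proj V b j))"
    unfolding sum_distrib_right mult.assoc by (intro sum.cong refl sum.swap)
  also have "\<dots> = 0" using comp_proj_col[OF U ij(2)] by simp
  finally show ?thesis using ij by (simp add: app_tan_kernel)
qed

text \<open>\<open>y\<close> is an approximate dual certificate: the hypotheses on \<open>y\<close> make \<open>ip E y h\<close> nonnegative
  for every feasible direction \<open>h\<close>, and \<open>inj\<close> controls the tangential part of \<open>h\<close>.\<close>

lemma solutions_unique: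
  fixes M U S V :: "real mat" and n1 n2 r :: nat
  defines "E \<equiv> cells n1 n2"
  defines "P \<equiv> app E (tan_kernel U V)"
  assumes M: "M \<in> carrier_mat n1 n2" and svd: "skinny_svd M r U S V" and Om: "\<Omega> \<subseteq> E"
    and G: "proj_kernel E (tan_kernel U V) tau"
    and y_supp: "\<And>c. c \<in> E \<Longrightarrow> y c \<noteq> 0 \<Longrightarrow> c \<in> \<Omega> \<and> M $$ c \<le> C"
    and y_sign: "\<And>c. c \<in> E \<Longrightarrow> M $$ c = C \<Longrightarrow> 0 \<le> y c"
    and ya: "nrm E (\<lambda>c. (U * transpose_mat V) $$ c - P y c) \<le> a"
    and inj: "\<And>h. (\<And>c. c \<in> \<Omega> \<Longrightarrow> M $$ c < C \<Longrightarrow> h c = 0) \<Longrightarrow> nrm E (P h) \<le> b * nrm E (\<lambda>c. h c - P h c)"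
    and ab: "a * b \<le> 1 / 2"
    and spec: "bil_bound n1 n2 (\<lambda>c. y c - P y c) s" and s: "s < 1 / 2"
  shows "solutions C M \<Omega> = {M}"
proof -
  note U = skinny_svdD(1)[OF svd M] and V = skinny_svdD(2)[OF svd M]
  have finE: "finite E" by (simp add: E_def)
  define t where "t k c = U $$ (fst c, k) * V $$ (snd c, k)" for k and c :: "nat \<times> nat"
  define e where "e c = (\<Sum>k<r. t k c)" for c
  have e_UV: "(U * transpose_mat V) $$ c = e c" if "c \<in> E" for c
    using that index_UVt[OF U V] by (simp add: E_def e_def t_def)
  have tt: "ip E (t k) (t l) = of_bool (k = l)" if "k < r" "l < r" for k l
  proof -
    have "ip E (t k) (t l) = ip {..<n1} (\<lambda>i. U $$ (i, k)) (\<lambda>i. U $$ (i, l)) *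
        ip {..<n2} (\<lambda>j. V $$ (j, k)) (\<lambda>j. V $$ (j, l))"
      unfolding E_def t_def[abs_def] by (rule ip_tensor)
    then show ?thesis using U V that by (simp add: ip_def orthocols_def)
  qed
  have Mt: "M $$ c = (\<Sum>k<r. S $$ (k, k) * t k c)" if "c \<in> E" for c
    using skinny_svdD(4)[OF svd M, of c] that by (simp add: E_def t_def)
  have ipM: "ip E z (($$) M) = (\<Sum>k<r. S $$ (k, k) * ip E z (t k))" for z
  proof -
    have "ip E z (($$) M) = ip E z (\<lambda>c. \<Sum>k<r. S $$ (k, k) * t k c)" by (intro ip_cong) (auto simp: Mt)
    then show ?thesis by (simp only: ip_linear)
  qed
  have eM: "ip E e (($$) M) = (\<Sum>k<r. S $$ (k, k))"
  proof -
    have "ip E e (t k) = 1" if "k < r" for k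
      unfolding e_def[abs_def] ip_linear using that by (simp add: tt of_bool_def)
    then show ?thesis by (simp add: ipM)
  qed
  \<comment> \<open>Only this inequality is needed. A dual optimizer of \<open>M\<close> pairs with
    each \<open>u_k v_k^T\<close> to at most 1, so the diagonal of \<open>S\<close> need not be
    matched with the eigenvalues in \<open>trace_norm\<close>.\<close>
  have trM: "trace_norm M \<le> ip E e (($$) M)"
  proof -
    obtain W where W: "bil_bound n1 n2 W 1" "ip E W (($$) M) = trace_norm M"
      by (rule trace_norm_dual_attained[OF M, folded E_def]) (rule that)
    have "ip E W (t k) \<le> 1" if k: "k < r" for k
    proof -
      have "ip E W (t k) = (\<Sum>c\<in>cells n1 n2. W c * U $$ (fst c, k) * V $$ (snd c, k))"
        using ip_tensor_right[of n1 n2 W "\<lambda>i. U $$ (i, k)" "\<lambda>j. V $$ (j, k)"]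
        by (simp add: E_def t_def[abs_def])
      also have "\<dots> \<le> 1 * nrm {..<n1} (\<lambda>i. U $$ (i, k)) * nrm {..<n2} (\<lambda>j. V $$ (j, k))"
        using W(1)[unfolded bil_bound_def, rule_format, of "\<lambda>i. U $$ (i, k)" "\<lambda>j. V $$ (j, k)"] by simp
      finally show ?thesis using nrm_col[OF U k] nrm_col[OF V k] by simp
    qed
    then have "(\<Sum>k<r. S $$ (k, k) * ip E W (t k)) \<le> (\<Sum>k<r. S $$ (k, k) * 1)"
      using skinny_svdD(3)[OF svd M] by (intro sum_mono mult_left_mono) (auto simp: less_imp_le)
    then show ?thesis unfolding eM using W(2) by (simp add: ipM)
  qed
  have Pe: "P e c = e c" if c: "c \<in> E" for c
  proof -
    have "P e = P (($$) (U * transpose_mat V))" unfolding P_def by (intro app_cong) (simp add: e_UV)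
    then show ?thesis using app_tan_kernel_UVt[OF U V, of c] c e_UV[OF c] by (simp add: P_def E_def)
  qed
  have P_sym: "ip E (P u) v = ip E u (P v)" for u v
    unfolding P_def using G by (intro ip_app_commute[symmetric]) (auto simp: proj_kernel_def)
  have PP: "P (P u) c = P u c" if "c \<in> E" for u c
    unfolding P_def using proj_kernel_app_idem[OF G that] .
  have P_orth: "ip E (\<lambda>c. u c - P u c) (P v) = 0" for u v
  proof -
    have "ip E (P u) (P v) = ip E u (P (P v))" by (rule P_sym)
    also have "\<dots> = ip E u (P v)" by (intro ip_cong) (auto simp: PP)
    finally show ?thesis by (simp add: ip_linear)
  qed
  have main: "trace_norm M < trace_norm X" if X: "feasible C M \<Omega> X" "X \<noteq> M" for X
  proof -
    have Xc: "X \<in> carrier_mat n1 n2" using X M by (simp add: feasible_def)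
    define h where "h c = X $$ c - M $$ c" for c
    define A where "A = Matrix.mat n1 n2 (\<lambda>c. h c - P h c)"
    have Ac: "A \<in> carrier_mat n1 n2" by (simp add: A_def)
    have Ae: "A $$ c = h c - P h c" if "c \<in> E" for c using that by (auto simp: A_def E_def)
    have Aij: "A $$ (i, j) = (\<Sum>a<n1. \<Sum>b<n2. comp_proj U i a * h (a, b) * comp_proj V b j)"
      if "i < n1" "j < n2" for i j
      using that Ae[of "(i, j)"] by (simp add: E_def P_def app_tan_kernel)
    have clip_M: "clip C M $$ c = min C (M $$ c)" if "c \<in> E" for c
      using that M by (auto simp: clip_def E_def)
    have h0: "h c = 0" if "c \<in> \<Omega>" "M $$ c < C" for c
    proof -
      have "c \<in> \<Omega> - clipped_obs C M \<Omega>" "c \<in> E"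
        using that Om clip_M[of c] by (auto simp: clipped_obs_def)
      then show ?thesis using X(1) that clip_M[of c] by (auto simp: feasible_def h_def)
    qed
    have hC: "0 \<le> h c" if "c \<in> \<Omega>" "M $$ c = C" for c
    proof -
      have "c \<in> clipped_obs C M \<Omega>" "c \<in> E"
        using that Om clip_M[of c] by (auto simp: clipped_obs_def)
      then have "clip C M $$ c \<le> X $$ c" using X(1) by (auto simp: feasible_def)
      then show ?thesis using clip_M[OF \<open>c \<in> E\<close>] that by (simp add: h_def)
    qed
    have yh: "0 \<le> ip E y h" unfolding ip_def
    proof (intro sum_nonneg)
      fix c assume c: "c \<in> E"
      show "0 \<le> y c * h c"
      proof (cases "y c = 0")
        case False
        then have "c \<in> \<Omega>" "M $$ c \<le> C" using y_supp[OF c] by auto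
        then show ?thesis using h0 hC y_sign[OF c] by (cases "M $$ c = C") auto
      qed simp
    qed
    \<comment> \<open>The polar factor of the part of \<open>h\<close> orthogonal to the tangent
      space. Its null vectors include all \<open>u_k\<close> and \<open>v_k\<close>, which makes
      \<open>e + W\<close> a subgradient at \<open>M\<close> adapted to the direction
      \<open>h\<close>.\<close>
    obtain W where W: "bil_bound n1 n2 W 1" "ip E W (($$) A) = trace_norm A"
      "\<And>x j. (\<And>j. j < n2 \<Longrightarrow> (\<Sum>i<n1. x i * A $$ (i, j)) = 0) \<Longrightarrow> j < n2 \<Longrightarrow> (\<Sum>i<n1. x i * W (i, j)) = 0"
      "\<And>y i. (\<And>i. i < n1 \<Longrightarrow> (\<Sum>j<n2. A $$ (i, j) * y j) = 0) \<Longrightarrow> i < n1 \<Longrightarrow> (\<Sum>j<n2. W (i, j) * y j) = 0"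
      by (rule trace_norm_dual_attained[OF Ac, folded E_def]) (rule that, assumption, assumption, blast, blast)
    have left: "(\<Sum>i<n1. U $$ (i, k) * W (i, j)) = 0" if k: "k < r" and j: "j < n2" for k j
    proof (rule W(3)[OF _ j])
      fix j assume j: "j < n2"
      have "(\<Sum>i<n1. U $$ (i, k) * A $$ (i, j)) =
          (\<Sum>i<n1. \<Sum>a<n1. (comp_proj U a i * U $$ (i, k)) * (\<Sum>b<n2. h (a, b) * comp_proj V b j))"
        using j by (intro sum.cong refl) (simp add: Aij sum_distrib_left comp_proj_sym algebra_simps)
      also have "\<dots> = (\<Sum>a<n1. (\<Sum>i<n1. comp_proj U a i * U $$ (i, k)) * (\<Sum>b<n2. h (a, b) * comp_proj V b j))"
        by (subst sum.swap) (simp add: sum_distrib_right)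
      also have "\<dots> = 0" using comp_proj_col[OF U _ k] by simp
      finally show "(\<Sum>i<n1. U $$ (i, k) * A $$ (i, j)) = 0" .
    qed
    have right: "(\<Sum>j<n2. W (i, j) * V $$ (j, k)) = 0" if k: "k < r" and i: "i < n1" for k i
    proof (rule W(4)[OF _ i])
      fix i assume i: "i < n1"
      have "(\<Sum>j<n2. A $$ (i, j) * V $$ (j, k)) =
          (\<Sum>j<n2. \<Sum>b<n2. (comp_proj V b j * V $$ (j, k)) * (\<Sum>a<n1. comp_proj U i a * h (a, b)))"
      proof (intro sum.cong refl)
        fix j assume "j \<in> {..<n2}"
        then have "A $$ (i, j) * V $$ (j, k) = (\<Sum>b<n2. \<Sum>a<n1. comp_proj U i a * h (a, b) * comp_proj V b j * V $$ (j, k))"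
          using i by (simp add: Aij sum_distrib_right) (subst sum.swap, simp)
        then show "A $$ (i, j) * V $$ (j, k) =
            (\<Sum>b<n2. (comp_proj V b j * V $$ (j, k)) * (\<Sum>a<n1. comp_proj U i a * h (a, b)))"
          by (simp add: sum_distrib_left algebra_simps)
      qed
      also have "\<dots> = (\<Sum>b<n2. (\<Sum>j<n2. comp_proj V b j * V $$ (j, k)) * (\<Sum>a<n1. comp_proj U i a * h (a, b)))"
        by (subst sum.swap) (simp add: sum_distrib_right)
      also have "\<dots> = 0" using comp_proj_col[OF V _ k] by simp
      finally show "(\<Sum>j<n2. A $$ (i, j) * V $$ (j, k)) = 0" .
    qed
    have dim: "dim_col U = r" "dim_col V = r" using U V by (auto simp: orthocols_def)
    have PW: "P W c = 0" if c: "c \<in> E" for c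
    proof -
      obtain i j where ij: "c = (i, j)" "i < n1" "j < n2" using c by (auto simp: E_def)
      have "(\<Sum>b<n2. V $$ (b, k) * (\<Sum>a<n1. comp_proj U i a * W (a, b))) = 0" if k: "k < r" for k
      proof -
        have "(\<Sum>b<n2. V $$ (b, k) * (\<Sum>a<n1. comp_proj U i a * W (a, b))) =
            (\<Sum>a<n1. comp_proj U i a * (\<Sum>b<n2. W (a, b) * V $$ (b, k)))"
          unfolding sum_distrib_left by (subst sum.swap) (simp add: algebra_simps)
        then show ?thesis using right[OF k] by simp
      qed
      then show ?thesis
        using ij left by (simp add: P_def E_def app_tan_kernel_expand dim)
    qed
    have Wt: "ip E W (t k) = 0" if k: "k < r" for k
    proof -
      have "ip E W (t k) = (\<Sum>i<n1. \<Sum>j<n2. U $$ (i, k) * W (i, j) * V $$ (j, k))"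
        by (simp add: ip_def E_def t_def sum_cells algebra_simps)
      also have "\<dots> = (\<Sum>j<n2. (\<Sum>i<n1. U $$ (i, k) * W (i, j)) * V $$ (j, k))"
        by (subst sum.swap) (simp add: sum_distrib_right)
      finally show ?thesis using left[OF k] by simp
    qed
    have ipX: "ip E z (($$) X) = ip E z (($$) M) + ip E z h" for z
      unfolding h_def[abs_def] by (simp add: ip_linear)
    have Wh: "ip E W h = trace_norm A"
    proof -
      have "ip E W (P h) = ip E (P W) h" by (rule P_sym[symmetric])
      also have "\<dots> = 0" by (simp add: ip_def PW)
      finally have "ip E W h = ip E W (\<lambda>c. h c - P h c)" by (simp add: ip_linear)
      also have "\<dots> = ip E W (($$) A)" by (intro ip_cong) (auto simp: Ae)
      finally show ?thesis by (simp add: W(2))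
    qed
    have "bil_bound n1 n2 (\<lambda>c. e c + W c) 1"
      unfolding e_def t_def by (rule bil_bound_subgradient[OF U V W(1) left right])
    from trace_norm_dual_bound[OF Xc this]
    have "ip E (\<lambda>c. e c + W c) (($$) X) \<le> trace_norm X" by (simp add: E_def)
    then have "ip E e (($$) M) + ip E e h + trace_norm A \<le> trace_norm X"
      by (simp add: ip_linear ipX Wh ipM[of W] Wt)
    then have lower: "trace_norm M + ip E e h + trace_norm A \<le> trace_norm X" using trM by linarith
    have nA: "nrm E (\<lambda>c. h c - P h c) \<le> trace_norm A"
      using nrm_le_trace_norm[OF Ac] nrm_cong[of E "($$) A" "\<lambda>c. h c - P h c"] Ae by (simp add: E_def)
    have "ip E (\<lambda>c. e c - P y c) (P h) = ip E (\<lambda>c. e c - P y c) h"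
    proof -
      have "P (\<lambda>c. e c - P y c) c = e c - P y c" if "c \<in> E" for c
        using Pe[OF that] PP[OF that, of y] by (simp add: P_def app_diff)
      then have "ip E (P (\<lambda>c. e c - P y c)) h = ip E (\<lambda>c. e c - P y c) h" by (intro ip_cong) auto
      then show ?thesis by (simp add: P_sym)
    qed
    moreover have "\<bar>ip E (\<lambda>c. e c - P y c) (P h)\<bar> \<le> a * nrm E (P h)"
    proof -
      have "nrm E (\<lambda>c. e c - P y c) \<le> a" using ya nrm_cong[of E "\<lambda>c. (U * transpose_mat V) $$ c - P y c"] e_UV by simp
      then show ?thesis
        using abs_ip_le[of E "\<lambda>c. e c - P y c" "P h"] mult_right_mono[OF _ nrm_nonneg[of E "P h"]] by fastforce
    qed
    moreover have "a * nrm E (P h) \<le> 1 / 2 * trace_norm A"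
    proof -
      have a: "0 \<le> a" using ya nrm_nonneg order_trans by blast
      have "a * nrm E (P h) \<le> a * (b * nrm E (\<lambda>c. h c - P h c))"
        using a inj[OF h0] by (intro mult_left_mono) auto
      also have "\<dots> \<le> 1 / 2 * nrm E (\<lambda>c. h c - P h c)"
        using mult_right_mono[OF ab nrm_nonneg[of E "\<lambda>c. h c - P h c"]] by (simp add: mult.assoc)
      also have "\<dots> \<le> 1 / 2 * trace_norm A" using nA by simp
      finally show ?thesis .
    qed
    moreover have "\<bar>ip E (\<lambda>c. y c - P y c) h\<bar> \<le> s * trace_norm A"
    proof -
      have "ip E (\<lambda>c. y c - P y c) h = ip E (\<lambda>c. y c - P y c) (\<lambda>c. h c - P h c)"
        using P_orth[of y h] by (simp add: ip_linear)
      also have "\<dots> = ip E (\<lambda>c. y c - P y c) (($$) A)" by (intro ip_cong) (auto simp: Ae)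
      finally show ?thesis using trace_norm_dual_bound[OF Ac spec] by (simp add: E_def)
    qed
    \<comment> \<open>The three terms cost at most \<open>1/2\<close> of
      \<open>trace_norm A\<close>, are nonnegative by feasibility, and cost at most \<open>s\<close>
      of \<open>trace_norm A\<close>. The subgradient gains the full \<open>trace_norm A\<close>, so
      a factor \<open>1/2 - s\<close> remains.\<close>
    moreover have "ip E e h = ip E (\<lambda>c. e c - P y c) h + ip E y h - ip E (\<lambda>c. y c - P y c) h"
      by (simp add: ip_linear)
    ultimately have "- (1 / 2 + s) * trace_norm A \<le> ip E e h" using yh by (simp add: algebra_simps abs_le_iff)
    then have "trace_norm M + (1 / 2 - s) * trace_norm A \<le> trace_norm X"
      using lower by (simp add: algebra_simps)
    \<comment> \<open>Otherwise \<open>h\<close> would be purely tangential, and \<open>inj\<close>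
      would force it to vanish.\<close>
    moreover have "0 < trace_norm A"
    proof (rule ccontr)
      assume "\<not> 0 < trace_norm A"
      then have z: "nrm E (\<lambda>c. h c - P h c) = 0" using nA nrm_nonneg[of E "\<lambda>c. h c - P h c"] by linarith
      then have "nrm E (P h) = 0" using inj[OF h0] nrm_nonneg[of E "P h"] by fastforce
      with z have "h c = 0" if "c \<in> E" for c using that finE by (simp add: nrm_zero_iff)
      then have "X = M" using Xc M by (intro eq_matI) (auto simp: h_def E_def)
      then show False using X(2) by simp
    qed
    ultimately show ?thesis using s by (smt (verit) mult_pos_pos)
  qed
  have feasM: "feasible C M \<Omega> M"
  proof -
    have "clip C M $$ c = min C (M $$ c)" if "c \<in> \<Omega>" for c
      using that Om M by (cases c) (auto simp: clip_def E_def)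
    then show ?thesis using M by (auto simp: feasible_def clipped_obs_def min_def split: if_splits)
  qed
  show ?thesis
  proof (intro equalityI subsetI)
    fix X assume "X \<in> solutions C M \<Omega>"
    then have "feasible C M \<Omega> X" "\<not> trace_norm M < trace_norm X"
      using feasM by (auto simp: solutions_def is_arg_min_def)
    then show "X \<in> {M}" using main by blast
  next
    fix X assume "X \<in> {M}"
    moreover have "\<not> trace_norm X < trace_norm M" if "feasible C M \<Omega> X" for X
      using main[OF that] by (cases "X = M") auto
    ultimately show "X \<in> solutions C M \<Omega>" using feasM by (simp add: solutions_def is_arg_min_def)
  qed
qed

section \<open>The information-loss quantities\<close>

text \<open>The crude constant \<open>k\<close> only certifies that the supremum is over a bounded
  set; the conclusion carries the sharp value.\<close>

lemma SUP_ratio_bound: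
  fixes F N :: "'a \<Rightarrow> real"
  assumes "Z \<in> A" "\<And>Z. Z \<in> A \<Longrightarrow> 0 < N Z" "\<And>Z. Z \<in> A \<Longrightarrow> F Z \<le> k * N Z"
  shows "F Z \<le> (SUP Z\<in>A. F Z / N Z) * N Z"
proof -
  have "bdd_above ((\<lambda>Z. F Z / N Z) ` A)"
  proof (intro bdd_aboveI2)
    fix Z assume "Z \<in> A"
    then show "F Z / N Z \<le> k" using assms(2,3)[of Z] by (simp add: divide_le_eq)
  qed
  then have "F Z / N Z \<le> (SUP Z\<in>A. F Z / N Z)" using assms(1) by (intro cSUP_upper)
  then show ?thesis using assms(2)[OF assms(1)] by (simp add: divide_le_eq)
qed

lemma SUP_ratio_nonneg:
  fixes F N :: "'a \<Rightarrow> real"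
  assumes "Z \<in> A" "\<And>Z. Z \<in> A \<Longrightarrow> 0 < N Z" "\<And>Z. Z \<in> A \<Longrightarrow> F Z \<le> k * N Z" "0 \<le> F Z"
  shows "0 \<le> (SUP Z\<in>A. F Z / N Z)"
  using SUP_ratio_bound[OF assms(1-3)] assms(2)[OF assms(1)] assms(4)
  by (meson dual_order.trans zero_le_mult_iff not_le)

lemma bil_bound_entry:
  assumes "bil_bound n1 n2 z s" "c \<in> cells n1 n2"
  shows "\<bar>z c\<bar> \<le> s"
proof -
  define x where "x i = (of_bool (i = fst c) :: real)" for i
  define y where "y j = (of_bool (j = snd c) :: real)" for j
  have "nrm {..<n1} x = 1" "nrm {..<n2} y = 1"
    using assms(2) by (auto simp: nrm_def ip_def x_def y_def of_bool_def if_distrib[of "\<lambda>t. t * _"] cong: if_cong)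
  moreover have "(\<Sum>d\<in>cells n1 n2. z d * x (fst d) * y (snd d)) =
      (\<Sum>d\<in>cells n1 n2. if d = c then z d else 0)"
    by (intro sum.cong refl) (auto simp: x_def y_def prod_eq_iff)
  ultimately show ?thesis
    using assms(1)[unfolded bil_bound_def, rule_format, of x y] assms(2) by (simp only: sum.delta' finite_cartesian_product finite_lessThan) (simp add: sum.delta)
qed

lemma nrm_le_sqrt_card:
  assumes "\<And>c. c \<in> J \<Longrightarrow> \<bar>u c\<bar> \<le> b" "0 \<le> b"
  shows "nrm J u \<le> sqrt (real (card J)) * b"
proof -
  have "ip J u u \<le> (\<Sum>c\<in>J. b\<^sup>2)"
    unfolding ip_self using assms by (intro sum_mono) (metis abs_le_square_iff abs_of_nonneg)
  then have "sqrt (ip J u u) \<le> sqrt (real (card J) * b\<^sup>2)" by simp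
  then show ?thesis using assms(2) by (simp add: nrm_def real_sqrt_mult)
qed

lemma abs_le_nrm: "finite J \<Longrightarrow> c \<in> J \<Longrightarrow> \<bar>u c\<bar> \<le> nrm J u"
proof -
  assume "finite J" "c \<in> J"
  then have "(u c)\<^sup>2 \<le> ip J u u" unfolding ip_self by (intro member_le_sum) auto
  then have "sqrt ((u c)\<^sup>2) \<le> sqrt (ip J u u)" by (rule real_sqrt_le_mono)
  then show ?thesis by (simp add: nrm_def)
qed

locale clipped_completion =
  fixes M U S V :: "real mat" and n1 n2 r :: nat and C :: real
  assumes n: "2 \<le> n1" "2 \<le> n2" and r: "1 \<le> r"
    and M: "M \<in> carrier_mat n1 n2" and svd: "skinny_svd M r U S V"
begin

definition "E = cells n1 n2"
definition "P = app E (tan_kernel U V)"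
definition "e = ($$) (U * transpose_mat V)"
definition "pstar z c = (if M $$ c < C then z c else if M $$ c = C then max (z c) 0 else 0)" for z :: "nat \<times> nat \<Rightarrow> real"
text \<open>The nonlinear \<open>P_star\<close> acts on a fixed \<open>z\<close> as the entry mask \<open>keep z\<close>, so linear concentration
  bounds apply to it once \<open>z\<close> is independent of the sample.\<close>

definition "keep z = {c. M $$ c < C \<or> (M $$ c = C \<and> 0 \<le> z c)}" for z :: "nat \<times> nat \<Rightarrow> real"
definition "m0 = max_norm (U * transpose_mat V)"
definition "N = real n1 * real n2"
text \<open>Equals \<open>coherence U V * r * (1 / n1 + 1 / n2)\<close>, the bound on the diagonal
  of the tangent projection.\<close>

definition "tau = coherence U V * real r * (real n1 + real n2) / N"

lemma U: "orthocols n1 r U" and V: "orthocols n2 r V"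
  using skinny_svdD[OF svd M] by auto

lemma dims: "dim_row U = n1" "dim_col U = r" "dim_row V = n2" "dim_col V = r"
    "dim_row M = n1" "dim_col M = n2"
  using U V M by (auto simp: orthocols_def)

lemma UVc: "U * transpose_mat V \<in> carrier_mat n1 n2"
  using dims by auto

lemma finE: "finite E" and cardE: "real (card E) = N" and N: "4 \<le> N"
proof -
  show "finite E" "real (card E) = N" by (simp_all add: E_def N_def)
  have "2 * 2 \<le> real n1 * real n2" using n by (intro mult_mono) auto
  then show "4 \<le> N" by (simp add: N_def)
qed

lemma row_sums: "i < n1 \<Longrightarrow> (\<Sum>k<r. (U $$ (i, k))\<^sup>2) \<le> coherence U V * real r / real n1"
    "j < n2 \<Longrightarrow> (\<Sum>k<r. (V $$ (j, k))\<^sup>2) \<le> coherence U V * real r / real n2"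
proof -
  have vr: "(vnorm (Matrix.row A i))\<^sup>2 = (\<Sum>k<r. (A $$ (i, k))\<^sup>2)" if "A \<in> carrier_mat m r" "i < m" for A m i
    using that by (simp add: vnorm_nrm nrm_square ip_self)
  have *: "x \<le> b * real r / real m" if "real m / real r * x \<le> b" "0 < m" for x b m
    using that r by (simp add: field_simps)
  show "(\<Sum>k<r. (U $$ (i, k))\<^sup>2) \<le> coherence U V * real r / real n1" if i: "i < n1"
  proof (rule *)
    have "(\<Sum>k<r. (U $$ (i, k))\<^sup>2) \<in> (\<lambda>i. (vnorm (Matrix.row U i))\<^sup>2) ` {..<n1}"
      using vr[of U n1 i] i U by (intro image_eqI[of _ _ i]) (simp_all add: orthocols_def)
    then have "(\<Sum>k<r. (U $$ (i, k))\<^sup>2) \<le> (MAX i\<in>{..<n1}. (vnorm (Matrix.row U i))\<^sup>2)"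
      by (intro Max_ge) auto
    then have "real n1 / real r * (\<Sum>k<r. (U $$ (i, k))\<^sup>2) \<le>
        real n1 / real r * (MAX i\<in>{..<n1}. (vnorm (Matrix.row U i))\<^sup>2)"
      by (intro mult_left_mono) auto
    also have "\<dots> \<le> coherence U V" by (simp add: coherence_def dims)
    finally show "real n1 / real r * (\<Sum>k<r. (U $$ (i, k))\<^sup>2) \<le> coherence U V" .
  qed (use n in auto)
  show "(\<Sum>k<r. (V $$ (j, k))\<^sup>2) \<le> coherence U V * real r / real n2" if j: "j < n2"
  proof (rule *)
    have "(\<Sum>k<r. (V $$ (j, k))\<^sup>2) \<in> (\<lambda>j. (vnorm (Matrix.row V j))\<^sup>2) ` {..<n2}"
      using vr[of V n2 j] j V by (intro image_eqI[of _ _ j]) (simp_all add: orthocols_def)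
    then have "(\<Sum>k<r. (V $$ (j, k))\<^sup>2) \<le> (MAX j\<in>{..<n2}. (vnorm (Matrix.row V j))\<^sup>2)"
      by (intro Max_ge) auto
    then have "real n2 / real r * (\<Sum>k<r. (V $$ (j, k))\<^sup>2) \<le>
        real n2 / real r * (MAX j\<in>{..<n2}. (vnorm (Matrix.row V j))\<^sup>2)"
      by (intro mult_left_mono) auto
    also have "\<dots> \<le> coherence U V" by (simp add: coherence_def dims)
    finally show "real n2 / real r * (\<Sum>k<r. (V $$ (j, k))\<^sup>2) \<le> coherence U V" .
  qed (use n in auto)
qed

lemma G: "proj_kernel E (tan_kernel U V) tau"
  unfolding E_def
proof (rule tan_kernel_proj[OF U V])
  fix i j assume "i < n1" "j < n2"
  then have "(\<Sum>k<r. (U $$ (i, k))\<^sup>2) + (\<Sum>k<r. (V $$ (j, k))\<^sup>2) \<le>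
      coherence U V * real r / real n1 + coherence U V * real r / real n2"
    by (intro add_mono row_sums)
  also have "\<dots> = tau" using n by (simp add: tau_def N_def field_simps)
  finally show "(\<Sum>k<r. (U $$ (i, k))\<^sup>2) + (\<Sum>k<r. (V $$ (j, k))\<^sup>2) \<le> tau" .
qed

lemma sum_U_squares: "(\<Sum>i<n1. \<Sum>k<r. (U $$ (i, k))\<^sup>2) = real r"
proof -
  have "(\<Sum>i<n1. \<Sum>k<r. (U $$ (i, k))\<^sup>2) = (\<Sum>k<r. \<Sum>i<n1. U $$ (i, k) * U $$ (i, k))"
    by (subst sum.swap) (simp add: power2_eq_square)
  then show ?thesis using U by (simp add: orthocols_def)
qed

lemma coherence_ge_1: "1 \<le> coherence U V"
proof -
  have "(\<Sum>i<n1. \<Sum>k<r. (U $$ (i, k))\<^sup>2) \<le> (\<Sum>i<n1. coherence U V * real r / real n1)"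
    by (intro sum_mono row_sums) auto
  also have "\<dots> = coherence U V * real r" using n by simp
  finally have "real r \<le> coherence U V * real r" by (simp only: sum_U_squares)
  then show ?thesis using r by simp
qed

lemma r_le: "real r \<le> N"
proof -
  have "(\<Sum>k<r. (U $$ (i, k))\<^sup>2) \<le> 1" if "i < n1" for i
    using comp_proj_diag_nonneg[OF U that] by (simp add: comp_proj_def dims power2_eq_square)
  then have "(\<Sum>i<n1. \<Sum>k<r. (U $$ (i, k))\<^sup>2) \<le> (\<Sum>i<n1. 1)" by (intro sum_mono) auto
  then have "real r \<le> real n1 * 1" by (simp add: sum_U_squares)
  also have "\<dots> \<le> real n1 * real n2" using n by (intro mult_left_mono) auto
  finally show ?thesis by (simp add: N_def)
qed

lemma tau_pos: "0 < tau"
  unfolding tau_def using coherence_ge_1 r n N by (intro divide_pos_pos mult_pos_pos) auto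

lemma P_sym: "ip E (P u) v = ip E u (P v)"
  unfolding P_def using G by (intro ip_app_commute[symmetric]) (auto simp: proj_kernel_def)

lemma PP: "c \<in> E \<Longrightarrow> P (P u) c = P u c"
  unfolding P_def using proj_kernel_app_idem[OF G] .

lemma P_contraction: "nrm E (P u) \<le> nrm E u"
  unfolding P_def nrm_def using proj_kernel_contraction[OF G] by simp

lemma P_cong: "(\<And>c. c \<in> E \<Longrightarrow> u c = v c) \<Longrightarrow> P u = P v"
  unfolding P_def by (rule app_cong)

lemma P_diff: "P (\<lambda>c. u c - v c) = (\<lambda>c. P u c - P v c)"
  unfolding P_def by (rule app_diff)

lemma P_add: "P (\<lambda>c. u c + v c) = (\<lambda>c. P u c + P v c)"
  unfolding P_def by (rule app_add)

lemma P_sum: "P (\<lambda>c. \<Sum>k\<in>A. u k c) c = (\<Sum>k\<in>A. P (u k) c)"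
  unfolding P_def app_def sum_distrib_left by (rule sum.swap)

lemma Pe: "c \<in> E \<Longrightarrow> P e c = e c"
  unfolding P_def E_def e_def by (rule app_tan_kernel_UVt[OF U V])

lemma e_expand: "c \<in> E \<Longrightarrow> e c = (\<Sum>k<r. U $$ (fst c, k) * V $$ (snd c, k))"
  unfolding E_def e_def by (rule index_UVt[OF U V])

lemma e_tensor:
  assumes k: "k < r"
  shows "ip E e (\<lambda>c. U $$ (fst c, k) * V $$ (snd c, k)) = 1"
proof -
  have "ip E e (\<lambda>c. U $$ (fst c, k) * V $$ (snd c, k)) =
      ip E (\<lambda>c. \<Sum>l<r. U $$ (fst c, l) * V $$ (snd c, l)) (\<lambda>c. U $$ (fst c, k) * V $$ (snd c, k))"
    by (intro ip_cong) (auto simp: e_expand)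
  also have "\<dots> = (\<Sum>l<r. ip {..<n1} (\<lambda>i. U $$ (i, l)) (\<lambda>i. U $$ (i, k)) *
      ip {..<n2} (\<lambda>j. V $$ (j, l)) (\<lambda>j. V $$ (j, k)))"
    unfolding ip_linear E_def
    by (intro sum.cong refl) (rule ip_tensor)
  also have "\<dots> = (\<Sum>l<r. if l = k then 1 else 0)"
    using U V k by (intro sum.cong refl) (auto simp: ip_def orthocols_def)
  finally show ?thesis using k by simp
qed

lemma nrm_e: "nrm E e = sqrt (real r)"
proof -
  have "ip E e e = ip E e (\<lambda>c. \<Sum>k<r. U $$ (fst c, k) * V $$ (snd c, k))"
    by (intro ip_cong) (auto simp: e_expand)
  also have "\<dots> = (\<Sum>k<r. 1)" unfolding ip_linear by (intro sum.cong refl) (auto simp: e_tensor)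
  finally show ?thesis by (simp add: nrm_def)
qed

lemma e_le_m0: "c \<in> E \<Longrightarrow> \<bar>e c\<bar> \<le> m0"
  unfolding e_def m0_def E_def by (rule max_norm_ge[OF UVc])

lemma m0_nonneg: "0 \<le> m0"
  using e_le_m0[of "(0, 0)"] n by (auto simp: E_def)

text \<open>The lower bound on the joint coherence compares norms of \<open>U V^T\<close>: its
  Frobenius norm is \<open>sqrt r\<close>, at most \<open>sqrt N\<close> times its largest
  entry.\<close>

lemma mu1: "sqrt N * m0 = sqrt (real r) * joint_coherence U V" and mu1_ge_1: "1 \<le> joint_coherence U V"
  and m0_pos: "0 < m0"
proof -
  have j: "joint_coherence U V = sqrt N / sqrt (real r) * m0"
    by (simp add: joint_coherence_def dims m0_def N_def real_sqrt_divide)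
  then show "sqrt N * m0 = sqrt (real r) * joint_coherence U V" using r by simp
  have "sqrt (real r) \<le> sqrt N * m0"
    using nrm_le_sqrt_card[of E e m0] e_le_m0 m0_nonneg by (simp add: nrm_e cardE)
  then show "1 \<le> joint_coherence U V" using r unfolding j by (simp add: field_simps)
  then show "0 < m0" using m0_nonneg j by (cases "m0 = 0") auto
qed

text \<open>Tested on the first singular pair. It makes the domain of the supremum in
  \<open>rho_op\<close> large enough for every golfing residual.\<close>

lemma spec_norm_UVt_ge_1: "1 \<le> spec_norm (U * transpose_mat V)"
proof -
  have k: "0 < r" using r by simp
  have "1 = (\<Sum>c\<in>cells n1 n2. e c * U $$ (fst c, 0) * V $$ (snd c, 0))"
    using e_tensor[OF k] ip_tensor_right[of n1 n2 e "\<lambda>i. U $$ (i, 0)" "\<lambda>j. V $$ (j, 0)"] by (simp add: E_def)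
  also have "\<dots> \<le> spec_norm (U * transpose_mat V) * nrm {..<n1} (\<lambda>i. U $$ (i, 0)) * nrm {..<n2} (\<lambda>j. V $$ (j, 0))"
    using bil_bound_spec_norm[OF UVc, unfolded bil_bound_def, rule_format, of "\<lambda>i. U $$ (i, 0)" "\<lambda>j. V $$ (j, 0)"]
    by (simp add: e_def)
  finally show ?thesis using nrm_col[OF U k] nrm_col[OF V k] by simp
qed

lemma pstar_keep: "pstar z c = of_bool (c \<in> keep z) * z c"
  by (auto simp: pstar_def keep_def)

lemma abs_pstar_le: "\<bar>pstar z c\<bar> \<le> \<bar>z c\<bar>"
  by (auto simp: pstar_def)

lemma tangent_iff': "Z \<in> tangent U V \<longleftrightarrow> Z \<in> carrier_mat n1 n2 \<and> (\<forall>c\<in>E. P (($$) Z) c = Z $$ c)"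
  using tangent_iff[OF U V] by (simp add: E_def P_def)

lemma proj_T_index:
  "Z \<in> carrier_mat n1 n2 \<Longrightarrow> proj_T U V Z \<in> carrier_mat n1 n2"
  "Z \<in> carrier_mat n1 n2 \<Longrightarrow> c \<in> E \<Longrightarrow> proj_T U V Z $$ c = P (($$) Z) c"
  using proj_T_eq[OF U V _ G[unfolded E_def], of Z] by (auto simp: E_def P_def)

lemma P_star_index:
  "Z \<in> carrier_mat n1 n2 \<Longrightarrow> P_star C M Z \<in> carrier_mat n1 n2"
  "Z \<in> carrier_mat n1 n2 \<Longrightarrow> c \<in> E \<Longrightarrow> P_star C M Z $$ c = pstar (($$) Z) c"
  by (auto simp: P_star_def pstar_def E_def)

lemma residual:
  assumes Z: "Z \<in> carrier_mat n1 n2"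
  shows "proj_T U V (P_star C M Z) - Z \<in> carrier_mat n1 n2"
    and "c \<in> E \<Longrightarrow> (proj_T U V (P_star C M Z) - Z) $$ c = P (pstar (($$) Z)) c - Z $$ c"
proof -
  show "proj_T U V (P_star C M Z) - Z \<in> carrier_mat n1 n2" using Z by auto
  assume c: "c \<in> E"
  have "P (($$) (P_star C M Z)) = P (pstar (($$) Z))" by (intro P_cong P_star_index(2)[OF Z])
  then show "(proj_T U V (P_star C M Z) - Z) $$ c = P (pstar (($$) Z)) c - Z $$ c"
    using Z c proj_T_index(2)[OF P_star_index(1)[OF Z] c] by (auto simp: E_def)
qed

lemma nrm_pstar_le: "nrm E (pstar z) \<le> nrm E z"
  by (intro nrm_mono_abs abs_pstar_le)

lemma residual_nrm_le: "nrm E (\<lambda>c. P (pstar z) c - z c) \<le> 2 * nrm E z"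
proof -
  have "nrm E (\<lambda>c. P (pstar z) c + (- 1) * z c) \<le> nrm E (P (pstar z)) + nrm E (\<lambda>c. (- 1) * z c)"
    by (rule nrm_triangle)
  also have "\<dots> \<le> nrm E z + nrm E z"
    unfolding nrm_scale using P_contraction[of "pstar z"] nrm_pstar_le[of z] by simp
  finally show ?thesis by simp
qed

lemma nrm_pos:
  assumes "Z \<in> carrier_mat n1 n2" "Z \<noteq> 0\<^sub>m n1 n2"
  shows "0 < nrm E (($$) Z)"
proof (rule ccontr)
  assume "\<not> ?thesis"
  then have "nrm E (($$) Z) = 0" using nrm_nonneg[of E "($$) Z"] by linarith
  then have "\<forall>c\<in>E. Z $$ c = 0" by (simp add: nrm_zero_iff[OF finE])
  then have "Z = 0\<^sub>m n1 n2" using assms(1) by (intro eq_matI) (auto simp: E_def)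
  then show False using assms(2) by simp
qed

lemma frob: "Z \<in> carrier_mat n1 n2 \<Longrightarrow> frob_norm Z = nrm E (($$) Z)"
  unfolding E_def by (rule frob_norm_nrm)

lemma max_norm_bounds:
  assumes Z: "Z \<in> carrier_mat n1 n2"
  shows "max_norm Z \<le> nrm E (($$) Z)" "nrm E (($$) Z) \<le> sqrt N * max_norm Z" "0 \<le> max_norm Z"
proof -
  show "max_norm Z \<le> nrm E (($$) Z)"
    using n abs_le_nrm[OF finE, of _ "($$) Z"] by (intro max_norm_le[OF Z]) (auto simp: E_def)
  have ge: "\<bar>Z $$ c\<bar> \<le> max_norm Z" if "c \<in> E" for c using max_norm_ge[OF Z] that by (simp add: E_def)
  have "(0, 0) \<in> E" using n by (auto simp: E_def)
  from ge[OF this] show "0 \<le> max_norm Z" by linarith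
  then show "nrm E (($$) Z) \<le> sqrt N * max_norm Z"
    using nrm_le_sqrt_card[of E "($$) Z" "max_norm Z"] ge by (simp add: cardE)
qed

lemma spec_norm_bounds:
  assumes Z: "Z \<in> carrier_mat n1 n2"
  shows "spec_norm Z \<le> nrm E (($$) Z)" "nrm E (($$) Z) \<le> sqrt N * spec_norm Z"
proof -
  show "spec_norm Z \<le> nrm E (($$) Z)"
    unfolding E_def by (intro spec_norm_le[OF Z bil_bound_nrm nrm_nonneg])
  have "\<bar>Z $$ c\<bar> \<le> spec_norm Z" if "c \<in> E" for c
    using bil_bound_entry[OF bil_bound_spec_norm[OF Z]] that by (simp add: E_def)
  then show "nrm E (($$) Z) \<le> sqrt N * spec_norm Z"
    using nrm_le_sqrt_card[of E "($$) Z" "spec_norm Z"] spec_norm_nonneg[OF Z] by (simp add: cardE)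
qed

lemma UVt_tangent: "U * transpose_mat V \<in> tangent U V"
  using Pe UVc by (simp add: tangent_iff' e_def)

lemma UVt_nonzero: "U * transpose_mat V \<noteq> 0\<^sub>m n1 n2"
proof
  assume "U * transpose_mat V = 0\<^sub>m n1 n2"
  then have "ip E e e = 0" by (auto simp: e_def ip_def E_def intro!: sum.neutral)
  then show False using nrm_e r by (simp add: nrm_def)
qed

definition "TF = {Z \<in> tangent U V. Z \<noteq> 0\<^sub>m n1 n2 \<and> frob_norm Z \<le> frob_norm (U * transpose_mat V)}"
definition "TI = {Z \<in> tangent U V. Z \<noteq> 0\<^sub>m n1 n2 \<and> max_norm Z \<le> max_norm (U * transpose_mat V)}"
definition "TO = {Z \<in> tangent U V. Z \<noteq> 0\<^sub>m n1 n2 \<and> spec_norm Z \<le> sqrt N * spec_norm (U * transpose_mat V)}"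

text \<open>Here and in the two analogues below, norm comparison gives a crude constant, possibly
  growing with the dimension, that makes the supremum meaningful.\<close>

lemma TF_bounds:
  assumes "Z \<in> TF"
  shows "0 < frob_norm Z" "frob_norm (proj_T U V (P_star C M Z) - Z) \<le> 2 * frob_norm Z"
proof -
  have Z: "Z \<in> carrier_mat n1 n2" "Z \<noteq> 0\<^sub>m n1 n2" using assms by (auto simp: TF_def tangent_iff')
  show "0 < frob_norm Z" using nrm_pos[OF Z] by (simp add: frob[OF Z(1)])
  show "frob_norm (proj_T U V (P_star C M Z) - Z) \<le> 2 * frob_norm Z"
    using residual_nrm_le[of "($$) Z"] residual(2)[OF Z(1)]
    by (simp add: frob[OF Z(1)] frob[OF residual(1)[OF Z(1)]] cong: nrm_cong)
qed

lemma TI_bounds: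
  assumes "Z \<in> TI"
  shows "0 < max_norm Z" "max_norm (proj_T U V (P_star C M Z) - Z) \<le> (2 * sqrt N) * max_norm Z"
proof -
  have Z: "Z \<in> carrier_mat n1 n2" "Z \<noteq> 0\<^sub>m n1 n2" using assms by (auto simp: TI_def tangent_iff')
  show "0 < max_norm Z"
    using nrm_pos[OF Z] max_norm_bounds[OF Z(1)] by (cases "max_norm Z = 0") auto
  have "max_norm (proj_T U V (P_star C M Z) - Z) \<le> nrm E (($$) (proj_T U V (P_star C M Z) - Z))"
    by (rule max_norm_bounds(1)[OF residual(1)[OF Z(1)]])
  also have "\<dots> \<le> 2 * nrm E (($$) Z)"
    using residual_nrm_le[of "($$) Z"] residual(2)[OF Z(1)] by (simp cong: nrm_cong)
  also have "\<dots> \<le> 2 * (sqrt N * max_norm Z)" using max_norm_bounds(2)[OF Z(1)] by simp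
  finally show "max_norm (proj_T U V (P_star C M Z) - Z) \<le> (2 * sqrt N) * max_norm Z" by simp
qed

lemma TO_bounds:
  assumes "Z \<in> TO"
  shows "0 < spec_norm Z" "spec_norm (P_star C M Z - Z) \<le> sqrt N * spec_norm Z"
proof -
  have Z: "Z \<in> carrier_mat n1 n2" "Z \<noteq> 0\<^sub>m n1 n2" using assms by (auto simp: TO_def tangent_iff')
  show "0 < spec_norm Z"
    using nrm_pos[OF Z] spec_norm_bounds[OF Z(1)] spec_norm_nonneg[OF Z(1)] by (cases "spec_norm Z = 0") auto
  have "P_star C M Z - Z \<in> carrier_mat n1 n2" using Z by auto
  then have "spec_norm (P_star C M Z - Z) \<le> nrm E (($$) (P_star C M Z - Z))"
    by (rule spec_norm_bounds(1))
  also have "\<dots> \<le> nrm E (($$) Z)"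
  proof (rule nrm_mono_abs)
    fix c assume c: "c \<in> E"
    then have "(P_star C M Z - Z) $$ c = pstar (($$) Z) c - Z $$ c"
      using Z P_star_index(2)[OF Z(1) c] by (auto simp: E_def)
    then show "\<bar>(P_star C M Z - Z) $$ c\<bar> \<le> \<bar>Z $$ c\<bar>" by (auto simp: pstar_def)
  qed
  also have "\<dots> \<le> sqrt N * spec_norm Z" by (rule spec_norm_bounds(2)[OF Z(1)])
  finally show "spec_norm (P_star C M Z - Z) \<le> sqrt N * spec_norm Z" .
qed

lemma UVt_in: "U * transpose_mat V \<in> TF" "U * transpose_mat V \<in> TI" "U * transpose_mat V \<in> TO"
proof -
  have "1 * spec_norm (U * transpose_mat V) \<le> sqrt N * spec_norm (U * transpose_mat V)"
    using N spec_norm_UVt_ge_1 by (intro mult_right_mono) auto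
  then show "U * transpose_mat V \<in> TF" "U * transpose_mat V \<in> TI" "U * transpose_mat V \<in> TO"
    using UVt_tangent UVt_nonzero by (auto simp: TF_def TI_def TO_def)
qed

lemma rho_F_SUP: "rho_F C M U V = (SUP Z\<in>TF. frob_norm (proj_T U V (P_star C M Z) - Z) / frob_norm Z)"
  by (simp add: rho_F_def TF_def dims)

lemma rho_inf_SUP: "rho_inf C M U V = (SUP Z\<in>TI. max_norm (proj_T U V (P_star C M Z) - Z) / max_norm Z)"
  by (simp add: rho_inf_def TI_def dims)

lemma rho_op_SUP: "rho_op C M U V = sqrt (real r) * joint_coherence U V *
    (SUP Z\<in>TO. spec_norm (P_star C M Z - Z) / spec_norm Z)"
  by (simp add: rho_op_def TO_def dims N_def)

lemma rho_F_nonneg: "0 \<le> rho_F C M U V"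
  unfolding rho_F_SUP
  by (rule SUP_ratio_nonneg[OF UVt_in(1) TF_bounds]) (auto simp: frob[OF residual(1)[OF UVc]] nrm_nonneg)

lemma rho_inf_nonneg: "0 \<le> rho_inf C M U V"
  unfolding rho_inf_SUP
  by (rule SUP_ratio_nonneg[OF UVt_in(2) TI_bounds]) (auto intro: max_norm_bounds(3) residual(1) UVc)

lemma SUP_op_nonneg: "0 \<le> (SUP Z\<in>TO. spec_norm (P_star C M Z - Z) / spec_norm Z)"
proof (rule SUP_ratio_nonneg[OF UVt_in(3) TO_bounds])
  have "P_star C M (U * transpose_mat V) - U * transpose_mat V \<in> carrier_mat n1 n2"
    by (rule minus_carrier_mat[OF UVc])
  then show "0 \<le> spec_norm (P_star C M (U * transpose_mat V) - U * transpose_mat V)"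
    by (rule spec_norm_nonneg)
qed auto

lemma rho_op_nonneg: "0 \<le> rho_op C M U V"
  unfolding rho_op_SUP using SUP_op_nonneg mu1_ge_1 by simp

section \<open>The suprema turned into inequalities for a tangential function on cells\<close>

context
  fixes w :: "nat \<times> nat \<Rightarrow> real"
  assumes Pw: "\<And>c. c \<in> E \<Longrightarrow> P w c = w c"
begin

private definition "Z = Matrix.mat n1 n2 w"

private lemma Zc: "Z \<in> carrier_mat n1 n2" and Ze: "c \<in> E \<Longrightarrow> Z $$ c = w c"
  by (auto simp: Z_def E_def)

private lemma Z_tangent: "Z \<in> tangent U V"
proof -
  have "P (($$) Z) = P w" by (intro P_cong Ze)
  then show ?thesis using Zc Ze Pw by (simp add: tangent_iff')
qed

private lemma pstar_Z: "c \<in> E \<Longrightarrow> pstar (($$) Z) c = pstar w c"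
  by (simp add: pstar_def Ze)

private lemma nrm_Z: "nrm E (($$) Z) = nrm E w"
  by (intro nrm_cong Ze)

text \<open>The zero matrix lies outside the domains of the suprema, but a golfing residual may
  vanish.\<close>

private lemma zero_case:
  assumes "Z = 0\<^sub>m n1 n2" "c \<in> E"
  shows "w c = 0" "P (pstar w) c - w c = 0" "pstar w c = 0"
proof -
  have w0: "w c = 0" if "c \<in> E" for c using Ze[OF that] assms(1) that by (auto simp: E_def)
  then have p0: "pstar w c = 0" if "c \<in> E" for c using that by (simp add: pstar_def)
  have "P (pstar w) = P (\<lambda>_. 0)" by (intro P_cong p0)
  then show "w c = 0" "P (pstar w) c - w c = 0" "pstar w c = 0"
    using w0 p0 assms(2) by (simp_all add: P_def app_def)
qed

lemma rho_F_bound: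
  assumes "nrm E w \<le> sqrt (real r)"
  shows "nrm E (\<lambda>c. P (pstar w) c - w c) \<le> rho_F C M U V * nrm E w"
proof (cases "Z = 0\<^sub>m n1 n2")
  case True
  have "nrm E (\<lambda>c. P (pstar w) c - w c) = nrm E (\<lambda>c. 0)" by (intro nrm_cong zero_case(2)[OF True])
  then show ?thesis using rho_F_nonneg nrm_nonneg[of E w] by (simp add: nrm_def ip_def)
next
  case False
  then have "Z \<in> TF"
    using assms Z_tangent frob[OF UVc] nrm_e by (simp add: TF_def frob[OF Zc] nrm_Z e_def)
  from SUP_ratio_bound[OF this TF_bounds]
  have "frob_norm (proj_T U V (P_star C M Z) - Z) \<le> rho_F C M U V * frob_norm Z"
    unfolding rho_F_SUP .
  moreover have "frob_norm (proj_T U V (P_star C M Z) - Z) = nrm E (\<lambda>c. P (pstar w) c - w c)"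
    unfolding frob[OF residual(1)[OF Zc]]
    using P_cong[of "pstar (($$) Z)" "pstar w"] pstar_Z by (intro nrm_cong) (simp add: residual(2)[OF Zc] Ze)
  ultimately show ?thesis by (simp add: frob[OF Zc] nrm_Z)
qed

lemma rho_inf_bound:
  assumes w: "\<And>c. c \<in> E \<Longrightarrow> \<bar>w c\<bar> \<le> z" and z: "z \<le> m0" and c: "c \<in> E"
  shows "\<bar>P (pstar w) c - w c\<bar> \<le> rho_inf C M U V * z"
proof (cases "Z = 0\<^sub>m n1 n2")
  case True
  then show ?thesis using zero_case[OF True c] rho_inf_nonneg w[OF c] by simp
next
  case False
  have mz: "max_norm Z \<le> z"
    using w Ze n by (intro max_norm_le[OF Zc]) (auto simp: E_def)
  then have "Z \<in> TI" using False Z_tangent z by (simp add: TI_def m0_def)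
  from SUP_ratio_bound[OF this TI_bounds]
  have "max_norm (proj_T U V (P_star C M Z) - Z) \<le> rho_inf C M U V * max_norm Z"
    unfolding rho_inf_SUP .
  also have "\<dots> \<le> rho_inf C M U V * z" using mz rho_inf_nonneg by (intro mult_left_mono)
  finally have "max_norm (proj_T U V (P_star C M Z) - Z) \<le> rho_inf C M U V * z" .
  moreover have "\<bar>(proj_T U V (P_star C M Z) - Z) $$ c\<bar> \<le> max_norm (proj_T U V (P_star C M Z) - Z)"
    using c by (intro max_norm_ge[OF residual(1)[OF Zc]]) (simp add: E_def)
  moreover have "(proj_T U V (P_star C M Z) - Z) $$ c = P (pstar w) c - w c"
    using P_cong[of "pstar (($$) Z)" "pstar w"] pstar_Z c by (simp add: residual(2)[OF Zc] Ze)
  ultimately show ?thesis by simp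
qed

text \<open>The prefactor \<open>sqrt r * mu_1\<close> of \<open>rho_op\<close> is consumed here:
  the spectral norm of \<open>w\<close> is at most its Frobenius norm, hence at most
  \<open>sqrt N * m0 * t\<close>, which is \<open>sqrt r * mu_1 * t\<close>. Decay of the maximum
  norm thus becomes decay in spectral norm.\<close>

lemma rho_op_bound:
  assumes w: "\<And>c. c \<in> E \<Longrightarrow> \<bar>w c\<bar> \<le> m0 * t" and t: "0 \<le> t" and nw: "nrm E w \<le> sqrt (real r)"
  shows "bil_bound n1 n2 (\<lambda>c. pstar w c - w c) (rho_op C M U V * t)"
proof (cases "Z = 0\<^sub>m n1 n2")
  case True
  have "bil_bound n1 n2 (\<lambda>c. pstar w c - w c) 0 \<longleftrightarrow> bil_bound n1 n2 (\<lambda>c. 0) 0"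
    using zero_case[OF True] by (intro bil_bound_cong) (simp add: E_def)
  then have "bil_bound n1 n2 (\<lambda>c. pstar w c - w c) 0" by (simp add: bil_bound_def)
  then show ?thesis by (rule bil_bound_mono) (simp add: rho_op_nonneg t)
next
  case False
  define sp where "sp = (SUP Z\<in>TO. spec_norm (P_star C M Z - Z) / spec_norm Z)"
  \<comment> \<open>Membership in the domain: spectral norm below Frobenius norm, and the latter at
    most \<open>sqrt r \<le> sqrt N\<close>.\<close>
  have "spec_norm Z \<le> sqrt N * 1"
    using spec_norm_bounds(1)[OF Zc] nw r_le by (simp add: nrm_Z) (meson order_trans real_sqrt_le_mono)
  also have "\<dots> \<le> sqrt N * spec_norm (U * transpose_mat V)"
    using N spec_norm_UVt_ge_1 by (intro mult_left_mono) auto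
  finally have "Z \<in> TO" using False Z_tangent by (simp add: TO_def)
  from SUP_ratio_bound[OF this TO_bounds]
  have *: "spec_norm (P_star C M Z - Z) \<le> sp * spec_norm Z" unfolding sp_def .
  have "spec_norm Z \<le> nrm E w" using spec_norm_bounds(1)[OF Zc] by (simp add: nrm_Z)
  also have "\<dots> \<le> sqrt N * (m0 * t)"
    using nrm_le_sqrt_card[of E w "m0 * t"] w m0_nonneg t by (simp add: cardE)
  also have "\<dots> = sqrt (real r) * joint_coherence U V * t" by (simp add: mu1 flip: mult.assoc)
  finally have "sp * spec_norm Z \<le> sp * (sqrt (real r) * joint_coherence U V * t)"
    using SUP_op_nonneg by (intro mult_left_mono) (auto simp: sp_def)
  also have "\<dots> = rho_op C M U V * t" by (simp add: rho_op_SUP sp_def)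
  finally have "spec_norm (P_star C M Z - Z) \<le> rho_op C M U V * t" using * by linarith
  moreover have "P_star C M Z - Z \<in> carrier_mat n1 n2" using Zc by auto
  ultimately have "bil_bound n1 n2 (($$) (P_star C M Z - Z)) (rho_op C M U V * t)"
    using bil_bound_mono[OF bil_bound_spec_norm] by blast
  also have "bil_bound n1 n2 (($$) (P_star C M Z - Z)) (rho_op C M U V * t) \<longleftrightarrow>
      bil_bound n1 n2 (\<lambda>c. pstar w c - w c) (rho_op C M U V * t)"
  proof (rule bil_bound_cong)
    fix c assume "c \<in> cells n1 n2"
    then have c: "c \<in> E" by (simp add: E_def)
    then show "(P_star C M Z - Z) $$ c = pstar w c - w c"
      using Zc P_star_index(2)[OF Zc c] pstar_Z[OF c] Ze[OF c] by (auto simp: E_def)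
  qed
  finally show ?thesis .
qed

end

definition "below = {c. M $$ c < C}"

lemma nu_B_bound:
  "nrm E (\<lambda>c. P (\<lambda>c. of_bool (c \<in> below) * P z c) c - P z c) \<le> nu_B C M U V * nrm E z"
  and nu_B_nonneg: "0 \<le> nu_B C M U V"
proof -
  define L where "L Z = proj_T U V (proj_entries (below_ceiling C M) (proj_T U V Z)) - proj_T U V Z" for Z
  define l where "l z c = P (\<lambda>c. of_bool (c \<in> below) * P z c) c - P z c" for z c
  define A where "A = {Z \<in> carrier_mat n1 n2. frob_norm Z \<le> 1}"
  have Lf: "frob_norm (L Z) = nrm E (l (($$) Z))" if Z: "Z \<in> carrier_mat n1 n2" for Z
  proof -
    define B where "B = proj_entries (below_ceiling C M) (proj_T U V Z)"
    have Tc: "proj_T U V Z \<in> carrier_mat n1 n2" by (rule proj_T_index(1)[OF Z])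
    have Bc: "B \<in> carrier_mat n1 n2" using Tc by (auto simp: B_def proj_entries_def)
    have Be: "B $$ c = of_bool (c \<in> below) * P (($$) Z) c" if "c \<in> E" for c
      using that Tc proj_T_index(2)[OF Z that]
      by (auto simp: B_def proj_entries_def below_ceiling_def below_def dims E_def)
    have PB: "P (($$) B) = P (\<lambda>c. of_bool (c \<in> below) * P (($$) Z) c)" by (intro P_cong Be)
    have Lc: "L Z \<in> carrier_mat n1 n2" using Tc by (auto simp: L_def)
    have "L Z $$ c = l (($$) Z) c" if c: "c \<in> E" for c
      using c Tc proj_T_index(2)[OF Bc c] proj_T_index(2)[OF Z c] proj_T_index(1)[OF Bc]
      by (auto simp: L_def l_def PB E_def B_def[symmetric])
    then show ?thesis unfolding frob[OF Lc] by (rule nrm_cong)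
  qed
  have l_le: "nrm E (l z) \<le> 2 * nrm E z" for z
  proof -
    have "nrm E (\<lambda>c. P (\<lambda>c. of_bool (c \<in> below) * P z c) c + (- 1) * P z c) \<le>
        nrm E (P (\<lambda>c. of_bool (c \<in> below) * P z c)) + nrm E (\<lambda>c. (- 1) * P z c)"
      by (rule nrm_triangle)
    also have "\<dots> \<le> nrm E (P z) + nrm E (P z)"
      unfolding nrm_scale
      using P_contraction[of "\<lambda>c. of_bool (c \<in> below) * P z c"]
        nrm_mono_abs[of E "\<lambda>c. of_bool (c \<in> below) * P z c" "P z"] by fastforce
    finally show ?thesis using P_contraction[of z] by (simp add: l_def[abs_def])
  qed
  have bdd: "bdd_above ((\<lambda>Z. frob_norm (L Z)) ` A)"
  proof (intro bdd_aboveI2)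
    fix Z assume Z: "Z \<in> A"
    then show "frob_norm (L Z) \<le> 2" using l_le[of "($$) Z"] Lf frob by (auto simp: A_def)
  qed
  have nu: "nu_B C M U V = (SUP Z\<in>A. frob_norm (L Z))"
    by (simp add: nu_B_def operator_norm_def A_def L_def dims)
  have up: "frob_norm (L Z) \<le> nu_B C M U V" if "Z \<in> A" for Z
    unfolding nu using that bdd by (intro cSUP_upper)
  have "0\<^sub>m n1 n2 \<in> A" by (simp add: A_def frob_norm_def mat_inner_def)
  from up[OF this] show nn: "0 \<le> nu_B C M U V"
    using Lf[of "0\<^sub>m n1 n2"] nrm_nonneg by (metis order_trans zero_carrier_mat)
  have "nrm E (l z) \<le> nu_B C M U V * nrm E z"
  proof (cases "nrm E z = 0")
    case True
    then show ?thesis using l_le[of z] by simp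
  next
    case False
    define t where "t = nrm E z"
    have t: "0 < t" using False nrm_nonneg[of E z] by (simp add: t_def)
    define Z where "Z = Matrix.mat n1 n2 (\<lambda>c. (1 / t) * z c)"
    have Zc: "Z \<in> carrier_mat n1 n2" by (simp add: Z_def)
    have Ze: "Z $$ c = (1 / t) * z c" if "c \<in> E" for c using that by (auto simp: Z_def E_def)
    have "nrm E (($$) Z) = nrm E (\<lambda>c. (1 / t) * z c)" by (intro nrm_cong Ze)
    also have "\<dots> = 1" unfolding nrm_scale using t by (simp add: t_def)
    finally have "Z \<in> A" using Zc by (simp add: A_def frob[OF Zc])
    from up[OF this] have "nrm E (l (($$) Z)) \<le> nu_B C M U V" by (simp add: Lf[OF Zc])
    moreover have "l (($$) Z) = (\<lambda>c. (1 / t) * l z c)"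
    proof -
      have PZ: "P (($$) Z) = (\<lambda>c. (1 / t) * P z c)"
        using P_cong[of "($$) Z" "\<lambda>c. (1 / t) * z c", OF Ze] unfolding P_def app_scale .
      have "P (\<lambda>c. of_bool (c \<in> below) * ((1 / t) * P z c)) = P (\<lambda>c. (1 / t) * (of_bool (c \<in> below) * P z c))"
        by (intro P_cong) simp
      also have "\<dots> = (\<lambda>c. (1 / t) * P (\<lambda>c. of_bool (c \<in> below) * P z c) c)"
        unfolding P_def app_scale ..
      finally show ?thesis by (simp only: l_def[abs_def] PZ right_diff_distrib)
    qed
    ultimately have "(1 / t) * nrm E (l z) \<le> nu_B C M U V" using t by (simp only: nrm_scale) simp
    then show ?thesis using t by (simp add: t_def[symmetric] field_simps)
  qed
  then show "nrm E (\<lambda>c. P (\<lambda>c. of_bool (c \<in> below) * P z c) c - P z c) \<le> nu_B C M U V * nrm E z"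
    by (simp add: l_def[abs_def])
qed

end

section \<open>The golfing scheme\<close>

context clipped_completion
begin

abbreviation "tk \<equiv> tan_kernel U V"

text \<open>\<open>golf q \<xi> k\<close> is the residual \<open>U V\<^sup>T - P y\<close> of the certificate built from rounds \<open>1..k\<close>; it depends
  only on these rounds, hence is independent of the sample of round \<open>k + 1\<close>.\<close>

primrec golf :: "real \<Rightarrow> (nat \<times> nat \<times> nat \<Rightarrow> bool) \<Rightarrow> nat \<Rightarrow> nat \<times> nat \<Rightarrow> real" where
  "golf q \<xi> 0 = e"
| "golf q \<xi> (Suc k) = (\<lambda>c. golf q \<xi> k c - P (\<lambda>c. of_bool (\<xi> (Suc k, c)) / q * pstar (golf q \<xi> k) c) c)"

lemma golf_cong:
  assumes "\<And>l c. l \<le> k \<Longrightarrow> \<xi> (l, c) = \<xi>' (l, c)"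
  shows "golf q \<xi> k = golf q \<xi>' k"
  using assms by (induction k) auto

lemma P_golf: "c \<in> E \<Longrightarrow> P (golf q \<xi> k) c = golf q \<xi> k c"
  by (induction k) (simp_all add: Pe P_diff PP)

text \<open>The thresholds are what the expected step leaves over: adding the matching
  \<open>rho\<close> gives a factor \<open>1/2\<close> in Frobenius and maximum norm and
  \<open>1/4\<close> in spectral norm. \<open>t\<close> is the scale that \<open>w\<close> is
  supposed to have.\<close>

definition good_round :: "real \<Rightarrow> (nat \<times> nat \<Rightarrow> real) \<Rightarrow> real \<Rightarrow> (nat \<times> nat \<Rightarrow> bool) \<Rightarrow> bool" where
  "good_round q w t \<xi> \<longleftrightarrow>
     frob_event E tk q (keep w) (1 / 2 - rho_F C M U V) \<xi> \<and>
     max_event E tk q (pstar w) ((1 / 2 - rho_inf C M U V) * (m0 * t)) \<xi> \<and>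
     spec_event n1 n2 q (pstar w) ((1 / 4 - rho_op C M U V) * t) \<xi>"

lemma frob_event_apply:
  assumes ev: "frob_event E tk q B s \<xi>" and s: "0 \<le> s" and Pw: "\<And>c. c \<in> E \<Longrightarrow> P w c = w c"
  shows "nrm E (P (\<lambda>c. (of_bool (\<xi> c) / q - 1) * (of_bool (c \<in> B) * w c))) \<le> s * nrm E w"
proof -
  define d where "d c = (of_bool (\<xi> c) / q - 1) * (of_bool (c \<in> B) * w c)" for c
  define x where "x = P d"
  have Px: "P x c = x c" if "c \<in> E" for c using PP[OF that] by (simp add: x_def)
  have "(nrm E x)\<^sup>2 = ip E (P d) x" by (simp add: nrm_square x_def)
  also have "\<dots> = ip E d (P x)" by (rule P_sym)
  also have "\<dots> = (\<Sum>c\<in>E. (of_bool (\<xi> c) / q - 1) * of_bool (c \<in> B) * P x c * P w c)"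
    unfolding ip_def by (intro sum.cong refl) (simp add: d_def Pw)
  also have "\<dots> \<le> s * nrm E x * nrm E w"
    using ev unfolding frob_event_def P_def by (meson abs_le_D1)
  finally have "nrm E x * nrm E x \<le> nrm E x * (s * nrm E w)" by (simp add: power2_eq_square algebra_simps)
  then have "nrm E x \<le> s * nrm E w"
    using nrm_nonneg[of E x] nrm_nonneg[of E w] s by (cases "nrm E x = 0") auto
  then show ?thesis by (simp add: x_def d_def[abs_def])
qed

lemma good_round_step:
  assumes Pw: "\<And>c. c \<in> E \<Longrightarrow> P w c = w c" and q: "0 < q" and t: "0 \<le> t" "t \<le> 1"
    and nw: "nrm E w \<le> sqrt (real r) * t" and iw: "\<And>c. c \<in> E \<Longrightarrow> \<bar>w c\<bar> \<le> m0 * t"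
    and ev: "good_round q w t \<xi>"
    and rho: "rho_F C M U V < 1 / 2"
  defines "w' \<equiv> \<lambda>c. w c - P (\<lambda>c. of_bool (\<xi> c) / q * pstar w c) c"
  shows "nrm E w' \<le> sqrt (real r) * (t / 2)" and "\<And>c. c \<in> E \<Longrightarrow> \<bar>w' c\<bar> \<le> m0 * (t / 2)"
    and "bil_bound n1 n2 (\<lambda>c. of_bool (\<xi> c) / q * pstar w c - w c) (t / 4)"
\<comment> \<open>\<open>d\<close> is the centered sampling noise. The new residual is, up to sign,
  the expected step error plus the projected noise, and each norm is bounded on these two
  parts.\<close>
proof -
  define d where "d c = (of_bool (\<xi> c) / q - 1) * pstar w c" for c
  have "P (\<lambda>c. of_bool (\<xi> c) / q * pstar w c) = P (\<lambda>c. d c + pstar w c)"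
    by (intro P_cong) (simp add: d_def algebra_simps)
  then have w': "w' c = (- 1) * ((P (pstar w) c - w c) + P d c)" for c
    by (simp add: w'_def P_add)
  have nr: "nrm E w \<le> sqrt (real r)"
    using nw mult_left_mono[OF t(2), of "sqrt (real r)"] by simp
  have d: "d = (\<lambda>c. (of_bool (\<xi> c) / q - 1) * (of_bool (c \<in> keep w) * w c))"
    by (simp add: fun_eq_iff d_def pstar_keep)
  have "nrm E (P d) \<le> (1 / 2 - rho_F C M U V) * nrm E w"
    unfolding d using ev rho by (intro frob_event_apply Pw) (auto simp: good_round_def)
  then have "nrm E (\<lambda>c. P (pstar w) c - w c) + nrm E (P d) \<le> 1 / 2 * nrm E w"
    using rho_F_bound[OF Pw nr] by (simp add: algebra_simps)
  moreover have "nrm E w' \<le> nrm E (\<lambda>c. P (pstar w) c - w c) + nrm E (P d)"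
    unfolding w'[abs_def] nrm_scale using nrm_triangle[of E "\<lambda>c. P (pstar w) c - w c" "P d"] by simp
  ultimately show "nrm E w' \<le> sqrt (real r) * (t / 2)" using nw by simp
  show "\<bar>w' c\<bar> \<le> m0 * (t / 2)" if c: "c \<in> E" for c
  proof -
    have "m0 * t \<le> m0" using mult_left_mono[OF t(2) m0_nonneg] by simp
    then have "\<bar>P (pstar w) c - w c\<bar> \<le> rho_inf C M U V * (m0 * t)"
      using rho_inf_bound[OF Pw iw _ c] by blast
    moreover have "P d c = (\<Sum>b\<in>E. (of_bool (\<xi> b) / q - 1) * (pstar w b * tk b c))"
      unfolding P_def app_def d_def using proj_kernelD(1)[OF G c]
      by (intro sum.cong refl) (simp add: algebra_simps)
    then have "\<bar>P d c\<bar> \<le> (1 / 2 - rho_inf C M U V) * (m0 * t)"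
      using ev c by (simp add: good_round_def max_event_def)
    ultimately have "\<bar>P (pstar w) c - w c\<bar> + \<bar>P d c\<bar> \<le> m0 * (t / 2)" by (simp add: algebra_simps)
    then show ?thesis unfolding w' by (smt (verit))
  qed
  have "bil_bound n1 n2 d ((1 / 4 - rho_op C M U V) * t)"
    using ev by (simp add: good_round_def spec_event_def bil_bound_def d_def)
  from bil_bound_add[OF this rho_op_bound[OF Pw iw t(1) nr]]
  show "bil_bound n1 n2 (\<lambda>c. of_bool (\<xi> c) / q * pstar w c - w c) (t / 4)"
    by (simp add: d_def algebra_simps)
qed

lemma golf_bounds:
  assumes q: "0 < q" and rho: "rho_F C M U V < 1 / 2"
    and good: "\<And>k. k < k0 \<Longrightarrow> good_round q (golf q \<xi> k) (1 / 2 ^ k) (\<lambda>c. \<xi> (Suc k, c))"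
  shows "k \<le> k0 \<Longrightarrow> nrm E (golf q \<xi> k) \<le> sqrt (real r) * (1 / 2 ^ k) \<and>
    (\<forall>c\<in>E. \<bar>golf q \<xi> k c\<bar> \<le> m0 * (1 / 2 ^ k))"
proof (induction k)
  case 0
  then show ?case using e_le_m0 by (simp add: nrm_e)
next
  case (Suc k)
  have t: "(0::real) \<le> 1 / 2 ^ k" "1 / 2 ^ k \<le> (1::real)" by simp_all
  from good_round_step[OF P_golf q t _ _ good[of k] rho] Suc show ?case by (simp add: mult.commute)
qed

text \<open>On sampled uncensored cells \<open>h\<close> vanishes, so there \<open>P h\<close> is
  minus the normal part of \<open>h\<close>; the reweighted sampled energy of \<open>P h\<close> is
  thus at most \<open>1 / q\<close> times the squared norm of that normal part. The same energy is
  at least half the squared norm of \<open>P h\<close>: \<open>nu_B\<close> bounds the expected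
  loss, and the event bounds the deviation by the rest of \<open>1/2\<close>.\<close>

lemma sampled_injective:
  assumes q: "0 < q" and nu: "nu_B C M U V < 1 / 2"
    and ev: "frob_event E tk q below (1 / 2 - nu_B C M U V) \<xi>"
    and h: "\<And>c. c \<in> E \<Longrightarrow> \<xi> c \<Longrightarrow> M $$ c < C \<Longrightarrow> h c = 0"
  shows "nrm E (P h) \<le> sqrt (2 / q) * nrm E (\<lambda>c. h c - P h c)"
proof -
  define u where "u = P h"
  define v where "v c = h c - P h c" for c
  have Pu: "P u c = u c" if "c \<in> E" for c using PP[OF that] by (simp add: u_def)
  define A where "A = (\<Sum>c\<in>E. of_bool (\<xi> c) / q * of_bool (c \<in> below) * (u c)\<^sup>2)"
  define B where "B = (\<Sum>c\<in>E. of_bool (c \<in> below) * (u c)\<^sup>2)"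
  have "A \<le> (\<Sum>c\<in>E. 1 / q * (v c)\<^sup>2)"
    unfolding A_def
  proof (intro sum_mono)
    fix c assume c: "c \<in> E"
    show "of_bool (\<xi> c) / q * of_bool (c \<in> below) * (u c)\<^sup>2 \<le> 1 / q * (v c)\<^sup>2"
    proof (cases "\<xi> c \<and> c \<in> below")
      case True
      then have "v c = - u c" using h[OF c] by (simp add: below_def v_def u_def)
      then show ?thesis using True by simp
    qed (use q in auto)
  qed
  also have "\<dots> = 1 / q * (nrm E v)\<^sup>2" unfolding nrm_square ip_self by (rule sum_distrib_left[symmetric])
  finally have A_le: "A \<le> 1 / q * (nrm E v)\<^sup>2" .
  have "\<bar>\<Sum>c\<in>E. (of_bool (\<xi> c) / q - 1) * of_bool (c \<in> below) * P u c * P u c\<bar>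
      \<le> (1 / 2 - nu_B C M U V) * nrm E u * nrm E u"
    using ev unfolding frob_event_def P_def by blast
  moreover have "(\<Sum>c\<in>E. (of_bool (\<xi> c) / q - 1) * of_bool (c \<in> below) * P u c * P u c) = A - B"
    unfolding A_def B_def sum_subtractf[symmetric]
    by (intro sum.cong refl) (simp add: Pu power2_eq_square algebra_simps)
  ultimately have AB: "B - A \<le> (1 / 2 - nu_B C M U V) * (nrm E u)\<^sup>2" by (simp add: power2_eq_square)
  let ?m = "\<lambda>c. of_bool (c \<in> below) * P u c"
  have "ip E u (P ?m) = ip E (P u) ?m" by (rule P_sym[symmetric])
  also have "\<dots> = B" unfolding ip_def B_def by (intro sum.cong refl) (simp add: Pu power2_eq_square)
  finally have "ip E u (\<lambda>c. P ?m c - P u c) = B - ip E u (P u)" by (simp add: ip_linear)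
  also have "ip E u (P u) = (nrm E u)\<^sup>2" unfolding nrm_square by (intro ip_cong) (auto simp: Pu)
  finally have "(nrm E u)\<^sup>2 - B \<le> \<bar>ip E u (\<lambda>c. P ?m c - P u c)\<bar>" by simp
  also have "\<dots> \<le> nrm E u * nrm E (\<lambda>c. P ?m c - P u c)" by (rule abs_ip_le)
  also have "\<dots> \<le> nrm E u * (nu_B C M U V * nrm E u)"
    by (intro mult_left_mono nu_B_bound nrm_nonneg)
  finally have "(nrm E u)\<^sup>2 - B \<le> nu_B C M U V * (nrm E u)\<^sup>2" by (simp add: power2_eq_square algebra_simps)
  then have "(nrm E u)\<^sup>2 \<le> 2 / q * (nrm E v)\<^sup>2" using AB A_le by (simp add: algebra_simps)
  then have "sqrt ((nrm E u)\<^sup>2) \<le> sqrt (2 / q * (nrm E v)\<^sup>2)" by (rule real_sqrt_le_mono)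
  then show ?thesis
    using nrm_nonneg[of E u] nrm_nonneg[of E v] unfolding real_sqrt_mult real_sqrt_abs
    by (simp add: u_def v_def[abs_def])
qed

lemma golf_success:
  assumes q: "0 < q" "1 / N \<le> q" and k0: "0 < k0" "2 * sqrt 2 * sqrt (N * real r) \<le> 2 ^ k0"
    and rho: "rho_F C M U V < 1 / 2" and nu: "nu_B C M U V < 1 / 2"
    and good: "\<And>k. k < k0 \<Longrightarrow> good_round q (golf q \<xi> k) (1 / 2 ^ k) (\<lambda>c. \<xi> (Suc k, c))"
    and ev: "frob_event E tk q below (1 / 2 - nu_B C M U V) (\<lambda>c. \<xi> (1, c))"
  shows "solutions C M (\<Union>k\<in>{1..k0}. {(i, j). i < n1 \<and> j < n2 \<and> \<xi> (k, i, j)}) = {M}"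
proof -
  define Om where "Om = (\<Union>k\<in>{1..k0}. {(i, j). i < n1 \<and> j < n2 \<and> \<xi> (k, i, j)})"
  have Om: "c \<in> Om \<longleftrightarrow> c \<in> E \<and> (\<exists>k<k0. \<xi> (Suc k, c))" for c
    unfolding Om_def image_Suc_lessThan[symmetric] by (cases c) (auto simp: E_def)
  define W where "W = golf q \<xi>"
  define Y where "Y k c = of_bool (\<xi> (Suc k, c)) / q * pstar (W k) c" for k c
  define y where "y c = (\<Sum>k<k0. Y k c)" for c
  have WS: "W (Suc k) c = W k c - P (Y k) c" for k c by (simp add: W_def Y_def[abs_def])
  have bounds: "nrm E (W k) \<le> sqrt (real r) * (1 / 2 ^ k)" "\<And>c. c \<in> E \<Longrightarrow> \<bar>W k c\<bar> \<le> m0 * (1 / 2 ^ k)"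
    if "k \<le> k0" for k
    using golf_bounds[OF q(1) rho good that] by (auto simp: W_def)
  have res: "W k c = e c - (\<Sum>l<k. P (Y l) c)" for k c
  proof (induction k)
    case 0
    then show ?case by (simp add: W_def)
  next
    case (Suc k)
    then show ?case by (simp add: WS)
  qed
  have Py: "P y c = (\<Sum>k<k0. P (Y k) c)" for c
    unfolding y_def[abs_def] by (rule P_sum)
  have PW: "P (W k) c = W k c" if "c \<in> E" for k c unfolding W_def using that by (rule P_golf)
  have geom: "(\<Sum>k<k0. (1 / 2 ^ k) / 4) < (1 / 2 :: real)"
  proof -
    have "(\<Sum>k<k0. (1 / 2 ^ k) / 4) = 1 / 2 - 1 / 2 / (2 :: real) ^ k0" for k0 :: nat
      by (induction k0) (simp_all add: field_simps)
    then show ?thesis by simp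
  qed
  have "solutions C M Om = {M}"
  proof (rule solutions_unique[OF M svd, where y = y and a = "sqrt (real r) * (1 / 2 ^ k0)"
        and b = "sqrt (2 / q)" and s = "\<Sum>k<k0. (1 / 2 ^ k) / 4" and tau = tau, folded E_def, folded P_def])
    show "Om \<subseteq> E" using Om by blast
    show "proj_kernel E tk tau" by (rule G)
    show "c \<in> Om \<and> M $$ c \<le> C" if c: "c \<in> E" and y0: "y c \<noteq> 0" for c
    proof -
      obtain k where k: "k < k0" "Y k c \<noteq> 0" using y0 by (auto simp: y_def elim: sum.not_neutral_contains_not_neutral)
      then have "\<xi> (Suc k, c)" "pstar (W k) c \<noteq> 0" by (auto simp: Y_def)
      then show ?thesis using k c Om by (auto simp: pstar_def split: if_splits)
    qed
    show "0 \<le> y c" if "c \<in> E" "M $$ c = C" for c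
      unfolding y_def Y_def using that q by (intro sum_nonneg mult_nonneg_nonneg) (auto simp: pstar_def)
    show "nrm E (\<lambda>c. (U * transpose_mat V) $$ c - P y c) \<le> sqrt (real r) * (1 / 2 ^ k0)"
    proof -
      have "(\<lambda>c. (U * transpose_mat V) $$ c - P y c) = W k0"
        by (simp add: fun_eq_iff res Py e_def)
      then show ?thesis using bounds(1)[of k0] by simp
    qed
    show "nrm E (P h) \<le> sqrt (2 / q) * nrm E (\<lambda>c. h c - P h c)"
      if h: "\<And>c. c \<in> Om \<Longrightarrow> M $$ c < C \<Longrightarrow> h c = 0" for h
    proof (rule sampled_injective[OF q(1) nu ev])
      fix c assume "c \<in> E" "\<xi> (1, c)" "M $$ c < C"
      then show "h c = 0" using h[of c] Om k0(1) by auto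
    qed
    \<comment> \<open>The number of rounds is tailored to this inequality:
      \<open>q \<ge> 1 / N\<close> bounds the injectivity factor by
      \<open>sqrt (2 * N)\<close>.\<close>
    show "sqrt (real r) * (1 / 2 ^ k0) * sqrt (2 / q) \<le> 1 / 2"
    proof -
      have "2 / q \<le> 2 * N" using q N by (simp add: field_simps)
      then have "sqrt (2 / q) \<le> sqrt (2 * N)" by (rule real_sqrt_le_mono)
      then have "sqrt (real r) * (1 / 2 ^ k0) * sqrt (2 / q) \<le> sqrt (real r) * (1 / 2 ^ k0) * sqrt (2 * N)"
        by (intro mult_left_mono) auto
      also have "\<dots> = (2 * sqrt 2 * sqrt (N * real r)) / 2 ^ k0 / 2" by (simp add: real_sqrt_mult)
      also have "\<dots> \<le> 1 / 2" using k0(2) by (simp add: field_simps)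
      finally show ?thesis .
    qed
    show "(\<Sum>k<k0. (1 / 2 ^ k) / 4) < (1 / 2 :: real)" by (rule geom)
    show "bil_bound n1 n2 (\<lambda>c. y c - P y c) (\<Sum>k<k0. (1 / 2 ^ k) / 4)"
    proof -
      \<comment> \<open>Subtracting the tangential \<open>W k\<close> leaves the normal part of
        \<open>Y k\<close> unchanged, and the spectral bound of a good round is for this difference.
        The telescoping costs sum to less than \<open>1/2\<close>.\<close>
      define R where "R k c = Y k c - W k c" for k c
      have "bil_bound n1 n2 (\<lambda>c. R k c - P (R k) c) ((1 / 2 ^ k) / 4)" if k: "k < k0" for k
      proof -
        have t: "(0::real) \<le> 1 / 2 ^ k" "1 / 2 ^ k \<le> (1::real)" by simp_all
        have "bil_bound n1 n2 (R k) ((1 / 2 ^ k) / 4)"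
          using good_round_step(3)[OF P_golf q(1) t bounds[unfolded W_def, of k] good[OF k] rho] k
          by (simp add: R_def[abs_def] Y_def W_def)
        from bil_bound_tan_complement[OF U V this] show ?thesis by (simp add: P_def E_def)
      qed
      then have "bil_bound n1 n2 (\<lambda>c. \<Sum>k<k0. R k c - P (R k) c) (\<Sum>k<k0. (1 / 2 ^ k) / 4)"
        by (intro bil_bound_sum) auto
      also have "?this \<longleftrightarrow> ?thesis"
      proof (rule bil_bound_cong)
        fix c assume "c \<in> cells n1 n2"
        then have c: "c \<in> E" by (simp add: E_def)
        have "R k c - P (R k) c = Y k c - P (Y k) c" for k
          using PW[OF c, of k] by (simp add: R_def[abs_def] P_diff)
        then show "(\<Sum>k<k0. R k c - P (R k) c) = y c - P y c"
          by (simp add: y_def Py sum_subtractf)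
      qed
      finally show ?thesis .
    qed
  qed
  then show ?thesis by (simp add: Om_def)
qed

end

section \<open>Probability of exact recovery\<close>

lemma bern_one: "finite E \<Longrightarrow> bern E 1 = return_pmf (\<lambda>c. c \<in> E)"
proof -
  assume E: "finite E"
  have "bernoulli_pmf 1 = return_pmf True"
    by (rule pmf_eqI) (auto simp: pmf_return split: split_indicator elim: bool.exhaust)
  then show ?thesis using E by (simp add: bern_def if_distrib)
qed

text \<open>Since \<open>r \<le> N\<close>, the argument of the logarithm is at most
  \<open>4 * N\<close>. With \<open>ln 2 \<ge> 2 / 3\<close> and one unit for the ceiling, the count
  is at most \<open>3 + 3/2 * ln N\<close>, and \<open>ln N \<ge> 4 / 3\<close> absorbs the
  constant.\<close>

lemma rounds_bounds:
  assumes X: "4 \<le> N" "1 \<le> r" "real r \<le> N" "N = real n1 * real n2"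
  shows "0 < rounds n1 n2 r" and "2 * sqrt 2 * sqrt (N * real r) \<le> 2 ^ rounds n1 n2 r"
    and "real (rounds n1 n2 r) \<le> 4 * ln N" and "4 / 3 \<le> ln N"
proof -
  define x where "x = 2 * sqrt 2 * sqrt (N * real r)"
  have k: "rounds n1 n2 r = nat \<lceil>log 2 x\<rceil>" using X by (simp add: rounds_def x_def)
  have "1 * 1 \<le> N * real r" using X by (intro mult_mono) auto
  then have "1 \<le> sqrt (N * real r)" by simp
  then have "2 * 1 * 1 \<le> x" unfolding x_def by (intro mult_mono) auto
  then have x: "2 \<le> x" by simp
  have lx: "1 \<le> log 2 x" using x by (subst le_log_iff) auto
  then show "0 < rounds n1 n2 r" unfolding k by linarith
  have "x = 2 powr (log 2 x)" using x by simp
  also have "\<dots> \<le> 2 powr (real (rounds n1 n2 r))" unfolding k by (intro powr_mono) linarith+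
  finally show "x \<le> 2 ^ rounds n1 n2 r" by (simp add: powr_realpow)
  have l2: "2 / 3 \<le> ln (2::real)" by (rule ln2_ge_two_thirds)
  have "2 * ln 2 = ln (4::real)" using ln_realpow[of 2 2] by simp
  also have "\<dots> \<le> ln N" using X by simp
  finally show L: "4 / 3 \<le> ln N" using l2 by linarith
  have "sqrt (N * real r) \<le> sqrt (N * N)" using X by (intro real_sqrt_le_mono mult_left_mono) auto
  then have "sqrt (N * real r) \<le> N" using X by simp
  moreover have "2 * sqrt 2 \<le> (4::real)" using sqrt2_less_2 by simp
  ultimately have "x \<le> 4 * N" unfolding x_def using X by (intro mult_mono) auto
  then have "log 2 x \<le> log 2 (4 * N)" using x X by (subst log_le_cancel_iff) auto
  also have "\<dots> = log 2 (2 ^ 2) + log 2 N" using X by (subst log_mult) auto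
  also have "\<dots> = 2 + ln N / ln 2" by (subst log_nat_power) (auto simp: log_def)
  also have "\<dots> \<le> 2 + ln N / (2 / 3)" using l2 L by (intro add_left_mono divide_left_mono) auto
  finally have "log 2 x \<le> 2 + 3 / 2 * ln N" by simp
  then show "real (rounds n1 n2 r) \<le> 4 * ln N" unfolding k using lx L by linarith
qed

text \<open>Bernoulli's inequality: \<open>k0\<close> rounds at rate \<open>p / k0\<close> cover a
  cell with probability at most \<open>p\<close>, so the rate that attains \<open>p\<close> is no
  smaller.\<close>

lemma round_prob_bounds:
  assumes k: "0 < rounds n1 n2 r" and p: "0 \<le> p" "p \<le> 1"
  shows "p / real (rounds n1 n2 r) \<le> round_prob n1 n2 r p" "round_prob n1 n2 r p \<le> 1"
proof -
  define k0 where "k0 = rounds n1 n2 r"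
  have pk: "p / real k0 \<le> 1" using p k by (simp add: k0_def field_simps)
  have "1 + real k0 * (- (p / real k0)) \<le> (1 + (- (p / real k0))) ^ k0"
    by (intro Bernoulli_inequality) (use pk in auto)
  then have le: "1 - p \<le> (1 - p / real k0) ^ k0" using k by (simp add: k0_def)
  have "(1 - p) powr (1 / real k0) \<le> 1 - p / real k0"
  proof (cases "p / real k0 = 1")
    case True
    then have "1 - p \<le> 0" using le k by (simp add: k0_def)
    then show ?thesis using p True by simp
  next
    case False
    then have pos: "0 < 1 - p / real k0" using pk False by linarith
    have "(1 - p) powr (1 / real k0) \<le> ((1 - p / real k0) ^ k0) powr (1 / real k0)"
      using le p by (intro powr_mono2) auto
    also have "\<dots> = 1 - p / real k0" using pos k by (simp add: k0_def powr_realpow[symmetric] powr_powr)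
    finally show ?thesis .
  qed
  then show "p / real (rounds n1 n2 r) \<le> round_prob n1 n2 r p"
    by (simp add: round_prob_def k0_def)
  show "round_prob n1 n2 r p \<le> 1" by (simp add: round_prob_def)
qed

context clipped_completion
begin

text \<open>The one ratio that all concentration bounds need to be small: it dominates
  \<open>tau / q\<close> as well as its spectral counterpart with the squared joint
  coherence.\<close>

definition "load q = max ((joint_coherence U V)\<^sup>2) (coherence U V) * real r * (real n1 + real n2) / (N * q)"

text \<open>\<open>p\<close> is half the moment order. About \<open>2 * ln N\<close> makes the tail
  \<open>N^-4\<close>, so that \<open>N^-3\<close> survives the dimension factor, which is at most
  \<open>N\<close>.\<close>

lemma exponent_choice:
  obtains p :: nat where "0 < p" "real p \<le> 3 * ln N" "exp (- 2 * real p) \<le> 1 / N ^ 4" "4 / 3 \<le> ln N"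
proof -
  have L: "4 / 3 \<le> ln N" using rounds_bounds(4)[OF N r r_le N_def] .
  define p where "p = nat \<lceil>2 * ln N\<rceil>"
  have p: "2 * ln N \<le> real p" "real p \<le> 2 * ln N + 1" unfolding p_def using L by linarith+
  have "exp (- 2 * real p) \<le> exp (- (4 * ln N))" using p by simp
  also have "\<dots> = 1 / N ^ 4" using N by (simp add: exp_minus field_simps exp_of_nat_mult[of 4, simplified])
  finally show ?thesis using that[of p] p L by linarith
qed

lemma n_le_N: "real n1 + real n2 \<le> N"
proof -
  have "0 \<le> (real n1 - 1) * (real n2 - 1) - 1"
    using mult_mono[of 1 "real n1 - 1" 1 "real n2 - 1"] n by simp
  then show ?thesis by (simp add: N_def algebra_simps)
qed

lemma frob_event_failure:
  assumes q: "0 < q" "q \<le> 1" and eps: "0 < eps" "eps \<le> 1" and small: "load q \<le> eps\<^sup>2 / (2000 * ln N)"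
  shows "measure_pmf.prob (bern E q) {\<xi>. \<not> frob_event E tk q B eps \<xi>} \<le> 1 / N ^ 3"
proof -
  obtain p :: nat where p: "0 < p" "real p \<le> 3 * ln N" "exp (- 2 * real p) \<le> 1 / N ^ 4" "4 / 3 \<le> ln N"
    by (rule exponent_choice)
  have "tau / q = coherence U V * real r * (real n1 + real n2) / (N * q)" by (simp add: tau_def)
  also have "\<dots> \<le> load q"
    unfolding load_def using q N by (intro divide_right_mono mult_right_mono) auto
  finally have tq: "tau / q \<le> eps\<^sup>2 / (2000 * ln N)" using small by linarith
  have "96 * real p * (tau / q) \<le> (96 * (3 * ln N)) * (eps\<^sup>2 / (2000 * ln N))"
    using p tq tau_pos q by (intro mult_mono) auto
  also have "\<dots> \<le> eps\<^sup>2" using p by (simp add: field_simps)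
  finally have "measure_pmf.prob (bern E q) {\<xi>. \<not> frob_event E tk q B eps \<xi>} \<le> real (card E) * exp (- 2 * real p)"
    using tau_pos by (intro frob_event_prob[OF finE G q _ eps p(1)]) auto
  also have "\<dots> \<le> N * (1 / N ^ 4)" unfolding cardE using p N by (intro mult_left_mono) auto
  also have "\<dots> = 1 / N ^ 3" using N by (simp add: field_simps eval_nat_numeral)
  finally show ?thesis .
qed

lemma max_event_failure:
  assumes q: "0 < q" "q \<le> 1" and eps: "0 < eps" "eps \<le> 1" and small: "load q \<le> eps\<^sup>2 / (2000 * ln N)"
    and z: "0 < z" "\<And>c. c \<in> E \<Longrightarrow> \<bar>w c\<bar> \<le> z"
  shows "measure_pmf.prob (bern E q) {\<xi>. \<not> max_event E tk q (pstar w) (eps * z) \<xi>} \<le> 1 / N ^ 3"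
proof -
  have L: "4 / 3 \<le> ln N" using rounds_bounds(4)[OF N r r_le N_def] .
  have "tau / q = coherence U V * real r * (real n1 + real n2) / (N * q)" by (simp add: tau_def)
  also have "\<dots> \<le> load q"
    unfolding load_def using q N by (intro divide_right_mono mult_right_mono) auto
  finally have "tau / q \<le> eps\<^sup>2 / (2000 * ln N)" using small by linarith
  then have "500 * ln N \<le> eps\<^sup>2 * q / (4 * tau)" using tau_pos q L by (simp add: field_simps)
  then have "exp (- (eps\<^sup>2 * q / (4 * tau))) \<le> exp (- (5 * ln N))" using L by simp
  also have "\<dots> = 1 / N ^ 5" using N by (simp add: exp_minus field_simps exp_of_nat_mult[of 5, simplified])
  finally have e: "exp (- (eps\<^sup>2 * q / (4 * tau))) \<le> 1 / N ^ 5" .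
  have "measure_pmf.prob (bern E q) {\<xi>. \<not> max_event E tk q (pstar w) (eps * z) \<xi>}
      \<le> real (card E) * (2 * exp (- (eps\<^sup>2 * q / (4 * tau))))"
    using z(2) order_trans[OF abs_pstar_le] eps by (intro max_event_prob[OF finE G q tau_pos _ z(1)]) auto
  also have "\<dots> \<le> N * (2 * (1 / N ^ 5))" unfolding cardE using e N by (intro mult_left_mono) auto
  also have "\<dots> = 2 / N * (1 / N ^ 3)" using N by (simp add: field_simps eval_nat_numeral)
  also have "\<dots> \<le> 1 * (1 / N ^ 3)" using N by (intro mult_right_mono) auto
  finally show ?thesis by simp
qed

lemma spec_event_failure:
  assumes q: "0 < q" "q \<le> 1" and eps: "0 < eps" "eps \<le> 1" and small: "load q \<le> eps\<^sup>2 / (2000 * ln N)"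
    and t: "0 < t" and w: "\<And>c. c \<in> E \<Longrightarrow> \<bar>w c\<bar> \<le> m0 * t"
  shows "measure_pmf.prob (bern E q) {\<xi>. \<not> spec_event n1 n2 q (pstar w) (eps * t) \<xi>} \<le> 1 / N ^ 3"
proof -
  obtain p :: nat where p: "0 < p" "real p \<le> 3 * ln N" "exp (- 2 * real p) \<le> 1 / N ^ 4" "4 / 3 \<le> ln N"
    by (rule exponent_choice)
  define n where "n = real n1 + real n2"
  define b where "b = sqrt (real r) * joint_coherence U V"
  have b1: "1 \<le> b" using mult_mono[of 1 "sqrt (real r)" 1 "joint_coherence U V"] r mu1_ge_1 by (simp add: b_def)
  have n0: "0 < n" and nN: "n \<le> N" using n_le_N clipped_completion_axioms by (auto simp: n_def clipped_completion_def)
  have sN: "sqrt N \<le> n"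
  proof (rule real_le_lsqrt)
    show "N \<le> n\<^sup>2" by (simp add: N_def n_def power2_eq_square algebra_simps add_nonneg_nonneg)
  qed (use N n0 in auto)
  \<comment> \<open>Solves \<open>2 * (m0 * t) * n * s = eps * t\<close>, using
    \<open>sqrt N * m0 = b\<close>. The admissibility condition \<open>s \<le> 1\<close> follows
    from \<open>sqrt N \<le> n\<close> and \<open>b \<ge> 1\<close>.\<close>
  define s where "s = eps * sqrt N / (2 * n * b)"
  have s: "0 < s" using eps N n0 b1 by (simp add: s_def)
  have "eps * sqrt N \<le> 1 * n" using eps sN N by (intro mult_mono) auto
  also have "\<dots> \<le> 2 * n * b" using n0 b1 mult_left_mono[of 1 b "2 * n"] by simp
  finally have s1: "s \<le> 1" using n0 b1 by (simp add: s_def)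
  have z: "0 < m0 * t" using m0_pos t by simp
  have zs: "2 * (m0 * t) * n * s = eps * t"
  proof -
    have "2 * (m0 * t) * n * s = t * eps * (sqrt N * m0) / b" using n0 b1 by (simp add: s_def field_simps)
    also have "sqrt N * m0 = b" by (simp add: mu1 b_def)
    also have "t * eps * b / b = eps * t" using b1 by simp
    finally show ?thesis .
  qed
  have s2: "s\<^sup>2 = eps\<^sup>2 * N / (4 * n\<^sup>2 * b\<^sup>2)" using N by (simp add: s_def power_divide power_mult_distrib)
  have "b\<^sup>2 * n / (N * q) \<le> load q"
    unfolding load_def b_def n_def power_mult_distrib using q N
    by (intro divide_right_mono mult_right_mono) (auto simp: mult.commute intro!: mult_right_mono mult_left_mono)
  then have lb: "b\<^sup>2 * n / (N * q) \<le> eps\<^sup>2 / (2000 * ln N)" using small by linarith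
  \<comment> \<open>Here \<open>384 = 96 * 4\<close>, the 4 coming from \<open>s^2\<close>. With
    \<open>p \<le> 3 * ln N\<close> this needs \<open>1152\<close>, the strongest of the demands
    covered by the constant \<open>2000\<close>.\<close>
  have "96 * real p * (1 / (n * q)) = (384 * real p) * (b\<^sup>2 * n / (N * q)) * (N / (4 * n\<^sup>2 * b\<^sup>2))"
    using n0 b1 N q by (simp add: field_simps power2_eq_square)
  also have "\<dots> \<le> (384 * (3 * ln N)) * (eps\<^sup>2 / (2000 * ln N)) * (N / (4 * n\<^sup>2 * b\<^sup>2))"
    using p lb n0 b1 N q by (intro mult_right_mono mult_mono) auto
  also have "\<dots> \<le> eps\<^sup>2 * (N / (4 * n\<^sup>2 * b\<^sup>2))"
  proof (rule mult_right_mono)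
    show "384 * (3 * ln N) * (eps\<^sup>2 / (2000 * ln N)) \<le> eps\<^sup>2" using p by (simp add: field_simps)
  qed (use N in auto)
  also have "\<dots> = s\<^sup>2" by (simp add: s2)
  finally have cond: "96 * real p * (1 / (n * q)) \<le> s\<^sup>2" .
  have "measure_pmf.prob (bern E q) {\<xi>. \<not> spec_event n1 n2 q (pstar w) (2 * (m0 * t) * n * s) \<xi>} \<le> n * exp (- 2 * real p)"
    unfolding E_def n_def
    using w order_trans[OF abs_pstar_le] cond[unfolded n_def] clipped_completion_axioms
    by (intro spec_event_prob[OF _ _ _ z q s s1 p(1)]) (auto simp: E_def clipped_completion_def)
  also have "\<dots> \<le> N * (1 / N ^ 4)" using p nN N n0 by (intro mult_mono) auto
  also have "\<dots> = 1 / N ^ 3" using N by (simp add: field_simps eval_nat_numeral)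
  finally show ?thesis unfolding zs .
qed

text \<open>The first alternative corresponds to the minimum with 1 in the rate condition: at full
  sampling the noise is identically zero, and no bound on the load is available.\<close>

definition sampling_rate_ok :: "real \<Rightarrow> bool" where
  "sampling_rate_ok q \<longleftrightarrow> q = 1 \<or>
     (\<forall>eps\<in>{1 / 2 - rho_F C M U V, 1 / 4 - rho_op C M U V, 1 / 2 - rho_inf C M U V, 1 / 2 - nu_B C M U V}.
        load q \<le> eps\<^sup>2 / (2000 * ln N))"

lemma bern_one_prob:
  assumes "\<And>\<xi>. (\<And>c. c \<in> E \<Longrightarrow> \<xi> c) \<Longrightarrow> Q \<xi>"
  shows "measure_pmf.prob (bern E 1) {\<xi>. \<not> Q \<xi>} \<le> 0"
  using assms[of "\<lambda>c. c \<in> E"] by (simp add: bern_one[OF finE] measure_return_pmf)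

lemma frob_event_full:
  assumes "0 \<le> s" "\<And>c. c \<in> E \<Longrightarrow> \<xi> c"
  shows "frob_event E tk 1 B s \<xi>"
  using assms by (simp add: frob_event_def nrm_nonneg)

lemma good_round_full:
  assumes rho: "rho_F C M U V < 1 / 2" "rho_op C M U V < 1 / 4" "rho_inf C M U V < 1 / 2"
    and t: "0 < t" and \<xi>: "\<And>c. c \<in> E \<Longrightarrow> \<xi> c"
  shows "good_round 1 w t \<xi>"
proof -
  have "max_event E tk 1 (pstar w) ((1 / 2 - rho_inf C M U V) * (m0 * t)) \<xi>"
    using \<xi> rho t m0_pos by (simp add: max_event_def)
  moreover have "spec_event n1 n2 1 (pstar w) ((1 / 4 - rho_op C M U V) * t) \<xi>"
    using \<xi> rho t by (simp add: spec_event_def E_def nrm_nonneg)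
  moreover have "frob_event E tk 1 (keep w) (1 / 2 - rho_F C M U V) \<xi>"
    using rho by (intro frob_event_full \<xi>) auto
  ultimately show ?thesis by (simp add: good_round_def)
qed

lemma good_round_failure:
  assumes q: "0 < q" "q \<le> 1" and ok: "sampling_rate_ok q"
    and rho: "rho_F C M U V < 1 / 2" "rho_op C M U V < 1 / 4" "rho_inf C M U V < 1 / 2"
    and t: "0 < t"
  shows "measure_pmf.prob (bern E q) {\<xi>. (\<forall>c\<in>E. \<bar>w c\<bar> \<le> m0 * t) \<and> \<not> good_round q w t \<xi>} \<le> 3 / N ^ 3"
proof (cases "q = 1")
  case True
  have "measure_pmf.prob (bern E 1) {\<xi>. (\<forall>c\<in>E. \<bar>w c\<bar> \<le> m0 * t) \<and> \<not> good_round 1 w t \<xi>} \<le>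
      measure_pmf.prob (bern E 1) {\<xi>. \<not> good_round 1 w t \<xi>}"
    by (intro measure_pmf.finite_measure_mono) auto
  also have "\<dots> \<le> 0" using good_round_full[OF rho t] by (intro bern_one_prob) blast
  also have "\<dots> \<le> 3 / N ^ 3" using N by simp
  finally show ?thesis using True by simp
next
  case q1: False
  show ?thesis
  proof (cases "\<forall>c\<in>E. \<bar>w c\<bar> \<le> m0 * t")
    case True
    let ?F = "{\<xi>. \<not> frob_event E tk q (keep w) (1 / 2 - rho_F C M U V) \<xi>}"
    let ?I = "{\<xi>. \<not> max_event E tk q (pstar w) ((1 / 2 - rho_inf C M U V) * (m0 * t)) \<xi>}"
    let ?O = "{\<xi>. \<not> spec_event n1 n2 q (pstar w) ((1 / 4 - rho_op C M U V) * t) \<xi>}"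
    have "measure_pmf.prob (bern E q) {\<xi>. (\<forall>c\<in>E. \<bar>w c\<bar> \<le> m0 * t) \<and> \<not> good_round q w t \<xi>} \<le>
        measure_pmf.prob (bern E q) (?F \<union> ?I \<union> ?O)"
      by (intro measure_pmf.finite_measure_mono) (auto simp: good_round_def)
    also have "\<dots> \<le> measure_pmf.prob (bern E q) (?F \<union> ?I) + measure_pmf.prob (bern E q) ?O"
      by (intro measure_subadditive) auto
    also have "\<dots> \<le> measure_pmf.prob (bern E q) ?F + measure_pmf.prob (bern E q) ?I + measure_pmf.prob (bern E q) ?O"
      by (intro add_right_mono measure_subadditive) auto
    also have "\<dots> \<le> 1 / N ^ 3 + 1 / N ^ 3 + 1 / N ^ 3"
      using ok q1 rho rho_F_nonneg rho_op_nonneg rho_inf_nonneg True m0_pos t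
      by (intro add_mono frob_event_failure[OF q] max_event_failure[OF q] spec_event_failure[OF q])
        (auto simp: sampling_rate_ok_def)
    finally show ?thesis by simp
  next
    case False
    then have empty: "{\<xi>. (\<forall>c\<in>E. \<bar>w c\<bar> \<le> m0 * t) \<and> \<not> good_round q w t \<xi>} = {}" by auto
    show ?thesis unfolding empty using N by simp
  qed
qed

lemma injectivity_failure:
  assumes q: "0 < q" "q \<le> 1" and ok: "sampling_rate_ok q" and nu: "nu_B C M U V < 1 / 2"
  shows "measure_pmf.prob (bern E q) {\<xi>. \<not> frob_event E tk q below (1 / 2 - nu_B C M U V) \<xi>} \<le> 3 / N ^ 3"
proof (cases "q = 1")
  case True
  have "measure_pmf.prob (bern E 1) {\<xi>. \<not> frob_event E tk 1 below (1 / 2 - nu_B C M U V) \<xi>} \<le> 0"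
    using nu by (intro bern_one_prob frob_event_full) auto
  also have "0 \<le> 3 / N ^ 3" using N by simp
  finally show ?thesis using True by simp
next
  case False
  have "measure_pmf.prob (bern E q) {\<xi>. \<not> frob_event E tk q below (1 / 2 - nu_B C M U V) \<xi>} \<le> 1 / N ^ 3"
    using ok False nu nu_B_nonneg by (intro frob_event_failure[OF q]) (auto simp: sampling_rate_ok_def)
  also have "\<dots> \<le> 3 / N ^ 3" using N by (intro divide_right_mono) auto
  finally show ?thesis .
qed

text \<open>The residual bound is part of the bad event \<open>bad k\<close>, so that its conditional probability given the
  other rounds is small for every history; along a sample without bad events the bound holds
  by induction.\<close>

lemma recovery_probability:
  fixes p :: real
  defines "k0 \<equiv> rounds n1 n2 r" and "q \<equiv> round_prob n1 n2 r p"
  assumes q: "0 < q" "q \<le> 1" "1 / N \<le> q" and ok: "sampling_rate_ok q"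
    and rho: "rho_F C M U V < 1 / 2" "rho_op C M U V < 1 / 4" "rho_inf C M U V < 1 / 2"
    and nu: "nu_B C M U V < 1 / 2"
  shows "1 - (real k0 + 1) * (3 / N ^ 3) \<le> measure_pmf.prob (sampling n1 n2 r p) {\<Omega>. solutions C M \<Omega> = {M}}"
proof -
  note k0 = rounds_bounds(1,2)[OF N r r_le N_def, folded k0_def]
  define R where "R = {1..k0}"
  define Om where "Om \<xi> = (\<Union>k\<in>R. {(i, j). i < n1 \<and> j < n2 \<and> \<xi> (k, i, j)})" for \<xi> :: "nat \<times> nat \<times> nat \<Rightarrow> bool"
  define D where "D = bern (R \<times> E) q"
  have samp: "sampling n1 n2 r p = map_pmf Om D"
    by (simp add: sampling_def Om_def[abs_def] D_def R_def bern_def E_def k0_def q_def)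
  define bad where "bad k \<xi> \<longleftrightarrow> (\<forall>c\<in>E. \<bar>golf q \<xi> k c\<bar> \<le> m0 * (1 / 2 ^ k)) \<and>
      \<not> good_round q (golf q \<xi> k) (1 / 2 ^ k) (\<lambda>c. \<xi> (Suc k, c))" for k and \<xi> :: "nat \<times> nat \<times> nat \<Rightarrow> bool"
  define badB where "badB \<xi> \<longleftrightarrow> \<not> frob_event E tk q below (1 / 2 - nu_B C M U V) (\<lambda>c. \<xi> (1, c))" for \<xi> :: "nat \<times> nat \<times> nat \<Rightarrow> bool"
  have finR: "finite R" by (simp add: R_def)
  have q0: "0 \<le> q" using q by simp
  have Pbad: "measure_pmf.prob D {\<xi>. bad k \<xi>} \<le> 3 / N ^ 3" if k: "k < k0" for k
    unfolding D_def
  proof (rule bern_round_bound[OF finR finE _ q0 q(2), where k = "Suc k" and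
        Bad = "\<lambda>g \<xi>. (\<forall>c\<in>E. \<bar>golf q g k c\<bar> \<le> m0 * (1 / 2 ^ k)) \<and> \<not> good_round q (golf q g k) (1 / 2 ^ k) \<xi>"])
    show "Suc k \<in> R" using k by (simp add: R_def)
    show "measure_pmf.prob (bern E q) {\<xi>. (\<forall>c\<in>E. \<bar>golf q g k c\<bar> \<le> m0 * (1 / 2 ^ k)) \<and>
        \<not> good_round q (golf q g k) (1 / 2 ^ k) \<xi>} \<le> 3 / N ^ 3" for g
      by (intro good_round_failure q ok rho) auto
    fix \<xi> assume b: "bad k \<xi>"
    \<comment> \<open>The residual after \<open>k\<close> rounds reads only rounds up to
      \<open>k\<close>, so blanking out round \<open>Suc k\<close> leaves it intact.\<close>
    have "golf q (\<lambda>(l, c). l \<noteq> Suc k \<and> \<xi> (l, c)) k = golf q \<xi> k"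
      by (intro golf_cong) auto
    then show "(\<forall>c\<in>E. \<bar>golf q (\<lambda>(l, c). l \<noteq> Suc k \<and> \<xi> (l, c)) k c\<bar> \<le> m0 * (1 / 2 ^ k)) \<and>
        \<not> good_round q (golf q (\<lambda>(l, c). l \<noteq> Suc k \<and> \<xi> (l, c)) k) (1 / 2 ^ k) (\<lambda>c. \<xi> (Suc k, c))"
      using b by (simp add: bad_def)
  qed
  have PbadB: "measure_pmf.prob D {\<xi>. badB \<xi>} \<le> 3 / N ^ 3"
    unfolding D_def
  proof (rule bern_round_bound[OF finR finE _ q0 q(2), where k = 1 and
        Bad = "\<lambda>g \<xi>. \<not> frob_event E tk q below (1 / 2 - nu_B C M U V) \<xi>"])
    show "1 \<in> R" using k0 by (simp add: R_def)
  qed (use injectivity_failure[OF q(1,2) ok nu] in \<open>auto simp: badB_def\<close>)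
  have succ: "solutions C M (Om \<xi>) = {M}" if nb: "\<And>k. k < k0 \<Longrightarrow> \<not> bad k \<xi>" "\<not> badB \<xi>" for \<xi>
  proof -
    have "good_round q (golf q \<xi> k) (1 / 2 ^ k) (\<lambda>c. \<xi> (Suc k, c))" if "k < k0" for k
      using that
    proof (induction k rule: less_induct)
      case (less k)
      have "\<forall>c\<in>E. \<bar>golf q \<xi> k c\<bar> \<le> m0 * (1 / 2 ^ k)"
        using golf_bounds[OF q(1) rho(1), of k \<xi> k] less by auto
      then show ?case using nb(1)[OF less.prems] by (simp add: bad_def)
    qed
    from golf_success[OF q(1,3) k0 rho(1) nu this] nb(2)
    show ?thesis by (simp add: Om_def R_def badB_def)
  qed
  have "measure_pmf.prob D {\<xi>. solutions C M (Om \<xi>) \<noteq> {M}} \<le>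
      measure_pmf.prob D ({\<xi>. badB \<xi>} \<union> (\<Union>k<k0. {\<xi>. bad k \<xi>}))"
    using succ by (intro measure_pmf.finite_measure_mono) auto
  also have "\<dots> \<le> measure_pmf.prob D {\<xi>. badB \<xi>} + measure_pmf.prob D (\<Union>k<k0. {\<xi>. bad k \<xi>})"
    by (intro measure_subadditive) auto
  also have "\<dots> \<le> measure_pmf.prob D {\<xi>. badB \<xi>} + (\<Sum>k<k0. measure_pmf.prob D {\<xi>. bad k \<xi>})"
    by (intro add_left_mono measure_UNION_le) auto
  also have "\<dots> \<le> 3 / N ^ 3 + (\<Sum>k<k0. 3 / N ^ 3)"
    using Pbad PbadB by (intro add_mono sum_mono) auto
  also have "\<dots> = (real k0 + 1) * (3 / N ^ 3)" by (simp add: algebra_simps add_divide_distrib)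
  finally have "measure_pmf.prob D {\<xi>. solutions C M (Om \<xi>) \<noteq> {M}} \<le> (real k0 + 1) * (3 / N ^ 3)" .
  moreover have "measure_pmf.prob D {\<xi>. solutions C M (Om \<xi>) \<noteq> {M}} =
      1 - measure_pmf.prob D {\<xi>. solutions C M (Om \<xi>) = {M}}"
    using measure_pmf.prob_compl[of "{\<xi>. solutions C M (Om \<xi>) = {M}}" D]
    by (simp add: Compl_eq[symmetric] Collect_neg_eq Compl_eq_Diff_UNIV)
  ultimately show ?thesis by (simp add: samp vimage_def)
qed

text \<open>Bookkeeping of constants. From \<open>p \<le> q * k0 \<le> 4 * q * ln N\<close> the
  factor \<open>1000\<close> becomes \<open>250\<close>, and one of the two logarithms is spent.
  Each entry of \<open>c_rho\<close> is at least \<open>8 / eps^2\<close>, which yields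
  \<open>250 * 8 = 2000\<close>. In the failure probability \<open>15\<close> is
  \<open>5 * 3\<close>: at most \<open>5 * ln N\<close> bad events of probability
  \<open>3 / N^3\<close>.\<close>

lemma exact_recovery:
  fixes p :: real
  assumes rho: "rho_F C M U V < 1 / 2" "rho_op C M U V < 1 / 4" "rho_inf C M U V < 1 / 2"
    and nu: "nu_B C M U V < 1 / 2" and p: "0 \<le> p" "p \<le> 1"
    and rate: "min 1 (c_rho C M U V * max ((joint_coherence U V)\<^sup>2) (coherence U V) * real r *
      (1000 * ((real n1 + real n2) * (ln (real n1 * real n2))\<^sup>2 / (real n1 * real n2)))) \<le> p"
  shows "1 - 15 * (ln (real n1 * real n2) / (real n1 + real n2)\<^sup>2) \<le>
    measure_pmf.prob (sampling n1 n2 r p) {\<Omega>. solutions C M \<Omega> = {M}}"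
proof -
  define k0 where "k0 = rounds n1 n2 r"
  define q where "q = round_prob n1 n2 r p"
  define mu where "mu = max ((joint_coherence U V)\<^sup>2) (coherence U V)"
  define nn where "nn = real n1 + real n2"
  define L where "L = ln N"
  note rb = rounds_bounds[OF N r r_le N_def, folded k0_def L_def]
  have qk: "p / real k0 \<le> q" "q \<le> 1"
    using round_prob_bounds[OF _ p, of n1 n2 r] rb(1) by (auto simp: k0_def q_def)
  have mu: "1 \<le> mu" using coherence_ge_1 by (simp add: mu_def)
  have nn: "4 \<le> nn" "nn \<le> N" using n n_le_N by (simp_all add: nn_def)
  define cr where "cr = c_rho C M U V"
  have c_ge: "8 / eps\<^sup>2 \<le> cr"
    if "eps \<in> {1 / 2 - rho_F C M U V, 1 / 4 - rho_op C M U V, 1 / 2 - rho_inf C M U V, 1 / 2 - nu_B C M U V}" for eps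
  proof -
    have "8 / (1 / 2 - rho_F C M U V)\<^sup>2 \<le> 24 / (1 / 2 - rho_F C M U V)\<^sup>2" by (intro divide_right_mono) auto
    moreover have "24 / (1 / 2 - rho_F C M U V)\<^sup>2 \<le> cr" "8 / (1 / 4 - rho_op C M U V)\<^sup>2 \<le> cr"
      "8 / (1 / 2 - rho_inf C M U V)\<^sup>2 \<le> cr" "8 / (1 / 2 - nu_B C M U V)\<^sup>2 \<le> cr"
      unfolding cr_def c_rho_def by (intro Max_ge; simp)+
    ultimately show ?thesis using that by auto
  qed
  have cr8: "8 \<le> cr"
  proof -
    have "(1 / 2 - rho_F C M U V)\<^sup>2 \<le> 1\<^sup>2" using rho rho_F_nonneg by (intro power_mono) auto
    then have "8 / 1 \<le> 8 / (1 / 2 - rho_F C M U V)\<^sup>2" using rho by (intro divide_left_mono) auto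
    then show ?thesis using c_ge[of "1 / 2 - rho_F C M U V"] by simp
  qed
  have qs: "0 < q \<and> 1 / N \<le> q \<and> sampling_rate_ok q"
  proof (cases "p = 1")
    case True
    then have "q = 1" using rb(1) by (simp add: q_def round_prob_def k0_def)
    then show ?thesis using N by (simp add: sampling_rate_ok_def)
  next
    case False
    have "cr * mu * real r * (1000 * (nn * L\<^sup>2 / N)) \<le> p"
      using rate False p by (auto simp: min_def cr_def mu_def nn_def L_def N_def split: if_splits)
    moreover have "p \<le> q * (4 * L)"
    proof -
      have "p \<le> q * real k0" using qk(1) rb(1) by (simp add: field_simps)
      moreover have "0 \<le> q" using qk(1) p rb(1) by (meson divide_nonneg_nonneg of_nat_0_le_iff order_trans)
      ultimately show ?thesis using rb(3) by (meson mult_left_mono order_trans)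
    qed
    ultimately have "cr * mu * real r * (1000 * (nn * L\<^sup>2 / N)) \<le> q * (4 * L)" by linarith
    then have qN: "250 * cr * mu * real r * nn * L \<le> q * N"
      using rb(4) N by (simp add: field_simps power2_eq_square)
    have big: "1 \<le> mu * real r * nn"
      using mult_mono[of 1 mu 1 "real r"] mult_mono[of 1 "mu * real r" 1 nn] mu r nn by simp
    have load_pos: "0 < mu * real r * nn" using big by linarith
    have "1 * 1 \<le> (250 * cr * L) * (mu * real r * nn)"
      using cr8 rb(4) big mult_mono[of 1 "250 * cr" 1 L] by (intro mult_mono) auto
    also have "\<dots> \<le> q * N" using qN by (simp add: algebra_simps)
    \<comment> \<open>This is the lower bound \<open>1 / N\<close> on the rate of a single round, as
      required by the injectivity estimate.\<close>
    finally have qN1: "1 \<le> q * N" by simp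
    then have q0: "0 < q" using N by (smt (verit) mult_nonpos_nonneg)
    have "load q \<le> eps\<^sup>2 / (2000 * L)"
      if eps: "eps \<in> {1 / 2 - rho_F C M U V, 1 / 4 - rho_op C M U V, 1 / 2 - rho_inf C M U V, 1 / 2 - nu_B C M U V}" for eps
    proof -
      have e0: "0 < eps" using eps rho nu by auto
      have "8 \<le> cr * eps\<^sup>2" using c_ge[OF eps] e0 by (simp add: field_simps)
      have "load q = mu * real r * nn / (N * q)" by (simp add: load_def mu_def nn_def)
      also have "\<dots> \<le> mu * real r * nn / (250 * cr * mu * real r * nn * L)"
      proof (rule divide_left_mono)
        have "0 < (250 * cr * L) * (mu * real r * nn)"
          using cr8 rb(4) by (intro mult_pos_pos load_pos) auto
        then have "0 < 250 * cr * mu * real r * nn * L" by (simp only: mult_ac)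
        then show "0 < N * q * (250 * cr * mu * real r * nn * L)" using q0 N by simp
      qed (use qN load_pos in \<open>auto simp: mult.commute\<close>)
      also have "\<dots> = 1 / (250 * cr * L)" using mu nn r by (simp add: field_simps)
      also have "\<dots> \<le> eps\<^sup>2 / (2000 * L)"
        using \<open>8 \<le> cr * eps\<^sup>2\<close> cr8 rb(4) by (simp add: field_simps)
      finally show ?thesis .
    qed
    then show ?thesis using q0 qN1 N by (auto simp: sampling_rate_ok_def L_def field_simps)
  qed
  have "1 - (real k0 + 1) * (3 / N ^ 3) \<le> measure_pmf.prob (sampling n1 n2 r p) {\<Omega>. solutions C M \<Omega> = {M}}"
    using recovery_probability[of p] qs qk(2) rho nu by (simp add: k0_def q_def)
  moreover have "(real k0 + 1) * (3 / N ^ 3) \<le> 15 * (L / nn\<^sup>2)"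
  proof -
    have "(real k0 + 1) * (3 / N ^ 3) \<le> (5 * L) * (3 / nn\<^sup>2)"
    proof (intro mult_mono divide_left_mono)
      \<comment> \<open>The failure bound is converted from the number of cells to the sum of the
        dimensions, which is at most \<open>N\<close> because both dimensions are at least
        2.\<close>
      have "nn\<^sup>2 \<le> N\<^sup>2" using nn by (intro power_mono) auto
      also have "\<dots> \<le> N ^ 3" using N by (intro power_increasing) auto
      finally show "nn\<^sup>2 \<le> N ^ 3" .
    qed (use rb N nn in auto)
    then show ?thesis by simp
  qed
  ultimately show ?thesis by (simp add: L_def nn_def N_def)
qed

end

theorem theorem1:
  "\<exists>f \<delta> :: nat \<Rightarrow> nat \<Rightarrow> real.
     (\<lambda>(n1, n2). f n1 n2) \<in> O[sequentially \<times>\<^sub>F sequentially](\<lambda>(n1, n2).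
        (real n1 + real n2) * (ln (real n1 * real n2))\<^sup>2 / (real n1 * real n2)) \<and>
     (\<lambda>(n1, n2). \<delta> n1 n2) \<in> O[sequentially \<times>\<^sub>F sequentially](\<lambda>(n1, n2).
        ln (real n1 * real n2) / (real n1 + real n2)\<^sup>2) \<and>
     (\<forall>n1 n2 r :: nat. \<forall>M U S V :: real mat. \<forall>C p :: real.
        n1 \<ge> 2 \<longrightarrow> n2 \<ge> 2 \<longrightarrow>
        M \<in> carrier_mat n1 n2 \<longrightarrow> vec_space.rank n1 M = r \<longrightarrow> r \<ge> 1 \<longrightarrow>
        skinny_svd M r U S V \<longrightarrow>
        rho_F C M U V < 1/2 \<longrightarrow> rho_op C M U V < 1/4 \<longrightarrow>
        rho_inf C M U V < 1/2 \<longrightarrow> nu_B C M U V < 1/2 \<longrightarrow>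
        0 \<le> p \<longrightarrow> p \<le> 1 \<longrightarrow> p \<ge> 1 / (real n1 * real n2) \<longrightarrow>
        p \<ge> min 1 (c_rho C M U V * max ((joint_coherence U V)\<^sup>2) (coherence U V) * real r * f n1 n2) \<longrightarrow>
        measure_pmf.prob (sampling n1 n2 r p) {\<Omega>. solutions C M \<Omega> = {M}} \<ge> 1 - \<delta> n1 n2)"
proof -
  define f where "f n1 n2 = 1000 * ((real n1 + real n2) * (ln (real n1 * real n2))\<^sup>2 / (real n1 * real n2))"
    for n1 n2 :: nat
  define \<delta> where "\<delta> n1 n2 = 15 * (ln (real n1 * real n2) / (real n1 + real n2)\<^sup>2)" for n1 n2 :: nat
  have f: "(\<lambda>(n1, n2). f n1 n2) \<in> O[sequentially \<times>\<^sub>F sequentially](\<lambda>(n1, n2).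
        (real n1 + real n2) * (ln (real n1 * real n2))\<^sup>2 / (real n1 * real n2))"
    by (intro bigoI[where c = 1000] always_eventually) (auto simp: f_def abs_mult)
  have \<delta>: "(\<lambda>(n1, n2). \<delta> n1 n2) \<in> O[sequentially \<times>\<^sub>F sequentially](\<lambda>(n1, n2).
        ln (real n1 * real n2) / (real n1 + real n2)\<^sup>2)"
    by (intro bigoI[where c = 15] always_eventually) (auto simp: \<delta>_def abs_mult)
  have main: "1 - \<delta> n1 n2 \<le> measure_pmf.prob (sampling n1 n2 r p) {\<Omega>. solutions C M \<Omega> = {M}}"
    if "n1 \<ge> 2" "n2 \<ge> 2" "M \<in> carrier_mat n1 n2" "r \<ge> 1" "skinny_svd M r U S V"
      "rho_F C M U V < 1/2" "rho_op C M U V < 1/4" "rho_inf C M U V < 1/2" "nu_B C M U V < 1/2"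
      "0 \<le> p" "p \<le> 1"
      "p \<ge> min 1 (c_rho C M U V * max ((joint_coherence U V)\<^sup>2) (coherence U V) * real r * f n1 n2)"
    for n1 n2 r :: nat and M U S V :: "real mat" and C p :: real
  proof -
    interpret clipped_completion M U S V n1 n2 r C using that by unfold_locales
    show ?thesis using exact_recovery[of p] that by (simp add: f_def \<delta>_def)
  qed
  show ?thesis
    by (rule exI[of _ f], rule exI[of _ \<delta>]) (use f \<delta> main in blast)
qed

end
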